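(* There exists $y_\ast\in(2,3)$ and a pair of real-analytic functions $(\tilde\rho,\tilde\omega)$ on $[0,\infty)$ such that: (i) $(\tilde\rho,\tilde\omega)$ solves $$\tilde\rho' = -\frac{2y\tilde\omega\tilde\rho}{1-y^2\tilde\omega^2}(\tilde\rho-\tilde\omega),\qquad \tilde\omega' = \frac{1-3\tilde\omega}{y}+\frac{2y\tilde\omega^2}{1-y^2\tilde\omega^2}(\tilde\rho-\tilde\omega),\qquad {}'=\frac{d}{dy},$$ on $(0,\infty)\setminus\{y_\ast\}$ (the points $y=0$ and $y=y_\ast$ being removable singularities); (ii) $\tilde\omega(0)=\frac13$, $\tilde\rho(0)>0$, $\tilde\rho(y)\sim y^{-2}$ as $y\to\infty$, and $\lim_{y\to\infty}\tilde\omega(y)=1$; (iii) $y_\ast$ is the only sonic point of $(\tilde\rho,\tilde\omega)$; (iv) as $y\to y_\ast$, $$\tilde\rho(y)=\frac1{y_\ast}-\frac1{y_\ast^2}(y-y_\ast)+\frac{-y_\ast^2+6y_\ast-7}{2y_\ast^3(2y_\ast-3)}(y-y_\ast)^2+O(|y-y_\ast|^3),$$ $$\tilde\omega(y)=\frac1{y_\ast}+\frac1{y_\ast}\Big(1-\frac2{y_\ast}\Big)(y-y_\ast)+\frac{-5y_\ast^2+19y_\ast-17}{2y_\ast^3(2y_\ast-3)}(y-y_\ast)^2+O(|y-y_\ast|^3);$$ (v) $\tilde\rho(y)>0$ for all $y\in[0,\infty)$, and with $\tilde u(y):=y(\tilde\omega(y)-1)$, $$-\frac23 y\le\tilde u(y)<0,\qquad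 y\in(0,\infty).$$
   Context: A point $y_\ast>0$ is called a sonic point of $(\tilde\rho,\tilde\omega)$ if $1-y_\ast^2\tilde\omega^2(y_\ast)=0$. Here $\tilde u$ is the velocity profile, related to the relative velocity $\tilde\omega$ by $\tilde\omega=(\tilde u(y)+y)/y$. The notation $\tilde\rho(y)\sim y^{-2}$ as $y\to\infty$ means that $y^2\tilde\rho(y)$ converges to a finite positive constant. Real-analytic on $[0,\infty)$ means real-analytic on a neighbourhood of each point, with one-sided convergent power series at $y=0$. (This is the self-similar system for the radially symmetric isothermal gravitational Euler-Poisson equations $\partial_t\varrho+(\partial_r+\frac2r)(\varrho u)=0$, $\varrho(\partial_tu+u\partial_ru)+\partial_rp+\varrho m/r^2=0$, $m(t,r)=\int_0^r4\pi\sigma^2\varrho(t,\sigma)\,d\sigma$, $p=k\varrho$, $k>0$, under $\varrho(t,r)=(\sqrt{2\pi k}\,t)^{-2}\tilde\rho(y)$, $u(t,r)=\sqrt k\,\tilde u(y)$, $y=\frac{r}{-\sqrt k\,t}$.) *)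

theory Defs
  imports "HOL-Analysis.Analysis" "HOL-Library.Landau_Symbols"
begin

text \<open>
  Real-analyticity on the half-line \<open>[0,\<infinity>)\<close>. For \<open>x > 0\<close> one may shrink \<open>r\<close> below \<open>x\<close>, so this is
  the usual two-sided notion there; at \<open>x = 0\<close> it is a one-sided convergent power series, and the
  values of \<open>f\<close> on the negative reals are irrelevant.
\<close>

definition real_analytic_half_line :: "(real \<Rightarrow> real) \<Rightarrow> bool" where
  "real_analytic_half_line f \<longleftrightarrow>
     (\<forall>x\<ge>0. \<exists>r>0. \<exists>a :: nat \<Rightarrow> real.
        \<forall>y\<ge>0. \<bar>y - x\<bar> < r \<longrightarrow> (\<lambda>n. a n * (y - x) ^ n) sums f y)"

definition rho_rhs :: "(real \<Rightarrow> real) \<Rightarrow> (real \<Rightarrow> real) \<Rightarrow> real \<Rightarrow> real" where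
  "rho_rhs \<rho> \<omega> y =
     - (2 * y * \<omega> y * \<rho> y / (1 - y\<^sup>2 * (\<omega> y)\<^sup>2)) * (\<rho> y - \<omega> y)"

definition omega_rhs :: "(real \<Rightarrow> real) \<Rightarrow> (real \<Rightarrow> real) \<Rightarrow> real \<Rightarrow> real" where
  "omega_rhs \<rho> \<omega> y =
     (1 - 3 * \<omega> y) / y + (2 * y * (\<omega> y)\<^sup>2 / (1 - y\<^sup>2 * (\<omega> y)\<^sup>2)) * (\<rho> y - \<omega> y)"

definition sonic_point :: "(real \<Rightarrow> real) \<Rightarrow> real \<Rightarrow> bool" where
  "sonic_point \<omega> y \<longleftrightarrow> y > 0 \<and> 1 - y\<^sup>2 * (\<omega> y)\<^sup>2 = 0"

definition velocity :: "(real \<Rightarrow> real) \<Rightarrow> real \<Rightarrow> real" where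
  "velocity \<omega> y = y * (\<omega> y - 1)"

text \<open>
  The singularities of \<open>g\<close> at \<open>0\<close> and at \<open>z\<close> are removable: off these two points \<open>g\<close> agrees
  with a function that is real-analytic on the whole half-line. The values of \<open>g\<close> at \<open>0\<close> and \<open>z\<close>
  (where HOL's division by zero returns zero) play no role.
\<close>

definition removable_at_0_and :: "real \<Rightarrow> (real \<Rightarrow> real) \<Rightarrow> bool" where
  "removable_at_0_and z g \<longleftrightarrow>
     (\<exists>h. real_analytic_half_line h \<and> (\<forall>y\<in>{0<..} - {z}. g y = h y))"

end

theory Submission
  imports Defs "HOL-Complex_Analysis.Complex_Analysis"
begin

text \<open>
  Put \<open>x = y \<omega>\<close> and \<open>s = y \<rho>\<close>. The system becomes
  \<open>x' = 1 - 2 x (1 - x s) / (y (1 - x\<^sup>2))\<close>, \<open>s' = s (1 + x\<^sup>2 - 2 x s) / (y (1 - x\<^sup>2))\<close>, and a sonic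
  point of a solution with \<open>x > 0\<close> is a point where \<open>x = 1\<close>. A smooth passage through \<open>x = 1\<close> forces
  \<open>s = 1\<close>, so the candidates form a one-parameter family indexed by the sonic point \<open>z\<close>; the proof
  shoots from \<open>y = z\<close> and adjusts \<open>z\<close> in \<open>(2,3)\<close> until the solution reaches the centre.

  The germ (\<open>sonic_germ_exists\<close>). Along \<open>x = s = 1\<close> the desingularised flow has the two transversal
  rates \<open>2 (z - 1)\<close> and \<open>2\<close>; the prescribed slopes \<open>x' = 1 - 1/z\<close>, \<open>s' = 0\<close> belong to the rate
  \<open>2 (z - 1)\<close>, the faster one for \<open>z > 2\<close>. After the second-order ansatz
  \<open>x = 1 + (1 - 1/z) t + t\<^sup>2 u\<close>, \<open>s = 1 + t\<^sup>2 v\<close> with \<open>t = y - z\<close> the system is of Briot-Bouquet type,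
  \<open>t u' + 2 u = \<dots>\<close> and \<open>t v' + (2 - 1/(z - 1)) v = \<dots>\<close>. Both exponents are at least \<open>1\<close>, so the
  operators on the left have bounded inverses on holomorphic functions and Picard iteration converges
  (\<open>triangular_briot_bouquet\<close>), on a disc that does not depend on \<open>z\<close> and with Lipschitz dependence
  on \<open>z\<close>.

  Shooting to the left (\<open>critical_parameter\<close>, \<open>left_solution\<close>). The homogeneous solution
  \<open>x = s = y/3\<close> (Friedmann) and the line \<open>x = y/2\<close> bound a region containing the germ for
  \<open>2 < z < 3\<close>. Followed towards the centre, the solution may fall below \<open>x = y/3\<close>, or it may first
  reach \<open>x = s\<close> or \<open>x = y/2\<close>. Both kinds of exit are transversal, hence open in \<open>z\<close>, and they exclude
  each other. The Taylor coefficients of the germ show that the first happens for \<open>z\<close> close to \<open>3\<close> and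
  the second for \<open>z\<close> close to \<open>2\<close>. As \<open>(2,3)\<close> is connected, for some \<open>z\<close> neither happens. For that
  \<open>z\<close> the solution stays in \<open>y/3 < x < y/2\<close>, \<open>x < s < 1\<close>; it cannot leave through the corner
  \<open>x = s = y/3\<close>, because it would then be the Friedmann solution, and it cannot reach \<open>s = 1\<close>, where
  \<open>s\<close> is increasing. In the region \<open>x\<close> is increasing in \<open>y\<close>, so \<open>x\<close> stays away from \<open>1\<close> and the
  solution exists on all of \<open>(0,z)\<close>.

  To the right (\<open>right_solution\<close>, \<open>far_field\<close>). The region \<open>s < 1 < x s\<close>, \<open>y/3 < x < y\<close> is
  forward invariant for every \<open>z\<close>, mainly because of the identity \<open>(x s)' = s (1 - x/y)\<close>. Inside
  it \<open>(y - x)' \<le> 2/y\<close>, so \<open>\<omega> = x/y\<close> tends to \<open>1\<close>, and \<open>x s\<close> is increasing and bounded, so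
  \<open>y\<^sup>2 \<rho> = y s\<close> has a positive limit.

  Analyticity. Near a regular point and near the sonic point the solution comes from a holomorphic one
  by construction. At the centre, \<open>\<rho>\<close> is monotone with bounded logarithmic derivative, which gives
  \<open>\<rho> = c + O(y)\<close>; a holomorphic solution with \<open>\<rho>(0) = c\<close> exists by the Briot-Bouquet theorem again,
  and the stability estimate \<open>euler_system_stability\<close> identifies the two (\<open>centre_extension\<close>).
\<close>

section \<open>The Euler operator and Briot-Bouquet systems\<close>

text \<open>
  The equation says \<open>(\<theta>\<^sup>k p)' = \<theta>\<^sup>k\<^sup>-\<^sup>1 a\<close>; boundedness of \<open>p\<close> kills the boundary term at \<open>0\<close>, and
  \<open>\<integral> \<theta>\<^sup>k\<^sup>-\<^sup>1 d\<theta> = T\<^sup>k / k\<close>. No integral is formed: on \<open>[e,T]\<close> the growth of \<open>\<theta>\<^sup>k p\<close> is compared with that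
  of \<open>M \<theta>\<^sup>k / k\<close>, and then \<open>e\<close> tends to \<open>0\<close>.
\<close>

lemma euler_operator_bound:
  fixes p :: "real \<Rightarrow> 'a::real_normed_vector"
  assumes k: "k > 0" and T: "T > 0"
    and der: "\<And>\<theta>. \<theta> \<in> {0<..T} \<Longrightarrow> (p has_vector_derivative p' \<theta>) (at \<theta>)"
    and eq: "\<And>\<theta>. \<theta> \<in> {0<..T} \<Longrightarrow> \<theta> *\<^sub>R p' \<theta> + k *\<^sub>R p \<theta> = a \<theta>"
    and a: "\<And>\<theta>. \<theta> \<in> {0<..T} \<Longrightarrow> norm (a \<theta>) \<le> M"
    and bd: "\<And>\<theta>. \<theta> \<in> {0<..T} \<Longrightarrow> norm (p \<theta>) \<le> B"
  shows "norm (p T) \<le> M / k"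
proof -
  have key: "T powr k * norm (p T) \<le> M / k * T powr k + e powr k * \<bar>B\<bar>" if e: "0 < e" "e < T" for e
  proof -
    let ?F = "\<lambda>\<theta>. (\<theta> powr k) *\<^sub>R p \<theta>"
    have dF: "(?F has_vector_derivative (\<theta> powr (k-1)) *\<^sub>R a \<theta>) (at \<theta>)" if "\<theta> \<in> {0<..T}" for \<theta>
    proof -
      have t: "\<theta> > 0" using that by auto
      have "((\<lambda>\<theta>. \<theta> powr k) has_real_derivative k * \<theta> powr (k-1)) (at \<theta>)"
        using t by (auto intro!: derivative_eq_intros)
      from has_vector_derivative_scaleR[OF this der[OF that]]
      have "(?F has_vector_derivative (\<theta> powr k) *\<^sub>R p' \<theta> + (k * \<theta> powr (k-1)) *\<^sub>R p \<theta>) (at \<theta>)" .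
      moreover have "(\<theta> powr k) *\<^sub>R p' \<theta> + (k * \<theta> powr (k-1)) *\<^sub>R p \<theta> = (\<theta> powr (k-1)) *\<^sub>R a \<theta>"
      proof -
        have "\<theta> powr k = \<theta> powr (k-1) * \<theta>" using t by (simp add: powr_diff)
        then show ?thesis by (simp add: eq[OF that, symmetric] algebra_simps)
      qed
      ultimately show ?thesis by simp
    qed
    have dG: "((\<lambda>\<theta>. M / k * \<theta> powr k) has_vector_derivative M * \<theta> powr (k-1)) (at \<theta>)" if "\<theta> > 0" for \<theta>
      unfolding has_real_derivative_iff_has_vector_derivative[symmetric]
      using that k by (auto intro!: derivative_eq_intros)
    have "norm (?F T - ?F e) \<le> M / k * T powr k - M / k * e powr k"
    proof (rule differentiable_bound_general[where f' = "\<lambda>\<theta>. (\<theta> powr (k-1)) *\<^sub>R a \<theta>" and \<phi>' = "\<lambda>\<theta>. M * \<theta> powr (k-1)"])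
      show "e < T" by fact
      show "continuous_on {e..T} ?F"
        using dF e by (intro continuous_at_imp_continuous_on ballI)
          (meson atLeastAtMost_iff greaterThanAtMost_iff has_vector_derivative_continuous less_le_trans)
      show "continuous_on {e..T} (\<lambda>\<theta>. M / k * \<theta> powr k)"
        using e by (intro continuous_intros) auto
      fix x assume x: "e < x" "x < T"
      then show "(?F has_vector_derivative (x powr (k-1)) *\<^sub>R a x) (at x)" using dF e by auto
      show "((\<lambda>\<theta>. M / k * \<theta> powr k) has_vector_derivative M * x powr (k-1)) (at x)" using dG x e by auto
      have "norm (a x) \<le> M" using a[of x] x e by auto
      then show "norm ((x powr (k-1)) *\<^sub>R a x) \<le> M * x powr (k-1)"
        by (simp add: mult.commute[of M] mult_left_mono)
    qed
    moreover have "norm (?F T) \<le> norm (?F T - ?F e) + norm (?F e)"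
      by (metis add.commute diff_add_cancel norm_triangle_ineq)
    moreover have "norm (?F e) \<le> e powr k * \<bar>B\<bar>"
      using bd[of e] e by (auto intro!: mult_left_mono)
    moreover have "0 \<le> M / k * e powr k"
      using order_trans[OF norm_ge_zero a[of T]] T k by auto
    ultimately show ?thesis by simp
  qed
  have "((\<lambda>e. M / k * T powr k + e powr k * \<bar>B\<bar>) \<longlongrightarrow> M / k * T powr k + 0 powr k * \<bar>B\<bar>) (at_right 0)"
    using k by (intro tendsto_intros) (auto simp: eventually_at_right_less intro!: eventually_at_rightI[of 0 1])
  moreover have "\<forall>\<^sub>F e in at_right 0. T powr k * norm (p T) \<le> M / k * T powr k + e powr k * \<bar>B\<bar>"
    using key T by (intro eventually_at_rightI[of 0 T]) auto
  ultimately have "T powr k * norm (p T) \<le> M / k * T powr k + 0 powr k * \<bar>B\<bar>"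
    by (rule tendsto_lowerbound) auto
  then have "T powr k * norm (p T) \<le> T powr k * (M / k)" using k by (simp add: mult.commute)
  then show ?thesis using T by (subst (asm) mult_le_cancel_left_pos) auto
qed

text \<open>
  The coupling of the first equation to \<open>q\<close> has no small factor, all other couplings carry the factor
  \<open>r\<close>. The weight \<open>4 C\<close> on \<open>q\<close> compensates for this: the supremum \<open>S\<close> of the weighted norm satisfies
  \<open>S \<le> S/2 + (1 + 4 C) E\<close>. With \<open>E = 0\<close> this is uniqueness of bounded solutions, and for the difference
  of two solutions it is dependence on parameters.
\<close>

lemma euler_system_stability:
  fixes p q :: "real \<Rightarrow> 'a::real_normed_vector"
  assumes C: "C \<ge> 1" and r: "r \<ge> 0" "16 * C\<^sup>2 * r \<le> 1" and k: "k1 \<ge> 1" "k2 \<ge> 1" and T: "T > 0"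
    and dp: "\<And>\<theta>. \<theta> \<in> {0<..T} \<Longrightarrow> (p has_vector_derivative p' \<theta>) (at \<theta>)"
    and dq: "\<And>\<theta>. \<theta> \<in> {0<..T} \<Longrightarrow> (q has_vector_derivative q' \<theta>) (at \<theta>)"
    and a: "\<And>\<theta>. \<theta> \<in> {0<..T} \<Longrightarrow> norm (\<theta> *\<^sub>R p' \<theta> + k1 *\<^sub>R p \<theta>) \<le> C * (r * norm (p \<theta>) + norm (q \<theta>)) + E"
    and b: "\<And>\<theta>. \<theta> \<in> {0<..T} \<Longrightarrow> norm (\<theta> *\<^sub>R q' \<theta> + k2 *\<^sub>R q \<theta>) \<le> C * r * (norm (p \<theta>) + norm (q \<theta>)) + E"
    and bp: "\<And>\<theta>. \<theta> \<in> {0<..T} \<Longrightarrow> norm (p \<theta>) \<le> B"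
    and bq: "\<And>\<theta>. \<theta> \<in> {0<..T} \<Longrightarrow> norm (q \<theta>) \<le> B"
    and E: "E \<ge> 0" and \<theta>: "\<theta> \<in> {0<..T}"
  shows "norm (p \<theta>) + 4 * C * norm (q \<theta>) \<le> 2 * (1 + 4 * C) * E"
proof -
  let ?W = "\<lambda>\<theta>. norm (p \<theta>) + 4 * C * norm (q \<theta>)"
  define S where "S = Sup (?W ` {0<..T})"
  have "?W x \<le> B + 4 * C * B" if "x \<in> {0<..T}" for x
    using bp[OF that] bq[OF that] C by (intro add_mono mult_left_mono) auto
  then have bdd: "bdd_above (?W ` {0<..T})" by (rule bdd_aboveI2)
  have WS: "?W x \<le> S" if "x \<in> {0<..T}" for x
    unfolding S_def using that bdd by (intro cSup_upper) auto
  have S0: "0 \<le> S" using WS[OF \<theta>] C by (smt (verit) mult_nonneg_nonneg norm_ge_zero)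
  have Cr: "16 * (C * r) \<le> 1"
  proof -
    have "C * r \<le> C\<^sup>2 * r" using C r by (intro mult_right_mono) (auto simp: power2_eq_square)
    then show ?thesis using r by simp
  qed
  have Crn: "0 \<le> C * r" "0 \<le> C\<^sup>2 * r" using C r by auto
  have step: "?W x \<le> S / 2 + (1 + 4 * C) * E" if x: "x \<in> {0<..T}" for x
  proof -
    have x0: "x > 0" and sub: "\<And>y. y \<in> {0<..x} \<Longrightarrow> y \<in> {0<..T}" using x by auto
    have A: "norm (p x) \<le> (S / 4 + E) / k1"
    proof (rule euler_operator_bound[OF _ x0, where p' = p' and B = B and a = "\<lambda>\<theta>. \<theta> *\<^sub>R p' \<theta> + k1 *\<^sub>R p \<theta>"])
      fix y assume y: "y \<in> {0<..x}"
      have "(4 * (C * r)) * norm (p y) \<le> 1 * norm (p y)" using Cr Crn by (intro mult_right_mono) auto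
      then have "C * (r * norm (p y) + norm (q y)) \<le> S / 4"
        using WS[OF sub[OF y]] by (simp add: algebra_simps)
      then show "norm (y *\<^sub>R p' y + k1 *\<^sub>R p y) \<le> S / 4 + E" using a[OF sub[OF y]] by simp
    qed (use k dp bp sub in auto)
    have Bq: "norm (q x) \<le> (S / (16 * C) + E) / k2"
    proof (rule euler_operator_bound[OF _ x0, where p' = q' and B = B and a = "\<lambda>\<theta>. \<theta> *\<^sub>R q' \<theta> + k2 *\<^sub>R q \<theta>"])
      fix y assume y: "y \<in> {0<..x}"
      have "(16 * (C\<^sup>2 * r)) * norm (p y) \<le> 1 * norm (p y)" using r Crn by (intro mult_right_mono) auto
      moreover have "(16 * (C * r)) * (C * norm (q y)) \<le> 1 * (C * norm (q y))"
        using Cr Crn C by (intro mult_right_mono) auto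
      moreover have "0 \<le> C * norm (q y)" using C by simp
      ultimately have "16 * C\<^sup>2 * r * (norm (p y) + norm (q y)) \<le> ?W y"
        by (simp add: algebra_simps power2_eq_square)
      then have "16 * C * (C * r * (norm (p y) + norm (q y))) \<le> S"
        using WS[OF sub[OF y]] by (simp add: algebra_simps power2_eq_square)
      then have "C * r * (norm (p y) + norm (q y)) \<le> S / (16 * C)"
        using C by (simp add: field_simps)
      then show "norm (y *\<^sub>R q' y + k2 *\<^sub>R q y) \<le> S / (16 * C) + E" using b[OF sub[OF y]] by simp
    qed (use k dq bq sub in auto)
    have "(S / 4 + E) / k1 \<le> (S / 4 + E) / 1" using k S0 E by (intro divide_left_mono) auto
    moreover have "(S / (16 * C) + E) / k2 \<le> (S / (16 * C) + E) / 1" using k S0 E C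
      by (intro divide_left_mono) auto
    ultimately have "norm (p x) \<le> S / 4 + E" "norm (q x) \<le> S / (16 * C) + E" using A Bq by auto
    moreover from this(2) have "4 * C * norm (q x) \<le> 4 * C * (S / (16 * C) + E)" using C by (intro mult_left_mono) auto
    moreover have "4 * C * (S / (16 * C) + E) = S / 4 + 4 * C * E" using C by (simp add: field_simps)
    ultimately show ?thesis by (simp add: algebra_simps)
  qed
  have "S \<le> S / 2 + (1 + 4 * C) * E"
    unfolding S_def using \<theta> step[unfolded S_def] by (intro cSup_least) auto
  then show ?thesis using WS[OF \<theta>] by (simp add: algebra_simps)
qed

text \<open>
  Division of the \<open>n\<close>-th Taylor coefficient by \<open>n + k\<close> keeps the radius of convergence.
\<close>

lemma euler_operator_inverse:
  fixes g :: "complex \<Rightarrow> complex" and k :: real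
  assumes k: "k > 0" and g: "g holomorphic_on ball 0 r"
  obtains h where "h holomorphic_on ball 0 r"
    "\<And>t. t \<in> ball 0 r \<Longrightarrow> t * deriv h t + of_real k * h t = g t"
proof -
  define c where "c n = (deriv ^^ n) g 0 / fact n" for n
  define b where "b n = c n / (of_nat n + of_real k)" for n
  define h where "h t = (\<Sum>n. b n * t ^ n)" for t
  have gs: "(\<lambda>n. c n * t ^ n) sums g t" if "norm t < r" for t
    using holomorphic_power_series[OF g, of t] that by (simp add: c_def)
  have nk: "norm (of_nat n + complex_of_real k) = real n + k" for n
  proof -
    have "of_nat n + complex_of_real k = of_real (real n + k)" by simp
    then show ?thesis using k by (simp only: norm_of_real)
  qed
  then have nz: "of_nat n + complex_of_real k \<noteq> 0" for n
    using k by (metis add_nonneg_pos norm_zero of_nat_0_le_iff order_less_irrefl)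
  have bs: "(\<lambda>n. b n * t ^ n) sums h t" if t: "norm t < r" for t
  proof -
    obtain s where s: "norm t < s" "s < r" using dense t by blast
    have "0 \<le> s" using s(1) norm_ge_zero[of t] by linarith
    then have "summable (\<lambda>n. c n * (of_real s) ^ n)"
      using gs[of "of_real s"] s by (auto simp: sums_iff)
    from powser_insidea[OF this, of t] s have sm: "summable (\<lambda>n. norm (c n * t ^ n))" by simp
    have "summable (\<lambda>n. b n * t ^ n)"
    proof (rule summable_comparison_test'[OF summable_mult[OF sm, of "1 / k"], of 0])
      fix n :: nat
      have "norm (c n * t ^ n) / (real n + k) \<le> norm (c n * t ^ n) / k"
        using k by (intro divide_left_mono) auto
      then show "norm (b n * t ^ n) \<le> 1 / k * norm (c n * t ^ n)"
        by (simp add: b_def norm_mult norm_divide nk)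
    qed
    then show ?thesis by (simp add: h_def summable_sums)
  qed
  have hol: "h holomorphic_on ball 0 r"
    by (rule power_series_holomorphic[of 0 r b]) (use bs in auto)
  have "t * deriv h t + of_real k * h t = g t" if t: "t \<in> ball 0 r" for t
  proof -
    have "(h has_field_derivative deriv h t) (at t)"
      using holomorphic_derivI[OF hol open_ball t] .
    from termdiffs_sums_strong[of r b h, OF bs this] t
    have "(\<lambda>n. diffs b n * t ^ n) sums deriv h t" by auto
    then have "(\<lambda>n. t * (diffs b n * t ^ n)) sums (t * deriv h t)" by (rule sums_mult)
    then have "(\<lambda>n. (of_nat (Suc n) * b (Suc n)) * t ^ Suc n) sums (t * deriv h t)"
      by (simp add: diffs_def algebra_simps)
    then have "(\<lambda>n. (of_nat n * b n) * t ^ n) sums (t * deriv h t)"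
      using sums_Suc_iff[of "\<lambda>n. (of_nat n * b n) * t ^ n"] by simp
    from sums_add[OF this sums_mult[OF bs[of t], of "of_real k"]] t
    have "(\<lambda>n. of_nat n * b n * t ^ n + of_real k * (b n * t ^ n)) sums (t * deriv h t + of_real k * h t)" by simp
    moreover have "of_nat n * b n * t ^ n + of_real k * (b n * t ^ n) = c n * t ^ n" for n
    proof -
      have "(of_nat n + of_real k) * b n = c n" using nz[of n] by (simp add: b_def)
      then show ?thesis by (metis distrib_right mult.assoc)
    qed
    ultimately have "(\<lambda>n. c n * t ^ n) sums (t * deriv h t + of_real k * h t)" by simp
    then show ?thesis using gs[of t] t sums_unique2 by fastforce
  qed
  with hol that show thesis by blast
qed

text \<open>
  Restricted to the ray through \<open>t\<close>, the operator \<open>t d/dt + k\<close> of a complex variable becomes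
  \<open>\<theta> d/d\<theta> + k\<close> with a real \<open>\<theta>\<close>, so that the real estimate applies.
\<close>

lemma euler_ray_derivative:
  fixes h :: "complex \<Rightarrow> complex"
  assumes h: "h holomorphic_on ball 0 r" and t: "t \<in> ball 0 r" and \<theta>: "\<theta> \<in> {0<..1}"
  shows "((\<lambda>\<theta>. h (of_real \<theta> * t)) has_vector_derivative t * deriv h (of_real \<theta> * t)) (at \<theta>)"
    and "of_real \<theta> * t \<in> ball 0 r"
proof -
  have "norm (of_real \<theta> * t) \<le> 1 * norm t"
    using \<theta> unfolding norm_mult by (intro mult_right_mono) auto
  then show in_ball: "of_real \<theta> * t \<in> ball 0 r" using t by auto
  have "((\<lambda>\<theta>. of_real \<theta> * t) has_vector_derivative t) (at \<theta>)"
    by (auto intro!: derivative_eq_intros)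
  from field_vector_diff_chain_at[OF this holomorphic_derivI[OF h open_ball in_ball]]
  show "((\<lambda>\<theta>. h (of_real \<theta> * t)) has_vector_derivative t * deriv h (of_real \<theta> * t)) (at \<theta>)"
    by (simp add: o_def)
qed

lemma euler_holomorphic_bound:
  fixes h :: "complex \<Rightarrow> complex"
  assumes k: "k > 0" and h: "h holomorphic_on ball 0 r" and t: "t \<in> ball 0 r"
    and M: "\<And>s. s \<in> ball 0 r \<Longrightarrow> norm s \<le> norm t \<Longrightarrow> norm (s * deriv h s + of_real k * h s) \<le> M"
  shows "norm (h t) \<le> M / k"
proof -
  have "continuous_on (cball 0 (norm t)) h"
    using t by (intro holomorphic_on_imp_continuous_on holomorphic_on_subset[OF h]) auto
  then have "compact (h ` cball 0 (norm t))" by (intro compact_continuous_image) auto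
  then obtain B where B: "\<And>s. s \<in> cball 0 (norm t) \<Longrightarrow> norm (h s) \<le> B"
    using compact_imp_bounded bounded_iff by (metis image_eqI)
  have le: "norm (of_real \<theta> * t) \<le> norm t" if "\<theta> \<in> {0<..1}" for \<theta> :: real
  proof -
    have "norm (of_real \<theta> * t) \<le> 1 * norm t"
      using that unfolding norm_mult by (intro mult_right_mono) auto
    then show ?thesis by simp
  qed
  have "norm (h (of_real 1 * t)) \<le> M / k"
  proof (rule euler_operator_bound[OF k zero_less_one, where p = "\<lambda>\<theta>. h (of_real \<theta> * t)" and B = B
        and p' = "\<lambda>\<theta>. t * deriv h (of_real \<theta> * t)"])
    fix \<theta> :: real assume \<theta>: "\<theta> \<in> {0<..1}"
    show "((\<lambda>\<theta>. h (of_real \<theta> * t)) has_vector_derivative t * deriv h (of_real \<theta> * t)) (at \<theta>)"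
      by (rule euler_ray_derivative[OF h t \<theta>])
    show "\<theta> *\<^sub>R (t * deriv h (of_real \<theta> * t)) + k *\<^sub>R h (of_real \<theta> * t)
        = (of_real \<theta> * t) * deriv h (of_real \<theta> * t) + of_real k * h (of_real \<theta> * t)"
      by (simp add: scaleR_conv_of_real mult.assoc)
    show "norm (of_real \<theta> * t * deriv h (of_real \<theta> * t) + of_real k * h (of_real \<theta> * t)) \<le> M"
      by (rule M[OF euler_ray_derivative(2)[OF h t \<theta>] le[OF \<theta>]])
    show "norm (h (of_real \<theta> * t)) \<le> B" using le[OF \<theta>] by (intro B) auto
  qed
  then show ?thesis by simp
qed

text \<open>
  The imaginary part along a real ray is a bounded solution of the homogeneous equation.
\<close>

lemma euler_holomorphic_real:
  fixes h :: "complex \<Rightarrow> complex"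
  assumes k: "k > 0" and h: "h holomorphic_on ball 0 r" and t: "t \<in> ball 0 r" "t \<in> \<real>"
    and g: "\<And>s. s \<in> ball 0 r \<Longrightarrow> s \<in> \<real> \<Longrightarrow> s * deriv h s + of_real k * h s \<in> \<real>"
  shows "h t \<in> \<real>"
proof -
  have "continuous_on (cball 0 (norm t)) h"
    using t by (intro holomorphic_on_imp_continuous_on holomorphic_on_subset[OF h]) auto
  then have "compact (h ` cball 0 (norm t))" by (intro compact_continuous_image) auto
  then obtain B where B: "\<And>s. s \<in> cball 0 (norm t) \<Longrightarrow> norm (h s) \<le> B"
    using compact_imp_bounded bounded_iff by (metis image_eqI)
  have "norm (Im (h (of_real 1 * t))) \<le> 0 / k"
  proof (rule euler_operator_bound[OF k zero_less_one, where p = "\<lambda>\<theta>. Im (h (of_real \<theta> * t))" and B = B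
        and p' = "\<lambda>\<theta>. Im (t * deriv h (of_real \<theta> * t))" and a = "\<lambda>_. 0"])
    fix \<theta> :: real assume \<theta>: "\<theta> \<in> {0<..1}"
    show "((\<lambda>\<theta>. Im (h (of_real \<theta> * t))) has_vector_derivative Im (t * deriv h (of_real \<theta> * t))) (at \<theta>)"
      by (rule bounded_linear.has_vector_derivative[OF bounded_linear_Im euler_ray_derivative(1)[OF h t(1) \<theta>]])
    have "of_real \<theta> * t \<in> \<real>" using t by auto
    from g[OF euler_ray_derivative(2)[OF h t(1) \<theta>] this]
    have "Im (of_real \<theta> * (t * deriv h (of_real \<theta> * t)) + of_real k * h (of_real \<theta> * t)) = 0"
      by (simp add: complex_is_Real_iff mult.assoc)
    then show "\<theta> *\<^sub>R Im (t * deriv h (of_real \<theta> * t)) + k *\<^sub>R Im (h (of_real \<theta> * t)) = 0"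
      by simp
    have "norm (of_real \<theta> * t) \<le> 1 * norm t"
      using \<theta> unfolding norm_mult by (intro mult_right_mono) auto
    then have "norm (h (of_real \<theta> * t)) \<le> B" by (intro B) auto
    then show "norm (Im (h (of_real \<theta> * t))) \<le> B"
      using abs_Im_le_cmod[of "h (of_real \<theta> * t)"] by simp
  qed auto
  then show ?thesis by (simp add: complex_is_Real_iff)
qed

text \<open>
  Picard iteration for \<open>t u' + k\<^sub>1 u = G\<^sub>1\<close>, \<open>t v' + k\<^sub>2 v = G\<^sub>2\<close>, started at the constants \<open>0\<close> and
  \<open>c / k\<^sub>2\<close>. The right-hand side \<open>G\<^sub>1\<close> may depend on \<open>v\<close> with a Lipschitz constant that is not small;
  every other Lipschitz constant carries a factor \<open>t\<close>. In each round the increment of \<open>v\<close> is therefore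
  small on its own, and the increment of \<open>u\<close> is controlled by that of \<open>v\<close>: increments of sizes
  \<open>8 C K\<close> and \<open>2 K\<close> are halved in every round. All hypotheses on \<open>G\<^sub>1\<close> and \<open>G\<^sub>2\<close> concern arguments with
  \<open>norm u \<le> K\<close> and \<open>norm (v - c / k\<^sub>2) \<le> 1\<close>, bounds that the iteration preserves.
\<close>

theorem triangular_briot_bouquet:
  fixes G1 G2 :: "complex \<Rightarrow> complex \<Rightarrow> complex \<Rightarrow> complex" and c C K r k1 k2 :: real
  assumes C: "C \<ge> 1" and K: "K \<ge> 1" and r: "r > 0" "16 * C\<^sup>2 * r \<le> 1" and k: "k1 \<ge> 1" "k2 \<ge> 1"
    and hol: "\<And>u v. u holomorphic_on ball 0 r \<Longrightarrow> v holomorphic_on ball 0 r \<Longrightarrow>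
        (\<And>t. t \<in> ball 0 r \<Longrightarrow> norm (u t) \<le> K \<and> norm (v t - of_real (c / k2)) \<le> 1) \<Longrightarrow>
        (\<lambda>t. G1 t (u t) (v t)) holomorphic_on ball 0 r \<and> (\<lambda>t. G2 t (u t) (v t)) holomorphic_on ball 0 r"
    and b1: "\<And>t u v. t \<in> ball 0 r \<Longrightarrow> norm u \<le> K \<Longrightarrow> norm (v - of_real (c / k2)) \<le> 1 \<Longrightarrow> norm (G1 t u v) \<le> K"
    and b2: "\<And>t u v. t \<in> ball 0 r \<Longrightarrow> norm u \<le> K \<Longrightarrow> norm (v - of_real (c / k2)) \<le> 1 \<Longrightarrow>
        norm (G2 t u v - of_real c) \<le> C * norm t"
    and l1: "\<And>t u v u' v'. t \<in> ball 0 r \<Longrightarrow> norm u \<le> K \<Longrightarrow> norm (v - of_real (c / k2)) \<le> 1 \<Longrightarrow>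
        norm u' \<le> K \<Longrightarrow> norm (v' - of_real (c / k2)) \<le> 1 \<Longrightarrow>
        norm (G1 t u v - G1 t u' v') \<le> C * (norm t * norm (u - u') + norm (v - v'))"
    and l2: "\<And>t u v u' v'. t \<in> ball 0 r \<Longrightarrow> norm u \<le> K \<Longrightarrow> norm (v - of_real (c / k2)) \<le> 1 \<Longrightarrow>
        norm u' \<le> K \<Longrightarrow> norm (v' - of_real (c / k2)) \<le> 1 \<Longrightarrow>
        norm (G2 t u v - G2 t u' v') \<le> C * norm t * (norm (u - u') + norm (v - v'))"
    and re: "\<And>t u v. t \<in> \<real> \<Longrightarrow> u \<in> \<real> \<Longrightarrow> v \<in> \<real> \<Longrightarrow> G1 t u v \<in> \<real> \<and> G2 t u v \<in> \<real>"
  obtains u v where "u holomorphic_on ball 0 r" "v holomorphic_on ball 0 r"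
    "\<And>t. t \<in> ball 0 r \<Longrightarrow> norm (u t) \<le> K"
    "\<And>t. t \<in> ball 0 r \<Longrightarrow> norm (v t - of_real (c / k2)) \<le> C * norm t"
    "\<And>t. t \<in> ball 0 r \<Longrightarrow> norm (v t - of_real (c / k2)) \<le> 1"
    "\<And>t. t \<in> ball 0 r \<Longrightarrow> t * deriv u t + of_real k1 * u t = G1 t (u t) (v t)"
    "\<And>t. t \<in> ball 0 r \<Longrightarrow> t * deriv v t + of_real k2 * v t = G2 t (u t) (v t)"
    "\<And>t. t \<in> ball 0 r \<Longrightarrow> t \<in> \<real> \<Longrightarrow> u t \<in> \<real> \<and> v t \<in> \<real>"
proof -
  let ?B = "ball (0::complex) r"
  let ?c = "complex_of_real (c / k2)"
  \<comment> \<open>The iterates are chosen one after the other by \<open>dependent_nat_choice\<close>: \<open>good\<close> is what every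
    iterate satisfies, \<open>step\<close> relates two consecutive ones.\<close>
  define good where "good w \<longleftrightarrow> fst w holomorphic_on ?B \<and> snd w holomorphic_on ?B \<and>
     (\<forall>t\<in>?B. norm (fst w t) \<le> K \<and> norm (snd w t - ?c) \<le> 1 \<and> (t \<in> \<real> \<longrightarrow> fst w t \<in> \<real> \<and> snd w t \<in> \<real>))"
    for w :: "(complex \<Rightarrow> complex) \<times> (complex \<Rightarrow> complex)"
  define step where "step w w' \<longleftrightarrow> (\<forall>t\<in>?B.
       t * deriv (fst w') t + of_real k1 * fst w' t = G1 t (fst w t) (snd w t) \<and>
       t * deriv (snd w') t + of_real k2 * snd w' t = G2 t (fst w t) (snd w t) \<and>
       norm (snd w' t - ?c) \<le> C * norm t)" for w w' :: "(complex \<Rightarrow> complex) \<times> (complex \<Rightarrow> complex)"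
  have Cr: "16 * (C * r) \<le> 1" "0 \<le> C * r"
  proof -
    have "C * r \<le> C\<^sup>2 * r" using C r by (intro mult_right_mono) (auto simp: power2_eq_square)
    then show "16 * (C * r) \<le> 1" using r by linarith
  qed (use C r in auto)
  have kpos: "k1 > 0" "k2 > 0" using k by auto
  have step_ex: "\<exists>w'. good w' \<and> step w w'" if w: "good w" for w
  proof -
    obtain u v where uv: "w = (u, v)" by force
    have u: "u holomorphic_on ?B" and v: "v holomorphic_on ?B"
      and bd: "\<And>t. t \<in> ?B \<Longrightarrow> norm (u t) \<le> K \<and> norm (v t - ?c) \<le> 1"
      and rl: "\<And>t. t \<in> ?B \<Longrightarrow> t \<in> \<real> \<Longrightarrow> u t \<in> \<real> \<and> v t \<in> \<real>"
      using w unfolding good_def uv by auto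
    from hol[OF u v bd] have h1: "(\<lambda>t. G1 t (u t) (v t)) holomorphic_on ?B"
      and h2: "(\<lambda>t. G2 t (u t) (v t)) holomorphic_on ?B" by auto
    obtain u' where u': "u' holomorphic_on ?B" "\<And>t. t \<in> ?B \<Longrightarrow> t * deriv u' t + of_real k1 * u' t = G1 t (u t) (v t)"
      using euler_operator_inverse[OF kpos(1) h1] by blast
    obtain v' where v': "v' holomorphic_on ?B" "\<And>t. t \<in> ?B \<Longrightarrow> t * deriv v' t + of_real k2 * v' t = G2 t (u t) (v t)"
      using euler_operator_inverse[OF kpos(2) h2] by blast
    have "norm (u' t) \<le> K" if t: "t \<in> ?B" for t
    proof -
      have "norm (u' t) \<le> K / k1"
        using bd by (intro euler_holomorphic_bound[OF kpos(1) u'(1) t]) (auto simp: u'(2) intro!: b1)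
      also have "\<dots> \<le> K / 1" using k K by (intro divide_left_mono) auto
      finally show ?thesis by simp
    qed
    moreover have vb: "norm (v' t - ?c) \<le> C * norm t" if t: "t \<in> ?B" for t
    proof -
      have "norm ((\<lambda>s. v' s - ?c) t) \<le> (C * norm t) / k2"
      proof (rule euler_holomorphic_bound[OF _ _ t])
        show "(\<lambda>s. v' s - ?c) holomorphic_on ?B" using v' by (intro holomorphic_intros)
        fix s assume s: "s \<in> ?B" "norm s \<le> norm t"
        have "(v' has_field_derivative deriv v' s) (at s)" using holomorphic_derivI[OF v'(1) open_ball s(1)] .
        then have "((\<lambda>s. v' s - ?c) has_field_derivative deriv v' s) (at s)"
          by (auto intro!: derivative_eq_intros)
        then have "deriv (\<lambda>s. v' s - ?c) s = deriv v' s" by (rule DERIV_imp_deriv)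
        then have "s * deriv (\<lambda>s. v' s - ?c) s + of_real k2 * (v' s - ?c) = G2 s (u s) (v s) - of_real c"
          using v'(2)[OF s(1)] k by (simp add: algebra_simps)
        moreover have "norm (G2 s (u s) (v s) - of_real c) \<le> C * norm s" using bd s by (intro b2) auto
        moreover have "C * norm s \<le> C * norm t" using s C by (intro mult_left_mono) auto
        ultimately show "norm (s * deriv (\<lambda>s. v' s - ?c) s + of_real k2 * (v' s - ?c)) \<le> C * norm t" by simp
      qed (use k in auto)
      also have "\<dots> \<le> (C * norm t) / 1" using k C by (intro divide_left_mono) auto
      finally show ?thesis by simp
    qed
    moreover have "norm (v' t - ?c) \<le> 1" if t: "t \<in> ?B" for t
    proof -
      have "C * norm t \<le> C * r" using t C by (intro mult_left_mono) auto
      then show ?thesis using vb[OF t] Cr by linarith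
    qed
    moreover have "u' t \<in> \<real>" if t: "t \<in> ?B" "t \<in> \<real>" for t
      using rl re by (intro euler_holomorphic_real[OF kpos(1) u'(1) t]) (simp add: u'(2))
    moreover have "v' t \<in> \<real>" if t: "t \<in> ?B" "t \<in> \<real>" for t
      using rl re by (intro euler_holomorphic_real[OF kpos(2) v'(1) t]) (simp add: v'(2))
    ultimately have "good (u', v') \<and> step w (u', v')"
      using u' v' unfolding good_def step_def uv by auto
    then show ?thesis by blast
  qed
  have "good (\<lambda>_. 0, \<lambda>_. ?c)" using K unfolding good_def by auto
  then have "\<exists>w. \<forall>n. good (w n) \<and> step (w n) (w (Suc n))"
    using step_ex by (intro dependent_nat_choice) blast+
  then obtain w where good: "\<And>n. good (w n)" and step: "\<And>n. step (w n) (w (Suc n))" by blast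
  define u v where "u n = fst (w n)" and "v n = snd (w n)" for n
  have hu: "u n holomorphic_on ?B" and hv: "v n holomorphic_on ?B" for n
    using good[of n] unfolding good_def u_def v_def by auto
  have bd: "norm (u n t) \<le> K" "norm (v n t - ?c) \<le> 1" if "t \<in> ?B" for n t
    using good[of n] that unfolding good_def u_def v_def by auto
  have rl: "u n t \<in> \<real>" "v n t \<in> \<real>" if "t \<in> ?B" "t \<in> \<real>" for n t
    using good[of n] that unfolding good_def u_def v_def by auto
  have eu: "t * deriv (u (Suc n)) t + of_real k1 * u (Suc n) t = G1 t (u n t) (v n t)"
    and ev: "t * deriv (v (Suc n)) t + of_real k2 * v (Suc n) t = G2 t (u n t) (v n t)"
    and ec: "norm (v (Suc n) t - ?c) \<le> C * norm t" if "t \<in> ?B" for n t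
    using step[of n] that unfolding step_def u_def v_def by auto
  \<comment> \<open>The inverse of \<open>t d/dt + k'\<close> has norm at most \<open>1 / k'\<close>, hence at most \<open>1\<close>.\<close>
  have contract: "norm (f t - g t) \<le> M"
    if "f holomorphic_on ?B" "g holomorphic_on ?B" "k' \<ge> 1" "t \<in> ?B" "M \<ge> 0"
      "\<And>s. s \<in> ?B \<Longrightarrow>
        norm ((s * deriv f s + of_real k' * f s) - (s * deriv g s + of_real k' * g s)) \<le> M"
    for f g and M k' :: real and t
  proof -
    have "norm (f t - g t) \<le> M / k'"
    proof (rule euler_holomorphic_bound[where h = "\<lambda>s. f s - g s" and r = r])
      show "(\<lambda>s. f s - g s) holomorphic_on ?B" using that by (intro holomorphic_intros)
      fix s assume s: "s \<in> ?B"
      have df: "deriv (\<lambda>s. f s - g s) s = deriv f s - deriv g s"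
        using holomorphic_on_imp_differentiable_at[OF that(1) open_ball s]
          holomorphic_on_imp_differentiable_at[OF that(2) open_ball s] by (rule deriv_diff)
      have "s * deriv (\<lambda>s. f s - g s) s + of_real k' * (f s - g s)
          = (s * deriv f s + of_real k' * f s) - (s * deriv g s + of_real k' * g s)"
        unfolding df by (simp add: algebra_simps)
      then show "norm (s * deriv (\<lambda>s. f s - g s) s + of_real k' * (f s - g s)) \<le> M"
        using that(6)[OF s] by simp
    qed (use that in auto)
    also have "\<dots> \<le> M / 1" using that by (intro divide_left_mono) auto
    finally show ?thesis by simp
  qed
  have diff: "norm (u (Suc n) t - u n t) \<le> 8 * C * K / 2 ^ n \<and> norm (v (Suc n) t - v n t) \<le> 2 * K / 2 ^ n" if "t \<in> ?B" for n t
    using that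
  proof (induction n arbitrary: t)
    case 0
    have CK: "1 * K \<le> C * K" using C K by (intro mult_right_mono) auto
    have "norm (u (Suc 0) t - u 0 t) \<le> norm (u (Suc 0) t) + norm (u 0 t)" by (rule norm_triangle_ineq4)
    moreover have "norm (v (Suc 0) t - v 0 t) \<le> norm (v (Suc 0) t - ?c) + norm (v 0 t - ?c)"
      using norm_triangle_ineq4[of "v (Suc 0) t - ?c" "v 0 t - ?c"] by simp
    ultimately have "norm (u (Suc 0) t - u 0 t) \<le> 8 * C * K" "norm (v (Suc 0) t - v 0 t) \<le> 2 * K"
      using bd[OF 0, of 0] bd[OF 0, of "Suc 0"] CK K by linarith+
    then show ?case by simp
  next
    case (Suc n)
    let ?d = "K / 2 ^ n"
    have d: "?d > 0" using K by simp
    have n1: "norm (G1 s (u (Suc n) s) (v (Suc n) s) - G1 s (u n s) (v n s)) \<le> 8 * C * K / 2 ^ Suc n" if s: "s \<in> ?B" for s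
    proof -
      have "norm (G1 s (u (Suc n) s) (v (Suc n) s) - G1 s (u n s) (v n s))
          \<le> C * (norm s * norm (u (Suc n) s - u n s) + norm (v (Suc n) s - v n s))"
        using s bd by (intro l1) auto
      also have "\<dots> \<le> C * (r * (8 * C * ?d) + 2 * ?d)"
        using Suc.IH[OF s] s C r by (intro mult_left_mono add_mono mult_mono) auto
      also have "\<dots> = (8 * (C * r) + 2) * C * ?d" by (simp add: algebra_simps)
      also have "\<dots> \<le> 4 * C * ?d" using Cr C d by (intro mult_right_mono) auto
      finally show ?thesis by simp
    qed
    have n2: "norm (G2 s (u (Suc n) s) (v (Suc n) s) - G2 s (u n s) (v n s)) \<le> 2 * K / 2 ^ Suc n" if s: "s \<in> ?B" for s
    proof -
      have "norm (G2 s (u (Suc n) s) (v (Suc n) s) - G2 s (u n s) (v n s))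
          \<le> C * norm s * (norm (u (Suc n) s - u n s) + norm (v (Suc n) s - v n s))"
        using s bd by (intro l2) auto
      also have "\<dots> \<le> C * r * (8 * C * ?d + 2 * ?d)"
        using Suc.IH[OF s] s C r by (intro mult_mono add_mono) auto
      also have "\<dots> = (8 * (C\<^sup>2 * r) + 2 * (C * r)) * ?d" by (simp add: algebra_simps power2_eq_square)
      also have "\<dots> \<le> 1 * ?d" using Cr r d by (intro mult_right_mono) auto
      finally show ?thesis by simp
    qed
    have "norm (u (Suc (Suc n)) t - u (Suc n) t) \<le> 8 * C * K / 2 ^ Suc n"
      by (rule contract[OF hu hu k(1) Suc.prems]) (use n1 C K in \<open>auto simp: eu\<close>)
    moreover have "norm (v (Suc (Suc n)) t - v (Suc n) t) \<le> 2 * K / 2 ^ Suc n"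
      by (rule contract[OF hv hv k(2) Suc.prems]) (use n2 K in \<open>auto simp: ev\<close>)
    ultimately show ?case by blast
  qed
  have lim: "\<exists>g. uniform_limit ?B f g sequentially"
    if f: "\<And>n t. t \<in> ?B \<Longrightarrow> norm (f (Suc n) t - f n t) \<le> M / 2 ^ n"
    for f :: "nat \<Rightarrow> complex \<Rightarrow> complex" and M
  proof -
    have "summable (\<lambda>n. M * (1 / 2) ^ n)" by (intro summable_mult summable_geometric) auto
    then have "summable (\<lambda>n. M / 2 ^ n)" by (simp add: power_one_over)
    from Weierstrass_m_test[OF f this]
    have "uniform_limit ?B (\<lambda>n t. \<Sum>i<n. f (Suc i) t - f i t) (\<lambda>t. \<Sum>i. f (Suc i) t - f i t) sequentially" .
    then have "uniform_limit ?B (\<lambda>n t. f n t - f 0 t) (\<lambda>t. \<Sum>i. f (Suc i) t - f i t) sequentially"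
      by (simp only: sum_lessThan_telescope[of "\<lambda>i. f i _"])
    from uniform_limit_add[OF this uniform_limit_const[of "f 0"]] show ?thesis by auto
  qed
  from lim[of u "8 * C * K"] diff obtain U where U: "uniform_limit ?B u U sequentially" by blast
  from lim[of v "2 * K"] diff obtain V where V: "uniform_limit ?B v V sequentially" by blast
  have Ut: "(\<lambda>n. u n t) \<longlonglongrightarrow> U t" and Vt: "(\<lambda>n. v n t) \<longlonglongrightarrow> V t" if "t \<in> ?B" for t
    using tendsto_uniform_limitI[OF U that] tendsto_uniform_limitI[OF V that] by auto
  have cb: "\<exists>d>0. cball x d \<subseteq> ?B \<and> uniform_limit (cball x d) f g sequentially"
    if ul: "uniform_limit ?B f g sequentially" and x: "x \<in> ?B" for f :: "nat \<Rightarrow> complex \<Rightarrow> complex" and g x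
  proof -
    obtain d where "d > 0" "cball x d \<subseteq> ?B" using iffD1[OF open_contains_cball_eq[OF open_ball, rule_format] x] by blast
    then show ?thesis using uniform_limit_on_subset[OF ul] by blast
  qed
  have hU: "U holomorphic_on ?B" by (rule holomorphic_uniform_sequence[OF open_ball hu cb[OF U]])
  have hV: "V holomorphic_on ?B" by (rule holomorphic_uniform_sequence[OF open_ball hv cb[OF V]])
  have bU: "norm (U t) \<le> K" and bV: "norm (V t - ?c) \<le> 1" and bV': "norm (V t - ?c) \<le> C * norm t" if t: "t \<in> ?B" for t
  proof -
    show "norm (U t) \<le> K" by (rule tendsto_upperbound[OF tendsto_norm[OF Ut[OF t]]]) (rule always_eventually[OF allI], rule bd[OF t], simp)
    have L: "(\<lambda>n. norm (v n t - ?c)) \<longlonglongrightarrow> norm (V t - ?c)" by (intro tendsto_intros Vt t)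
    show "norm (V t - ?c) \<le> 1" by (rule tendsto_upperbound[OF L]) (rule always_eventually[OF allI], rule bd[OF t], simp)
    have "norm (v n t - ?c) \<le> C * norm t" if "n \<ge> 1" for n
      using ec[OF t, of "n - 1"] that by simp
    then have "\<forall>\<^sub>F n in sequentially. norm (v n t - ?c) \<le> C * norm t"
      by (rule eventually_sequentiallyI)
    then show "norm (V t - ?c) \<le> C * norm t" by (intro tendsto_upperbound[OF L]) auto
  qed
  have rU: "U t \<in> \<real> \<and> V t \<in> \<real>" if t: "t \<in> ?B" "t \<in> \<real>" for t
    using closed_sequentially[OF closed_complex_Reals _ Ut[OF t(1)]]
      closed_sequentially[OF closed_complex_Reals _ Vt[OF t(1)]] rl[OF t] by blast
  \<comment> \<open>Uniform limits of holomorphic functions may be differentiated termwise.\<close>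
  have lims: "t * deriv U t + of_real k1 * U t = G1 t (U t) (V t)"
    "t * deriv V t + of_real k2 * V t = G2 t (U t) (V t)" if t: "t \<in> ?B" for t
  proof -
    have dU: "(\<lambda>n. deriv (u n) t) \<longlonglongrightarrow> deriv U t" and dV: "(\<lambda>n. deriv (v n) t) \<longlonglongrightarrow> deriv V t"
      using deriv_complex_uniform_limit[OF U _ _ open_ball t] deriv_complex_uniform_limit[OF V _ _ open_ball t] hu hv
      by auto
    have eps: "(\<lambda>n. C * (norm t * norm (u n t - U t) + norm (v n t - V t))) \<longlonglongrightarrow> C * (norm t * norm (U t - U t) + norm (V t - V t))"
      "(\<lambda>n. C * norm t * (norm (u n t - U t) + norm (v n t - V t))) \<longlonglongrightarrow> C * norm t * (norm (U t - U t) + norm (V t - V t))"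
      by (intro tendsto_intros Ut Vt t)+
    have zu: "(\<lambda>n. G1 t (u n t) (v n t) - G1 t (U t) (V t)) \<longlonglongrightarrow> 0"
      by (rule Lim_null_comparison[OF always_eventually[OF allI[OF l1[OF t bd[OF t] bU[OF t] bV[OF t]]]]])
        (use eps(1) in simp)
    have "(\<lambda>n. t * deriv (u (Suc n)) t + of_real k1 * u (Suc n) t) \<longlonglongrightarrow> t * deriv U t + of_real k1 * U t"
      by (intro tendsto_intros LIMSEQ_Suc[OF dU] LIMSEQ_Suc[OF Ut[OF t]])
    from LIMSEQ_unique[OF this[unfolded eu[OF t]] LIM_zero_cancel[OF zu]]
    show "t * deriv U t + of_real k1 * U t = G1 t (U t) (V t)" .
    have zv: "(\<lambda>n. G2 t (u n t) (v n t) - G2 t (U t) (V t)) \<longlonglongrightarrow> 0"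
      by (rule Lim_null_comparison[OF always_eventually[OF allI[OF l2[OF t bd[OF t] bU[OF t] bV[OF t]]]]])
        (use eps(2) in simp)
    have "(\<lambda>n. t * deriv (v (Suc n)) t + of_real k2 * v (Suc n) t) \<longlonglongrightarrow> t * deriv V t + of_real k2 * V t"
      by (intro tendsto_intros LIMSEQ_Suc[OF dV] LIMSEQ_Suc[OF Vt[OF t]])
    from LIMSEQ_unique[OF this[unfolded ev[OF t]] LIM_zero_cancel[OF zv]]
    show "t * deriv V t + of_real k2 * V t = G2 t (U t) (V t)" .
  qed
  show thesis by (rule that[OF hU hV bU bV' bV lims rU])
qed

section \<open>Bounded Lipschitz functions\<close>

text \<open>
  Unlike the Lipschitz functions alone, the bounded Lipschitz functions form an algebra, closed under
  division by functions that are bounded away from zero. The constants needed for the contraction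
  argument thus exist for every rational right-hand side on a bounded domain without being computed.
  One constant serves for both the bound and the Lipschitz estimate.
\<close>

definition bounded_lipschitz :: "'i::metric_space set \<Rightarrow> ('i \<Rightarrow> 'a::real_normed_vector) \<Rightarrow> bool" where
  "bounded_lipschitz S f \<longleftrightarrow>
     (\<exists>C. \<forall>p\<in>S. norm (f p) \<le> C \<and> (\<forall>q\<in>S. norm (f p - f q) \<le> C * dist p q))"

lemma bounded_lipschitzI:
  assumes "\<And>p. p \<in> S \<Longrightarrow> norm (f p) \<le> A" "\<And>p q. p \<in> S \<Longrightarrow> q \<in> S \<Longrightarrow> norm (f p - f q) \<le> B * dist p q"
  shows "bounded_lipschitz S f"
  unfolding bounded_lipschitz_def
proof (intro exI[of _ "max A B"] ballI conjI)
  fix p q assume "p \<in> S" "q \<in> S"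
  with assms(2)[OF this] show "norm (f p - f q) \<le> max A B * dist p q"
    by (meson max.cobounded2 mult_right_mono order_trans zero_le_dist)
qed (use assms(1) in \<open>simp add: le_max_iff_disj\<close>)

lemma bounded_lipschitzD:
  assumes "bounded_lipschitz S f"
  shows "\<exists>C\<ge>1. (\<forall>p\<in>S. norm (f p) \<le> C) \<and> (\<forall>p\<in>S. \<forall>q\<in>S. norm (f p - f q) \<le> C * dist p q)"
proof -
  obtain C where C: "\<forall>p\<in>S. norm (f p) \<le> C \<and> (\<forall>q\<in>S. norm (f p - f q) \<le> C * dist p q)"
    using assms unfolding bounded_lipschitz_def by blast
  have "norm (f p - f q) \<le> max 1 C * dist p q" if "p \<in> S" "q \<in> S" for p q
    using C that by (meson max.cobounded2 mult_right_mono order_trans zero_le_dist)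
  then show ?thesis using C by (intro exI[of _ "max 1 C"]) (auto simp: le_max_iff_disj)
qed

named_theorems bl_intros

lemma bounded_lipschitz_const [bl_intros]: "bounded_lipschitz S (\<lambda>p. c)"
  by (rule bounded_lipschitzI[of _ _ "norm c" 0]) auto

lemma bounded_lipschitz_add [bl_intros]:
  assumes "bounded_lipschitz S f" "bounded_lipschitz S g"
  shows "bounded_lipschitz S (\<lambda>p. f p + g p)"
proof -
  obtain A where A: "\<And>p. p \<in> S \<Longrightarrow> norm (f p) \<le> A"
    "\<And>p q. p \<in> S \<Longrightarrow> q \<in> S \<Longrightarrow> norm (f p - f q) \<le> A * dist p q"
    using bounded_lipschitzD[OF assms(1)] by blast
  obtain B where B: "\<And>p. p \<in> S \<Longrightarrow> norm (g p) \<le> B"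
    "\<And>p q. p \<in> S \<Longrightarrow> q \<in> S \<Longrightarrow> norm (g p - g q) \<le> B * dist p q"
    using bounded_lipschitzD[OF assms(2)] by blast
  show ?thesis
  proof (rule bounded_lipschitzI[of _ _ "A + B" "A + B"])
    fix p q assume pq: "p \<in> S" "q \<in> S"
    show "norm (f p + g p) \<le> A + B" by (rule norm_triangle_mono[OF A(1) B(1)]) fact+
    show "norm (f p + g p - (f q + g q)) \<le> (A + B) * dist p q"
      using norm_triangle_mono[OF A(2)[OF pq] B(2)[OF pq]] by (simp add: algebra_simps)
  qed
qed

lemma bounded_lipschitz_minus [bl_intros]:
  assumes "bounded_lipschitz S f"
  shows "bounded_lipschitz S (\<lambda>p. - f p)"
  using assms unfolding bounded_lipschitz_def by (simp add: norm_minus_commute)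

lemma bounded_lipschitz_diff [bl_intros]:
  assumes "bounded_lipschitz S f" "bounded_lipschitz S g"
  shows "bounded_lipschitz S (\<lambda>p. f p - g p)"
  using bounded_lipschitz_add[OF assms(1) bounded_lipschitz_minus[OF assms(2)]] by simp

lemma bounded_lipschitz_mult [bl_intros]:
  fixes f g :: "_ \<Rightarrow> 'a::real_normed_algebra"
  assumes "bounded_lipschitz S f" "bounded_lipschitz S g"
  shows "bounded_lipschitz S (\<lambda>p. f p * g p)"
proof -
  obtain A where A: "A \<ge> 1" "\<And>p. p \<in> S \<Longrightarrow> norm (f p) \<le> A"
    "\<And>p q. p \<in> S \<Longrightarrow> q \<in> S \<Longrightarrow> norm (f p - f q) \<le> A * dist p q"
    using bounded_lipschitzD[OF assms(1)] by blast
  obtain B where B: "B \<ge> 1" "\<And>p. p \<in> S \<Longrightarrow> norm (g p) \<le> B"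
    "\<And>p q. p \<in> S \<Longrightarrow> q \<in> S \<Longrightarrow> norm (g p - g q) \<le> B * dist p q"
    using bounded_lipschitzD[OF assms(2)] by blast
  show ?thesis
  proof (rule bounded_lipschitzI[of _ _ "A * B" "2 * A * B"])
    fix p q assume pq: "p \<in> S" "q \<in> S"
    show "norm (f p * g p) \<le> A * B"
      using A B pq by (intro norm_mult_ineq[THEN order_trans] mult_mono) auto
    have "f p * g p - f q * g q = f p * (g p - g q) + (f p - f q) * g q" by (simp add: algebra_simps)
    also have "norm \<dots> \<le> A * (B * dist p q) + (A * dist p q) * B"
      using A B pq by (intro norm_triangle_mono norm_mult_ineq[THEN order_trans] mult_mono) auto
    finally show "norm (f p * g p - f q * g q) \<le> 2 * A * B * dist p q" by simp
  qed
qed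

lemma bounded_lipschitz_power [bl_intros]:
  fixes f :: "_ \<Rightarrow> 'a::real_normed_algebra_1"
  assumes "bounded_lipschitz S f"
  shows "bounded_lipschitz S (\<lambda>p. f p ^ n)"
  by (induction n) (auto intro!: bl_intros assms)

lemma bounded_lipschitz_divide [bl_intros]:
  fixes f g :: "_ \<Rightarrow> 'a::real_normed_field"
  assumes "bounded_lipschitz S f" "bounded_lipschitz S g" and m: "\<exists>m>0. \<forall>p\<in>S. m \<le> norm (g p)"
  shows "bounded_lipschitz S (\<lambda>p. f p / g p)"
proof -
  obtain m where m: "m > 0" "\<And>p. p \<in> S \<Longrightarrow> m \<le> norm (g p)" using m by blast
  obtain B where B: "B \<ge> 1" "\<And>p. p \<in> S \<Longrightarrow> norm (g p) \<le> B"
    "\<And>p q. p \<in> S \<Longrightarrow> q \<in> S \<Longrightarrow> norm (g p - g q) \<le> B * dist p q"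
    using bounded_lipschitzD[OF assms(2)] by blast
  have "bounded_lipschitz S (\<lambda>p. inverse (g p))"
  proof (rule bounded_lipschitzI[of _ _ "inverse m" "B / m\<^sup>2"])
    fix p q assume pq: "p \<in> S" "q \<in> S"
    have nz: "g p \<noteq> 0" "g q \<noteq> 0" using m pq by (metis leD norm_zero)+
    show "norm (inverse (g p)) \<le> inverse m"
      unfolding norm_inverse using m pq by (intro le_imp_inverse_le) auto
    have "m * m \<le> norm (g p) * norm (g q)" using m pq by (intro mult_mono) (auto intro: order_trans)
    moreover have "norm (inverse (g p) - inverse (g q)) = norm (g p - g q) / (norm (g p) * norm (g q))"
      using nz by (simp add: inverse_eq_divide diff_frac_eq norm_divide norm_mult norm_minus_commute)
    ultimately have "norm (inverse (g p) - inverse (g q)) \<le> (B * dist p q) / (m * m)"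
      using B(3)[OF pq] m nz B(1) by (auto intro!: frac_le)
    then show "norm (inverse (g p) - inverse (g q)) \<le> B / m\<^sup>2 * dist p q"
      by (simp add: power2_eq_square)
  qed
  from bounded_lipschitz_mult[OF assms(1) this] show ?thesis by (simp add: divide_inverse)
qed

lemma bounded_lipschitz_id:
  assumes "bounded S"
  shows "bounded_lipschitz S (\<lambda>p. p)"
proof -
  obtain A where "\<And>p. p \<in> S \<Longrightarrow> norm p \<le> A" using assms by (auto simp: bounded_iff)
  then show ?thesis by (intro bounded_lipschitzI[of _ _ A 1]) (auto simp: dist_norm)
qed

lemma bounded_lipschitz_projection:
  assumes f: "bounded_lipschitz S f" and L: "\<And>v w. L (v - w) = L v - L w" "\<And>v. norm (L v) \<le> norm v"
  shows "bounded_lipschitz S (\<lambda>p. L (f p))"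
proof -
  obtain A where A: "\<And>p. p \<in> S \<Longrightarrow> norm (f p) \<le> A"
    "\<And>p q. p \<in> S \<Longrightarrow> q \<in> S \<Longrightarrow> norm (f p - f q) \<le> A * dist p q"
    using bounded_lipschitzD[OF f] by blast
  show ?thesis
    by (rule bounded_lipschitzI[of _ _ A A]) (auto simp: L(1)[symmetric] intro!: order_trans[OF L(2)] A)
qed

lemma bounded_lipschitz_fst_snd:
  fixes f :: "'i::metric_space \<Rightarrow> 'b::real_normed_vector \<times> 'c::real_normed_vector"
  assumes "bounded_lipschitz S f"
  shows "bounded_lipschitz S (\<lambda>p. fst (f p))" "bounded_lipschitz S (\<lambda>p. snd (f p))"
  by (rule bounded_lipschitz_projection[OF assms]; simp add: norm_prod_def)+

lemma dist_Pair_le: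
  fixes a a' :: "'a::real_normed_vector" and b b' :: "'b::real_normed_vector"
  shows "dist (a, b) (a', b') \<le> dist a a' + dist b b'"
  using norm_Pair_le[of "a - a'" "b - b'"] by (simp add: dist_norm)

lemma bounded_tripleI:
  assumes "\<And>a b c. (a, b, c) \<in> S \<Longrightarrow> norm a \<le> R \<and> norm b \<le> R \<and> norm c \<le> R"
  shows "bounded (S :: ('a::real_normed_vector \<times> 'b::real_normed_vector \<times> 'c::real_normed_vector) set)"
proof (rule boundedI[of _ "R + (R + R)"])
  fix p assume "p \<in> S"
  obtain a b c where p: "p = (a, b, c)" by (cases p)
  have "norm (a, b, c) \<le> norm a + (norm b + norm c)"
    by (meson add_left_mono norm_Pair_le order_trans)
  then show "norm p \<le> R + (R + R)" using assms[of a b c] \<open>p \<in> S\<close> p by auto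
qed

text \<open>
  One common constant for the two components of a vector field on triples, in the form in which the
  existence theorems consume it.
\<close>

lemma bounded_lipschitz_tripleD:
  fixes f g :: "'a::real_normed_vector \<Rightarrow> 'b::real_normed_vector \<Rightarrow> 'c::real_normed_vector \<Rightarrow> 'd::real_normed_vector"
  assumes "bounded_lipschitz S (\<lambda>p. f (fst p) (fst (snd p)) (snd (snd p)))"
    and "bounded_lipschitz S (\<lambda>p. g (fst p) (fst (snd p)) (snd (snd p)))"
  obtains K where "K \<ge> 1" "\<And>a b c. (a, b, c) \<in> S \<Longrightarrow> norm (f a b c) \<le> K \<and> norm (g a b c) \<le> K"
    "\<And>a b c a' b' c'. (a, b, c) \<in> S \<Longrightarrow> (a', b', c') \<in> S \<Longrightarrow>
       norm (f a b c - f a' b' c') \<le> K * (dist a a' + (dist b b' + dist c c')) \<and>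
       norm (g a b c - g a' b' c') \<le> K * (dist a a' + (dist b b' + dist c c'))"
proof -
  obtain A where A: "A \<ge> 1" "\<And>p. p \<in> S \<Longrightarrow> norm (f (fst p) (fst (snd p)) (snd (snd p))) \<le> A"
    "\<And>p q. p \<in> S \<Longrightarrow> q \<in> S \<Longrightarrow> norm (f (fst p) (fst (snd p)) (snd (snd p)) - f (fst q) (fst (snd q)) (snd (snd q))) \<le> A * dist p q"
    using bounded_lipschitzD[OF assms(1)] by blast
  obtain B where B: "B \<ge> 1" "\<And>p. p \<in> S \<Longrightarrow> norm (g (fst p) (fst (snd p)) (snd (snd p))) \<le> B"
    "\<And>p q. p \<in> S \<Longrightarrow> q \<in> S \<Longrightarrow> norm (g (fst p) (fst (snd p)) (snd (snd p)) - g (fst q) (fst (snd q)) (snd (snd q))) \<le> B * dist p q"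
    using bounded_lipschitzD[OF assms(2)] by blast
  show thesis
  proof (rule that[of "max A B"])
    fix a b c assume p: "(a, b, c) \<in> S"
    show "norm (f a b c) \<le> max A B \<and> norm (g a b c) \<le> max A B"
      using A(2)[OF p] B(2)[OF p] by (simp add: le_max_iff_disj)
    fix a' b' c' assume q: "(a', b', c') \<in> S"
    have d: "dist (a, b, c) (a', b', c') \<le> dist a a' + (dist b b' + dist c c')"
      using dist_Pair_le[of a "(b, c)" a' "(b', c')"] dist_Pair_le[of b c b' c'] by linarith
    have "A * dist (a, b, c) (a', b', c') \<le> max A B * (dist a a' + (dist b b' + dist c c'))"
      "B * dist (a, b, c) (a', b', c') \<le> max A B * (dist a a' + (dist b b' + dist c c'))"
      using d A(1) B(1) by (intro mult_mono; simp)+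
    then show "norm (f a b c - f a' b' c') \<le> max A B * (dist a a' + (dist b b' + dist c c')) \<and>
       norm (g a b c - g a' b' c') \<le> max A B * (dist a a' + (dist b b' + dist c c'))"
      using A(3)[OF p q] B(3)[OF p q] by simp
  qed (use A in simp)
qed

lemma dist_mult_left:
  fixes t u u' :: "'a::real_normed_div_algebra"
  shows "dist (t * u) (t * u') = norm t * norm (u - u')"
  by (simp add: dist_norm right_diff_distrib flip: norm_mult)

section \<open>The flow away from the sonic line\<close>

text \<open>
  The system in the unknowns \<open>x = y \<omega>\<close>, \<open>s = y \<rho>\<close>. It is defined over any normed field, because the same
  formulas are used on the real line and on complex discs.
\<close>

definition xdot :: "'a::real_normed_field \<Rightarrow> 'a \<Rightarrow> 'a \<Rightarrow> 'a" where
  "xdot y x s = 1 - 2 * x * (1 - x * s) / (y * (1 - x\<^sup>2))"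

definition sdot :: "'a::real_normed_field \<Rightarrow> 'a \<Rightarrow> 'a \<Rightarrow> 'a" where
  "sdot y x s = s * (1 + x\<^sup>2 - 2 * x * s) / (y * (1 - x\<^sup>2))"

text \<open>
  Bounded parts of phase space at a positive distance from the singularities \<open>y = 0\<close> and \<open>x\<^sup>2 = 1\<close>.
\<close>

definition regular_box :: "real \<Rightarrow> real \<Rightarrow> ('a::real_normed_field \<times> 'a \<times> 'a) set" where
  "regular_box m R = {(y, x, s). m \<le> norm y \<and> m \<le> norm (1 - x\<^sup>2) \<and> norm y \<le> R \<and> norm x \<le> R \<and> norm s \<le> R}"

lemma field_lipschitz:
  assumes m: "m > 0"
  obtains K where "K \<ge> 1"
    "\<And>y x s :: 'a::real_normed_field. (y, x, s) \<in> regular_box m R \<Longrightarrow> norm (xdot y x s) \<le> K \<and> norm (sdot y x s) \<le> K"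
    "\<And>y x s y' x' s' :: 'a. (y, x, s) \<in> regular_box m R \<Longrightarrow> (y', x', s') \<in> regular_box m R \<Longrightarrow>
      norm (xdot y x s - xdot y' x' s') \<le> K * (dist y y' + (dist x x' + dist s s')) \<and>
      norm (sdot y x s - sdot y' x' s') \<le> K * (dist y y' + (dist x x' + dist s s'))"
proof -
  let ?S = "regular_box m R :: ('a \<times> 'a \<times> 'a) set"
  have "bounded ?S" by (rule bounded_tripleI[of _ R]) (auto simp: regular_box_def)
  then have id: "bounded_lipschitz ?S (\<lambda>p. p)" by (rule bounded_lipschitz_id)
  have c: "bounded_lipschitz ?S (\<lambda>p. fst p)" "bounded_lipschitz ?S (\<lambda>p. fst (snd p))"
    "bounded_lipschitz ?S (\<lambda>p. snd (snd p))"
    by (intro bounded_lipschitz_fst_snd id)+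
  have low: "\<exists>b>0. \<forall>p\<in>?S. b \<le> norm (fst p * (1 - (fst (snd p))\<^sup>2))"
  proof (intro exI[of _ "m * m"] conjI ballI)
    fix p assume "p \<in> ?S"
    then show "m * m \<le> norm (fst p * (1 - (fst (snd p))\<^sup>2))"
      unfolding norm_mult using m by (intro mult_mono) (auto simp: regular_box_def)
  qed (use m in simp)
  have "bounded_lipschitz ?S (\<lambda>p. xdot (fst p) (fst (snd p)) (snd (snd p)))"
    "bounded_lipschitz ?S (\<lambda>p. sdot (fst p) (fst (snd p)) (snd (snd p)))"
    unfolding xdot_def sdot_def by (intro bl_intros c low)+
  then show thesis by (rule bounded_lipschitz_tripleD) (rule that; blast)
qed

text \<open>
  A small displacement costs half of the distance to the singularities: the change of \<open>x\<^sup>2\<close> is at most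
  \<open>d (2 R + 1) \<le> 4 R d\<close>.
\<close>

lemma regular_box_shift:
  fixes y x s t u v :: "'a::real_normed_field"
  assumes p: "(y, x, s) \<in> regular_box m R" and R: "R \<ge> 1" and m: "m > 0"
    and d: "norm t \<le> d" "norm u \<le> d" "norm v \<le> d" and dm: "d \<le> 1" "8 * R * d \<le> m"
  shows "(y + t, x + u, s + v) \<in> regular_box (m / 2) (R + 1)"
proof -
  have q: "m \<le> norm y" "m \<le> norm (1 - x\<^sup>2)" "norm y \<le> R" "norm x \<le> R" "norm s \<le> R"
    using p by (auto simp: regular_box_def)
  have d0: "0 \<le> d" using d norm_ge_zero order_trans by blast
  have "1 * d \<le> R * d" using R d0 by (intro mult_right_mono) auto
  then have dd: "8 * d \<le> m" using dm by linarith
  have "norm y - norm t \<le> norm (y + t)" by (metis norm_diff_ineq)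
  then have 1: "m / 2 \<le> norm (y + t)" using q d dd d0 by linarith
  have eq: "1 - (x + u)\<^sup>2 = (1 - x\<^sup>2) - u * (2 * x + u)" by (simp add: power2_eq_square algebra_simps)
  have "norm (1 - x\<^sup>2) - norm (u * (2 * x + u)) \<le> norm (1 - (x + u)\<^sup>2)"
    unfolding eq by (rule norm_triangle_ineq2)
  moreover have "norm (u * (2 * x + u)) \<le> d * (2 * R + 1)"
  proof -
    have "norm (2 * x + u) \<le> norm (2 * x) + norm u" by (rule norm_triangle_ineq)
    also have "\<dots> \<le> 2 * R + 1" using q d dm by (simp add: norm_mult)
    finally show ?thesis unfolding norm_mult using d d0 by (intro mult_mono) auto
  qed
  moreover have "d * (2 * R + 1) \<le> m / 2"
  proof -
    have "d * (2 * R + 1) \<le> d * (4 * R)" using R d0 by (intro mult_left_mono) auto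
    then show ?thesis using dm by (simp add: algebra_simps)
  qed
  ultimately have 2: "m / 2 \<le> norm (1 - (x + u)\<^sup>2)"
    using q by linarith
  have 3: "norm (y + t) \<le> R + 1" "norm (x + u) \<le> R + 1" "norm (s + v) \<le> R + 1"
    using q d dm norm_triangle_ineq[of y t] norm_triangle_ineq[of x u] norm_triangle_ineq[of s v] by linarith+
  show ?thesis using 1 2 3 by (simp add: regular_box_def)
qed

lemma of_real_xdot: "xdot (of_real y) (of_real x) (of_real s) = of_real (xdot y x s)"
  by (simp add: xdot_def)

lemma of_real_sdot: "sdot (of_real y) (of_real x) (of_real s) = of_real (sdot y x s)"
  by (simp add: sdot_def)

lemma of_real_regular_box:
  "((of_real y, of_real x, of_real s) :: complex \<times> complex \<times> complex) \<in> regular_box m R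
    \<longleftrightarrow> (y, x, s) \<in> regular_box m R"
proof -
  have "norm (1 - (complex_of_real x)\<^sup>2) = norm (1 - x\<^sup>2)"
    by (metis norm_of_real of_real_1 of_real_diff of_real_power real_norm_def)
  then show ?thesis by (simp add: regular_box_def)
qed

definition flow_on :: "real set \<Rightarrow> (real \<Rightarrow> real) \<Rightarrow> (real \<Rightarrow> real) \<Rightarrow> bool" where
  "flow_on I x s \<longleftrightarrow> (\<forall>y\<in>I. y > 0 \<and> (x y)\<^sup>2 \<noteq> 1 \<and>
     (x has_real_derivative xdot y (x y) (s y)) (at y) \<and>
     (s has_real_derivative sdot y (x y) (s y)) (at y))"

lemma flow_onD:
  assumes "flow_on I x s" "y \<in> I"
  shows "y > 0" "(x y)\<^sup>2 \<noteq> 1" "(x has_real_derivative xdot y (x y) (s y)) (at y)"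
    "(s has_real_derivative sdot y (x y) (s y)) (at y)" "isCont x y" "isCont s y"
  using assms by (auto simp: flow_on_def intro: DERIV_isCont)

lemma flow_on_subset: "flow_on I x s \<Longrightarrow> J \<subseteq> I \<Longrightarrow> flow_on J x s"
  by (auto simp: flow_on_def)

lemma flow_on_continuous:
  assumes "flow_on I x s" shows "continuous_on I x" "continuous_on I s"
  using flow_onD(5,6)[OF assms] by (auto intro: continuous_at_imp_continuous_on)

lemma flow_on_cong_open:
  assumes f: "flow_on I x s" and I: "open I" and eq: "\<And>y. y \<in> I \<Longrightarrow> x' y = x y \<and> s' y = s y"
  shows "flow_on I x' s'"
  unfolding flow_on_def
proof (intro ballI conjI)
  fix y assume y: "y \<in> I"
  note d = flow_onD[OF f y]
  show "y > 0" "(x' y)\<^sup>2 \<noteq> 1" using d eq[OF y] by auto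
  show "(x' has_real_derivative xdot y (x' y) (s' y)) (at y)"
    using d(3) eq[OF y] has_field_derivative_transform_within_open[OF d(3) I y, of x'] eq by auto
  show "(s' has_real_derivative sdot y (x' y) (s' y)) (at y)"
    using d(4) eq[OF y] has_field_derivative_transform_within_open[OF d(4) I y, of s'] eq by auto
qed

lemma real_part_has_derivative:
  assumes "(X has_field_derivative D) (at (of_real y))"
  shows "((\<lambda>y. Re (X (of_real y))) has_real_derivative Re D) (at y)"
  using bounded_linear.has_vector_derivative[OF bounded_linear_Re has_vector_derivative_real_field[OF assms]]
  by (simp add: has_real_derivative_iff_has_vector_derivative)

lemma of_real_in_ball: "\<bar>v - x\<bar> < r \<Longrightarrow> complex_of_real v \<in> ball (of_real x) r"
  by (simp add: dist_norm abs_minus_commute flip: of_real_diff)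

text \<open>
  The ansatz \<open>x = x\<^sub>0 + t u\<close>, \<open>s = s\<^sub>0 + t v\<close> with \<open>t = y - y\<^sub>0\<close> turns the Cauchy problem into a
  Briot-Bouquet system with both exponents equal to \<open>1\<close>. This yields a holomorphic solution, and the
  length \<open>\<delta>\<close> of the interval is the same for all initial values in the box, which is what continuation
  requires.
\<close>

lemma local_flow:
  assumes m: "m > 0" and R: "R \<ge> 1"
  shows "\<exists>\<delta>>0. \<forall>y0 x0 s0. (y0, x0, s0) \<in> regular_box m R \<and> y0 > 0 \<longrightarrow>
    (\<exists>x s. flow_on {y0 - \<delta><..<y0 + \<delta>} x s \<and> x y0 = x0 \<and> s y0 = s0 \<and>
      (\<exists>X S. X holomorphic_on ball (of_real y0) \<delta> \<and> S holomorphic_on ball (of_real y0) \<delta> \<and>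
        (\<forall>y. \<bar>y - y0\<bar> < \<delta> \<longrightarrow> X (of_real y) = of_real (x y) \<and> S (of_real y) = of_real (s y))))"
proof -
  let ?S = "regular_box (m / 2) (R + 1) :: (complex \<times> complex \<times> complex) set"
  have m2: "m / 2 > 0" using m by simp
  obtain K where K: "K \<ge> 1"
    and Kb: "\<And>y x s. (y, x, s) \<in> ?S \<Longrightarrow> norm (xdot y x s) \<le> K \<and> norm (sdot y x s) \<le> K"
    and Kl: "\<And>y x s y' x' s'. (y, x, s) \<in> ?S \<Longrightarrow> (y', x', s') \<in> ?S \<Longrightarrow>
      norm (xdot y x s - xdot y' x' s') \<le> K * (dist y y' + (dist x x' + dist s s')) \<and>
      norm (sdot y x s - sdot y' x' s') \<le> K * (dist y y' + (dist x x' + dist s s'))"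
    by (rule field_lipschitz[OF m2, where R = "R + 1" and 'a = complex]) blast
  define C where "C = K * (2 * K + 2)"
  define d where "d = min 1 (m / (8 * R))"
  have d: "d > 0" "d \<le> 1" "8 * R * d \<le> m"
  proof -
    have "8 * R * d \<le> 8 * R * (m / (8 * R))" unfolding d_def using R by (intro mult_left_mono) auto
    then show "8 * R * d \<le> m" using R by simp
  qed (use m R in \<open>auto simp: d_def\<close>)
  have CK: "K \<le> C"
  proof -
    have "K * 1 \<le> K * (2 * K + 2)" using K by (intro mult_left_mono) auto
    then show ?thesis by (simp add: C_def)
  qed
  then have C: "C \<ge> 1" using K by simp
  define r where "r = min (1 / (16 * C\<^sup>2)) (d / (K + 1))"
  have r: "r > 0" "16 * C\<^sup>2 * r \<le> 1" "r * (K + 1) \<le> d" "r \<le> 1"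
  proof -
    show "r > 0" using C K d by (simp add: r_def)
    have "16 * C\<^sup>2 * r \<le> 16 * C\<^sup>2 * (1 / (16 * C\<^sup>2))" unfolding r_def by (intro mult_left_mono) auto
    then show "16 * C\<^sup>2 * r \<le> 1" using C by simp
    have "r * (K + 1) \<le> d / (K + 1) * (K + 1)" unfolding r_def using K by (intro mult_right_mono) auto
    then show rd: "r * (K + 1) \<le> d" using K by simp
    have "r * 1 \<le> r * (K + 1)" using K \<open>r > 0\<close> by (intro mult_left_mono) auto
    then show "r \<le> 1" using rd d by linarith
  qed
  have "\<exists>x s. flow_on {y0 - r<..<y0 + r} x s \<and> x y0 = x0 \<and> s y0 = s0 \<and>
      (\<exists>X S. X holomorphic_on ball (of_real y0) r \<and> S holomorphic_on ball (of_real y0) r \<and>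
        (\<forall>y. \<bar>y - y0\<bar> < r \<longrightarrow> X (of_real y) = of_real (x y) \<and> S (of_real y) = of_real (s y)))"
    if p0: "(y0, x0, s0) \<in> regular_box m R" and y0: "y0 > 0" for y0 x0 s0 :: real
  proof -
    let ?y = "complex_of_real y0" and ?x = "complex_of_real x0" and ?s = "complex_of_real s0"
    define c where "c = sdot y0 x0 s0"
    \<comment> \<open>The initial value of \<open>s'\<close> is the constant \<open>c\<close> of the Briot-Bouquet theorem; \<open>u\<close> and \<open>v\<close> are the
      difference quotients of \<open>x\<close> and \<open>s\<close>.\<close>
    define G1 G2 where "G1 t u v = xdot (?y + t) (?x + t * u) (?s + t * v)"
      and "G2 t u v = sdot (?y + t) (?x + t * u) (?s + t * v)" for t u v :: complex
    have pc: "(?y, ?x, ?s) \<in> regular_box m R" using p0 by (simp add: of_real_regular_box)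
    have in_S: "(?y + t, ?x + t * u, ?s + t * v) \<in> ?S" if "norm t \<le> r" "norm u \<le> K" "norm v \<le> K + 1" for t u v :: complex
    proof (rule regular_box_shift[OF pc R m _ _ _ d(2,3)])
      have "norm t * 1 \<le> r * (K + 1)" using that K r by (intro mult_mono) auto
      then show "norm t \<le> d" using r by simp
      have "norm t * norm u \<le> r * (K + 1)" using that K r by (intro mult_mono) auto
      then show "norm (t * u) \<le> d" using r by (simp add: norm_mult)
      have "norm t * norm v \<le> r * (K + 1)" using that K r by (intro mult_mono) auto
      then show "norm (t * v) \<le> d" using r by (simp add: norm_mult)
    qed
    have S0: "(?y, ?x, ?s) \<in> ?S" using in_S[of 0 0 0] K r by auto
    have c: "norm (complex_of_real c) \<le> K" using Kb[OF S0] by (simp add: c_def of_real_sdot)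
    have vK: "norm v \<le> K + 1" if "norm (v - of_real (c / 1)) \<le> 1" for v :: complex
      using norm_triangle_ineq[of "v - of_real c" "of_real c"] that c by simp
    obtain u v where uv: "u holomorphic_on ball 0 r" "v holomorphic_on ball 0 r"
      "\<And>t. t \<in> ball 0 r \<Longrightarrow> norm (u t) \<le> K"
      "\<And>t. t \<in> ball 0 r \<Longrightarrow> norm (v t - of_real (c / 1)) \<le> 1"
      "\<And>t. t \<in> ball 0 r \<Longrightarrow> t * deriv u t + of_real 1 * u t = G1 t (u t) (v t)"
      "\<And>t. t \<in> ball 0 r \<Longrightarrow> t * deriv v t + of_real 1 * v t = G2 t (u t) (v t)"
      "\<And>t. t \<in> ball 0 r \<Longrightarrow> t \<in> \<real> \<Longrightarrow> u t \<in> \<real> \<and> v t \<in> \<real>"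
    proof (rule triangular_briot_bouquet[of C K r 1 1 c G1 G2, OF C K r(1,2) order_refl order_refl])
      fix u v assume hol: "u holomorphic_on ball 0 r" "v holomorphic_on ball 0 r"
        and bd: "\<And>t. t \<in> ball 0 r \<Longrightarrow> norm (u t) \<le> K \<and> norm (v t - of_real (c / 1)) \<le> 1"
      have nz: "(?y + t) * (1 - (?x + t * u t)\<^sup>2) \<noteq> 0" if t: "t \<in> ball 0 r" for t
      proof -
        have "(?y + t, ?x + t * u t, ?s + t * v t) \<in> ?S" using t bd[OF t] vK by (intro in_S) auto
        then show ?thesis using m by (auto simp: regular_box_def)
      qed
      show "(\<lambda>t. G1 t (u t) (v t)) holomorphic_on ball 0 r \<and> (\<lambda>t. G2 t (u t) (v t)) holomorphic_on ball 0 r"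
        unfolding G1_def G2_def xdot_def sdot_def
        using nz by (intro conjI holomorphic_intros hol) auto
    next
      fix t u v :: complex assume t: "t \<in> ball 0 r" and u: "norm u \<le> K" and v: "norm (v - of_real (c / 1)) \<le> (1::real)"
      have S1: "(?y + t, ?x + t * u, ?s + t * v) \<in> ?S" using t u vK[OF v] by (intro in_S) auto
      then show "norm (G1 t u v) \<le> K" using Kb by (simp add: G1_def)
      have "norm (G2 t u v - of_real c) \<le> K * (dist (?y + t) ?y + (dist (?x + t * u) ?x + dist (?s + t * v) ?s))"
        using Kl[OF S1 S0] by (simp add: G2_def c_def of_real_sdot)
      also have "\<dots> = K * (1 + (norm u + norm v)) * norm t" by (simp add: dist_norm norm_mult algebra_simps)
      also have "\<dots> \<le> K * (2 * K + 2) * norm t"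
        using u vK[OF v] K by (intro mult_right_mono mult_left_mono) auto
      finally show "norm (G2 t u v - of_real c) \<le> C * norm t" by (simp add: C_def)
    next
      fix t u v u' v' :: complex assume t: "t \<in> ball 0 r" and u: "norm u \<le> K" and v: "norm (v - of_real (c / 1)) \<le> (1::real)"
        and u': "norm u' \<le> K" and v': "norm (v' - of_real (c / 1)) \<le> (1::real)"
      have S1: "(?y + t, ?x + t * u, ?s + t * v) \<in> ?S" using t u vK[OF v] by (intro in_S) auto
      have S2: "(?y + t, ?x + t * u', ?s + t * v') \<in> ?S" using t u' vK[OF v'] by (intro in_S) auto
      have "dist (?y + t) (?y + t) + (dist (?x + t * u) (?x + t * u') + dist (?s + t * v) (?s + t * v'))
          = norm t * (norm (u - u') + norm (v - v'))"
        by (simp add: dist_mult_left distrib_left)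
      moreover have "K * (norm t * (norm (u - u') + norm (v - v'))) \<le> C * (norm t * (norm (u - u') + norm (v - v')))"
        using CK by (intro mult_right_mono) auto
      ultimately have G: "norm (G1 t u v - G1 t u' v') \<le> C * (norm t * (norm (u - u') + norm (v - v')))"
        "norm (G2 t u v - G2 t u' v') \<le> C * (norm t * (norm (u - u') + norm (v - v')))"
        using Kl[OF S1 S2] unfolding G1_def G2_def by simp_all
      note G(1)
      also have "\<dots> \<le> C * (norm t * norm (u - u') + norm (v - v'))"
      proof -
        have "norm t * norm (v - v') \<le> 1 * norm (v - v')" using t r by (intro mult_right_mono) auto
        then show ?thesis using C by (intro mult_left_mono) (auto simp: algebra_simps)
      qed
      finally show "norm (G1 t u v - G1 t u' v') \<le> C * (norm t * norm (u - u') + norm (v - v'))" .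
      from G(2) show "norm (G2 t u v - G2 t u' v') \<le> C * norm t * (norm (u - u') + norm (v - v'))"
        by (simp add: mult.assoc)
    next
      fix t u v :: complex assume "t \<in> \<real>" "u \<in> \<real>" "v \<in> \<real>"
      then show "G1 t u v \<in> \<real> \<and> G2 t u v \<in> \<real>"
        unfolding G1_def G2_def xdot_def sdot_def by auto
    qed blast
    define X S where "X w = ?x + (w - ?y) * u (w - ?y)" and "S w = ?s + (w - ?y) * v (w - ?y)" for w
    define x s where "x y = Re (X (of_real y))" and "s y = Re (S (of_real y))" for y
    have tb: "w - ?y \<in> ball 0 r" if "w \<in> ball ?y r" for w
      using that by (auto simp: dist_norm norm_minus_commute)
    have dX: "(X has_field_derivative xdot w (X w) (S w)) (at w)"
      and dS: "(S has_field_derivative sdot w (X w) (S w)) (at w)" if w: "w \<in> ball ?y r" for w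
    proof -
      note t = tb[OF w]
      have shift: "((\<lambda>w. w - ?y) has_field_derivative 1) (at w)"
        by (auto intro!: derivative_eq_intros)
      have du: "((\<lambda>w. u (w - ?y)) has_field_derivative deriv u (w - ?y)) (at w)"
        using DERIV_chain2[where f = u and g = "\<lambda>w. w - ?y" and x = w and s = UNIV,
            OF holomorphic_derivI[OF uv(1) open_ball t, of UNIV] shift] by simp
      have dv: "((\<lambda>w. v (w - ?y)) has_field_derivative deriv v (w - ?y)) (at w)"
        using DERIV_chain2[where f = v and g = "\<lambda>w. w - ?y" and x = w and s = UNIV,
            OF holomorphic_derivI[OF uv(2) open_ball t, of UNIV] shift] by simp
      have "(X has_field_derivative (w - ?y) * deriv u (w - ?y) + of_real 1 * u (w - ?y)) (at w)"
        unfolding X_def by (rule derivative_eq_intros du refl)+ simp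
      then show "(X has_field_derivative xdot w (X w) (S w)) (at w)"
        unfolding uv(5)[OF t] by (simp add: G1_def X_def S_def)
      have "(S has_field_derivative (w - ?y) * deriv v (w - ?y) + of_real 1 * v (w - ?y)) (at w)"
        unfolding S_def by (rule derivative_eq_intros dv refl)+ simp
      then show "(S has_field_derivative sdot w (X w) (S w)) (at w)"
        unfolding uv(6)[OF t] by (simp add: G2_def X_def S_def)
    qed
    have hX: "X holomorphic_on ball ?y r" "S holomorphic_on ball ?y r"
      unfolding holomorphic_on_open[OF open_ball] using dX dS by blast+
    note wb = of_real_in_ball
    have XR: "X (of_real y) = of_real (x y)" "S (of_real y) = of_real (s y)" if "\<bar>y - y0\<bar> < r" for y
    proof -
      have "of_real y - ?y \<in> \<real>" by auto
      with uv(7)[OF tb[OF wb[OF that]]] have "X (of_real y) \<in> \<real>" "S (of_real y) \<in> \<real>"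
        unfolding X_def S_def by auto
      then show "X (of_real y) = of_real (x y)" "S (of_real y) = of_real (s y)"
        by (auto simp: x_def s_def)
    qed
    have fl: "flow_on {y0 - r<..<y0 + r} x s"
      unfolding flow_on_def
    proof (intro ballI conjI)
      fix y assume "y \<in> {y0 - r<..<y0 + r}"
      then have y: "\<bar>y - y0\<bar> < r" by auto
      let ?t = "complex_of_real y - ?y"
      note t = tb[OF wb[OF y]]
      have "(?y + ?t, ?x + ?t * u ?t, ?s + ?t * v ?t) \<in> ?S"
        using t uv(3)[OF t] vK[OF uv(4)[OF t]] by (intro in_S) auto
      then have "(of_real y, X (of_real y), S (of_real y)) \<in> ?S" by (simp add: X_def S_def)
      then have "(y, x y, s y) \<in> regular_box (m / 2) (R + 1)"
        by (simp only: XR[OF y] of_real_regular_box)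
      then show "(x y)\<^sup>2 \<noteq> 1" using m by (auto simp: regular_box_def)
      have "m \<le> y0" using p0 y0 by (auto simp: regular_box_def)
      moreover have "r * 1 \<le> r * (K + 1)" using K r by (intro mult_left_mono) auto
      moreover have "8 * 1 * d \<le> 8 * R * d" using R d by (intro mult_right_mono) auto
      ultimately show "y > 0" using y r d m by linarith
      show "(x has_real_derivative xdot y (x y) (s y)) (at y)"
        using real_part_has_derivative[OF dX[OF wb[OF y]]] unfolding XR[OF y] of_real_xdot x_def[symmetric] by simp
      show "(s has_real_derivative sdot y (x y) (s y)) (at y)"
        using real_part_has_derivative[OF dS[OF wb[OF y]]] unfolding XR[OF y] of_real_sdot s_def[symmetric] by simp
    qed
    have "x y0 = x0" "s y0 = s0" by (auto simp: x_def s_def X_def S_def)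
    with fl hX XR show ?thesis by blast
  qed
  then show ?thesis using r(1) by blast
qed

section \<open>Comparison, uniqueness and continuation\<close>

lemma gronwall_two_sided:
  fixes D :: "real \<Rightarrow> real"
  assumes ab: "a \<le> b" and d: "\<And>y. y \<in> {a..b} \<Longrightarrow> (D has_real_derivative D' y) (at y)"
    and L: "\<And>y. y \<in> {a..b} \<Longrightarrow> \<bar>D' y\<bar> \<le> L * D y"
  shows "D b \<le> D a * exp (L * (b - a))" "D a \<le> D b * exp (L * (b - a))"
proof -
  have "D b * exp (- (L * b)) \<le> D a * exp (- (L * a))"
  proof (rule DERIV_nonpos_imp_nonincreasing[OF ab, where f = "\<lambda>y. D y * exp (- (L * y))"])
    fix y assume y: "a \<le> y" "y \<le> b"
    have "((\<lambda>y. D y * exp (- (L * y))) has_real_derivative (D' y - L * D y) * exp (- (L * y))) (at y)"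
      using d[of y] y by (auto intro!: derivative_eq_intros simp: algebra_simps)
    moreover have "(D' y - L * D y) * exp (- (L * y)) \<le> 0"
      using L[of y] y by (intro mult_nonpos_nonneg) auto
    ultimately show "\<exists>z. ((\<lambda>y. D y * exp (- (L * y))) has_real_derivative z) (at y) \<and> z \<le> 0" by blast
  qed
  then have "D b * exp (- (L * b)) * exp (L * b) \<le> D a * exp (- (L * a)) * exp (L * b)"
    by (intro mult_right_mono) auto
  then show "D b \<le> D a * exp (L * (b - a))"
    by (simp add: mult.assoc right_diff_distrib flip: exp_add)
  have "D a * exp (L * a) \<le> D b * exp (L * b)"
  proof (rule DERIV_nonneg_imp_nondecreasing[OF ab, where f = "\<lambda>y. D y * exp (L * y)"])
    fix y assume y: "a \<le> y" "y \<le> b"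
    have "((\<lambda>y. D y * exp (L * y)) has_real_derivative (D' y + L * D y) * exp (L * y)) (at y)"
      using d[of y] y by (auto intro!: derivative_eq_intros simp: algebra_simps)
    moreover have "0 \<le> (D' y + L * D y) * exp (L * y)"
      using L[of y] y by (intro mult_nonneg_nonneg) auto
    ultimately show "\<exists>z. ((\<lambda>y. D y * exp (L * y)) has_real_derivative z) (at y) \<and> z \<ge> 0" by blast
  qed
  then have "D a * exp (L * a) * exp (- (L * a)) \<le> D b * exp (L * b) * exp (- (L * a))"
    by (intro mult_right_mono) auto
  then show "D a \<le> D b * exp (L * (b - a))"
    by (simp add: mult.assoc right_diff_distrib flip: exp_add)
qed

definition flow_gap :: "(real \<Rightarrow> real) \<Rightarrow> (real \<Rightarrow> real) \<Rightarrow> (real \<Rightarrow> real) \<Rightarrow> (real \<Rightarrow> real) \<Rightarrow> real \<Rightarrow> real" where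
  "flow_gap x s x' s' y = (x y - x' y)\<^sup>2 + (s y - s' y)\<^sup>2"

text \<open>
  Gronwall in both directions of time: solutions are followed to the left as well as to the right.
\<close>

lemma flow_stability:
  assumes m: "m > 0"
  shows "\<exists>L\<ge>0. \<forall>a b x s x' s'. flow_on {a..b} x s \<and> flow_on {a..b} x' s' \<and>
     (\<forall>y\<in>{a..b}. (y, x y, s y) \<in> regular_box m R \<and> (y, x' y, s' y) \<in> regular_box m R) \<longrightarrow>
     (\<forall>y\<in>{a..b}. flow_gap x s x' s' y \<le> flow_gap x s x' s' a * exp (L * (y - a)) \<and>
        flow_gap x s x' s' y \<le> flow_gap x s x' s' b * exp (L * (b - y)))"
proof -
  let ?S = "regular_box m R :: (real \<times> real \<times> real) set"
  obtain K where K: "K \<ge> 1"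
    and Kl: "\<And>y x s y' x' s'. (y, x, s) \<in> ?S \<Longrightarrow> (y', x', s') \<in> ?S \<Longrightarrow>
      norm (xdot y x s - xdot y' x' s') \<le> K * (dist y y' + (dist x x' + dist s s')) \<and>
      norm (sdot y x s - sdot y' x' s') \<le> K * (dist y y' + (dist x x' + dist s s'))"
    by (rule field_lipschitz[OF m, where R = R and 'a = real]) blast
  define L where "L = 4 * K"
  have main: "flow_gap x s x' s' y \<le> flow_gap x s x' s' a * exp (L * (y - a)) \<and>
        flow_gap x s x' s' y \<le> flow_gap x s x' s' b * exp (L * (b - y))"
    if f: "flow_on {a..b} x s" "flow_on {a..b} x' s'"
      and box: "\<And>y. y \<in> {a..b} \<Longrightarrow> (y, x y, s y) \<in> ?S \<and> (y, x' y, s' y) \<in> ?S"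
      and y: "y \<in> {a..b}" for a b x s x' s' y
  proof -
    let ?D' = "\<lambda>y. 2 * (x y - x' y) * (xdot y (x y) (s y) - xdot y (x' y) (s' y))
        + 2 * (s y - s' y) * (sdot y (x y) (s y) - sdot y (x' y) (s' y))"
    have d: "(flow_gap x s x' s' has_real_derivative ?D' z) (at z)" if z: "z \<in> {a..b}" for z
    proof -
      note fx = flow_onD(3,4)[OF f(1) z] flow_onD(3,4)[OF f(2) z]
      have "((\<lambda>y. (x y - x' y)\<^sup>2 + (s y - s' y)\<^sup>2) has_real_derivative ?D' z) (at z)"
        by (rule derivative_eq_intros fx refl)+ (simp add: algebra_simps)
      then show ?thesis by (simp add: flow_gap_def[abs_def])
    qed
    have bd: "\<bar>?D' z\<bar> \<le> L * flow_gap x s x' s' z" if z: "z \<in> {a..b}" for z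
    proof -
      let ?a = "\<bar>x z - x' z\<bar>" and ?b = "\<bar>s z - s' z\<bar>"
      have X: "\<bar>xdot z (x z) (s z) - xdot z (x' z) (s' z)\<bar> \<le> K * (?a + ?b)"
        and Y: "\<bar>sdot z (x z) (s z) - sdot z (x' z) (s' z)\<bar> \<le> K * (?a + ?b)"
        using Kl[OF conjunct1 conjunct2, OF box[OF z] box[OF z]] by (simp_all add: dist_real_def)
      have "\<bar>?D' z\<bar> \<le> \<bar>2 * (x z - x' z) * (xdot z (x z) (s z) - xdot z (x' z) (s' z))\<bar>
          + \<bar>2 * (s z - s' z) * (sdot z (x z) (s z) - sdot z (x' z) (s' z))\<bar>"
        by (rule abs_triangle_ineq)
      also have "\<dots> = 2 * ?a * \<bar>xdot z (x z) (s z) - xdot z (x' z) (s' z)\<bar>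
          + 2 * ?b * \<bar>sdot z (x z) (s z) - sdot z (x' z) (s' z)\<bar>"
        by (simp only: abs_mult abs_numeral)
      also have "\<dots> \<le> 2 * ?a * (K * (?a + ?b)) + 2 * ?b * (K * (?a + ?b))"
        using X Y by (intro add_mono mult_left_mono) auto
      also have "\<dots> = 2 * K * (?a + ?b)\<^sup>2" by (simp add: power2_eq_square algebra_simps)
      also have "\<dots> \<le> 2 * K * (2 * (?a\<^sup>2 + ?b\<^sup>2))"
        using K sum_squares_bound[of ?a ?b] by (intro mult_left_mono) (auto simp: power2_sum)
      also have "\<dots> = L * flow_gap x s x' s' z" by (simp add: L_def flow_gap_def algebra_simps)
      finally show ?thesis .
    qed
    have "flow_gap x s x' s' y \<le> flow_gap x s x' s' a * exp (L * (y - a))"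
      using y d bd by (intro gronwall_two_sided(1)[of a y _ ?D']) auto
    moreover have "flow_gap x s x' s' y \<le> flow_gap x s x' s' b * exp (L * (b - y))"
      using y d bd by (intro gronwall_two_sided(2)[of y b _ ?D']) auto
    ultimately show ?thesis by blast
  qed
  have L: "L \<ge> 0" using K by (simp add: L_def)
  show ?thesis
    by (intro exI[of _ L] conjI allI impI L ballI) (use main in auto)
qed

lemma flow_in_box:
  assumes f: "flow_on {a..b} x s"
  shows "\<exists>m>0. \<exists>R\<ge>1. \<forall>y\<in>{a..b}. (y, x y, s y) \<in> regular_box m R"
proof (cases "a \<le> b")
  case False
  then show ?thesis by (intro exI[of _ 1]) auto
next
  case True
  note c = flow_on_continuous[OF f]
  obtain M1 where M1: "\<forall>y\<in>{a..b}. \<bar>x y\<bar> \<le> M1"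
    using compact_imp_bounded[OF compact_continuous_image[OF c(1) compact_Icc]] by (auto simp: bounded_iff)
  obtain M2 where M2: "\<forall>y\<in>{a..b}. \<bar>s y\<bar> \<le> M2"
    using compact_imp_bounded[OF compact_continuous_image[OF c(2) compact_Icc]] by (auto simp: bounded_iff)
  have "continuous_on {a..b} (\<lambda>y. \<bar>1 - (x y)\<^sup>2\<bar>)" by (intro continuous_intros c)
  then obtain y0 where y0: "y0 \<in> {a..b}" "\<forall>y\<in>{a..b}. \<bar>1 - (x y0)\<^sup>2\<bar> \<le> \<bar>1 - (x y)\<^sup>2\<bar>"
    using continuous_attains_inf[of "{a..b}" "\<lambda>y. \<bar>1 - (x y)\<^sup>2\<bar>"] True by auto
  have pos: "a > 0" using flow_onD(1)[OF f] True by auto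
  have "\<bar>1 - (x y0)\<^sup>2\<bar> > 0" using flow_onD(2)[OF f y0(1)] by auto
  moreover have "(y, x y, s y) \<in> regular_box (min a \<bar>1 - (x y0)\<^sup>2\<bar>) (max 1 (max b (max M1 M2)))"
    if "y \<in> {a..b}" for y
    using that M1 M2 y0 pos by (auto simp: regular_box_def le_max_iff_disj min_le_iff_disj)
  ultimately show ?thesis using pos
    by (intro exI[of _ "min a \<bar>1 - (x y0)\<^sup>2\<bar>"] conjI exI[of _ "max 1 (max b (max M1 M2))"]) auto
qed

lemma regular_box_mono: "(y, x, s) \<in> regular_box m R \<Longrightarrow> m' \<le> m \<Longrightarrow> R \<le> R' \<Longrightarrow> (y, x, s) \<in> regular_box m' R'"
  by (auto simp: regular_box_def)

lemma flow_unique_Icc: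
  assumes f: "flow_on {a..b} x s" "flow_on {a..b} x' s'" and c: "c \<in> {a..b}" "c = a \<or> c = b"
    and eq: "x c = x' c" "s c = s' c" and y: "y \<in> {a..b}"
  shows "x y = x' y \<and> s y = s' y"
proof -
  obtain m R where 1: "m > 0" "\<forall>y\<in>{a..b}. (y, x y, s y) \<in> regular_box m R"
    using flow_in_box[OF f(1)] by blast
  obtain m' R' where 2: "m' > 0" "\<forall>y\<in>{a..b}. (y, x' y, s' y) \<in> regular_box m' R'"
    using flow_in_box[OF f(2)] by blast
  have m: "min m m' > 0" using 1 2 by simp
  obtain L where L: "\<And>a b x s x' s'. flow_on {a..b} x s \<and> flow_on {a..b} x' s' \<and>
     (\<forall>y\<in>{a..b}. (y, x y, s y) \<in> regular_box (min m m') (max R R') \<and> (y, x' y, s' y) \<in> regular_box (min m m') (max R R')) \<Longrightarrow>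
     (\<forall>y\<in>{a..b}. flow_gap x s x' s' y \<le> flow_gap x s x' s' a * exp (L * (y - a)) \<and>
        flow_gap x s x' s' y \<le> flow_gap x s x' s' b * exp (L * (b - y)))"
    using flow_stability[OF m, of "max R R'"] by blast
  have "\<forall>y\<in>{a..b}. flow_gap x s x' s' y \<le> flow_gap x s x' s' a * exp (L * (y - a)) \<and>
        flow_gap x s x' s' y \<le> flow_gap x s x' s' b * exp (L * (b - y))"
    using f 1 2 by (intro L) (auto intro: regular_box_mono)
  then have "flow_gap x s x' s' y \<le> 0" using y c eq by (auto simp: flow_gap_def)
  then show ?thesis unfolding flow_gap_def by (smt (verit) sum_power2_le_zero_iff)
qed

lemma flow_unique:
  assumes f: "flow_on I x s" "flow_on I x' s'" and I: "is_interval I" and c: "c \<in> I"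
    and eq: "x c = x' c" "s c = s' c" and y: "y \<in> I"
  shows "x y = x' y \<and> s y = s' y"
proof (cases "c \<le> y")
  case True
  then have "{c..y} \<subseteq> I" using I c y by (meson atLeastAtMost_iff is_interval_1 subsetI)
  with True show ?thesis
    by (intro flow_unique_Icc[of c y x s x' s' c]) (auto intro: flow_on_subset[OF f(1)] flow_on_subset[OF f(2)] simp: eq)
next
  case False
  then have "{y..c} \<subseteq> I" using I c y by (meson atLeastAtMost_iff is_interval_1 subsetI)
  with False show ?thesis
    by (intro flow_unique_Icc[of y c x s x' s' c]) (auto intro: flow_on_subset[OF f(1)] flow_on_subset[OF f(2)] simp: eq)
qed

lemma flow_glue:
  assumes f: "flow_on {a<..<b} x s" "flow_on {a'<..<b'} x' s'"
    and p: "p \<in> {a<..<b}" "p \<in> {a'<..<b'}" "x p = x' p" "s p = s' p"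
  shows "\<exists>X S. flow_on {min a a'<..<max b b'} X S \<and> (\<forall>y\<in>{a<..<b}. X y = x y \<and> S y = s y) \<and>
     (\<forall>y\<in>{a'<..<b'}. X y = x' y \<and> S y = s' y)"
proof -
  have common: "x y = x' y \<and> s y = s' y" if "y \<in> {a<..<b} \<inter> {a'<..<b'}" for y
    by (rule flow_unique[of "{a<..<b} \<inter> {a'<..<b'}" x s x' s' p])
      (use f p that in \<open>auto intro: flow_on_subset simp: is_interval_1\<close>)
  define X S where "X y = (if y \<in> {a<..<b} then x y else x' y)" and "S y = (if y \<in> {a<..<b} then s y else s' y)" for y
  have 1: "\<forall>y\<in>{a<..<b}. X y = x y \<and> S y = s y" by (auto simp: X_def S_def)
  have 2: "\<forall>y\<in>{a'<..<b'}. X y = x' y \<and> S y = s' y" using common by (auto simp: X_def S_def)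
  have "flow_on {a<..<b} X S" by (rule flow_on_cong_open[OF f(1)]) (use 1 in auto)
  moreover have "flow_on {a'<..<b'} X S" by (rule flow_on_cong_open[OF f(2)]) (use 2 in auto)
  moreover have "y \<in> {a<..<b} \<or> y \<in> {a'<..<b'}" if "y \<in> {min a a'<..<max b b'}" for y
    using that p by auto
  ultimately have "flow_on {min a a'<..<max b b'} X S" unfolding flow_on_def by blast
  with 1 2 show ?thesis by blast
qed

text \<open>
  If every solution that exists up to some \<open>b\<close> between \<open>y\<^sub>1\<close> and \<open>a\<close> still lies in the box at \<open>b\<close>, then
  the solution exists up to \<open>a\<close>: the local existence theorem extends it each time by the same length, so
  finitely many steps suffice. The direction from \<open>y\<^sub>1\<close> to \<open>a\<close> is arbitrary.
\<close>

lemma flow_continuation: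
  assumes m: "m > 0" and R: "R \<ge> 1" and pos: "y1 > 0" "a > 0"
    and inv: "\<And>lo hi x s b. flow_on {lo<..<hi} x s \<Longrightarrow> x y1 = x1 \<Longrightarrow> s y1 = s1 \<Longrightarrow>
       b \<in> closed_segment y1 a \<Longrightarrow> closed_segment y1 b \<subseteq> {lo<..<hi} \<Longrightarrow> (b, x b, s b) \<in> regular_box m R"
    and start: "(y1, x1, s1) \<in> regular_box m R"
  shows "\<exists>lo hi x s. flow_on {lo<..<hi} x s \<and> closed_segment y1 a \<subseteq> {lo<..<hi} \<and> x y1 = x1 \<and> s y1 = s1"
proof -
  obtain d where d: "d > 0" and loc: "\<And>y0 x0 s0. (y0, x0, s0) \<in> regular_box m R \<Longrightarrow> y0 > 0 \<Longrightarrow>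
    (\<exists>x s. flow_on {y0 - d<..<y0 + d} x s \<and> x y0 = x0 \<and> s y0 = s0)"
    using local_flow[OF m R] by blast
  define \<eta> where "\<eta> = d / (2 * (\<bar>a - y1\<bar> + 1))"
  have \<eta>: "\<eta> > 0" "\<eta> * \<bar>a - y1\<bar> < d"
  proof -
    show "\<eta> > 0" using d by (simp add: \<eta>_def add_nonneg_pos)
    have "\<eta> * \<bar>a - y1\<bar> \<le> \<eta> * (\<bar>a - y1\<bar> + 1)" using \<open>\<eta> > 0\<close> by (intro mult_left_mono) auto
    also have "\<dots> = d / 2"
    proof -
      have half: "d / (2 * q) * q = d / 2" if "q \<noteq> 0" for q using that by simp
      show ?thesis unfolding \<eta>_def by (rule half) linarith
    qed
    finally show "\<eta> * \<bar>a - y1\<bar> < d" using d by simp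
  qed
  \<comment> \<open>The grid points run from \<open>y\<^sub>1\<close> to \<open>a\<close> and stop there.\<close>
  define B where "B n = y1 + min 1 (real n * \<eta>) * (a - y1)" for n
  have Bseg: "B n \<in> closed_segment y1 a" for n
    unfolding B_def closed_segment_def using \<eta>
    by (intro CollectI exI[of _ "min 1 (real n * \<eta>)"]) (auto simp: algebra_simps)
  have Bpos: "B n > 0" for n
    using Bseg[of n] pos unfolding closed_segment_eq_real_ivl by (auto split: if_splits)
  have Bstep: "\<bar>B (Suc n) - B n\<bar> < d" for n
  proof -
    have "B (Suc n) - B n = (min 1 (real (Suc n) * \<eta>) - min 1 (real n * \<eta>)) * (a - y1)"
      by (simp add: B_def algebra_simps)
    moreover have "\<bar>min 1 (real (Suc n) * \<eta>) - min 1 (real n * \<eta>)\<bar> \<le> \<eta>"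
      using \<eta> by (auto simp: min_def algebra_simps)
    ultimately have "\<bar>B (Suc n) - B n\<bar> \<le> \<eta> * \<bar>a - y1\<bar>" by (simp add: abs_mult mult_right_mono)
    then show ?thesis using \<eta> by simp
  qed
  have ex: "\<exists>lo hi x s. flow_on {lo<..<hi} x s \<and> closed_segment y1 (B n) \<subseteq> {lo<..<hi} \<and> x y1 = x1 \<and> s y1 = s1" for n
  proof (induction n)
    case 0
    obtain x s where "flow_on {y1 - d<..<y1 + d} x s" "x y1 = x1" "s y1 = s1"
      using loc[OF start pos(1)] by blast
    moreover have "closed_segment y1 (B 0) \<subseteq> {y1 - d<..<y1 + d}" using d by (simp add: B_def)
    ultimately show ?case by blast
  next
    case (Suc n)
    then obtain lo hi x s where f: "flow_on {lo<..<hi} x s" "closed_segment y1 (B n) \<subseteq> {lo<..<hi}" "x y1 = x1" "s y1 = s1"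
      by blast
    have Bin: "B n \<in> {lo<..<hi}" "y1 \<in> {lo<..<hi}" using f(2) by auto
    have "(B n, x (B n), s (B n)) \<in> regular_box m R" by (rule inv[OF f(1,3,4) Bseg f(2)])
    from loc[OF this Bpos] obtain x' s' where f': "flow_on {B n - d<..<B n + d} x' s'" "x' (B n) = x (B n)" "s' (B n) = s (B n)"
      by blast
    obtain X S where XS: "flow_on {min lo (B n - d)<..<max hi (B n + d)} X S" "\<forall>y\<in>{lo<..<hi}. X y = x y \<and> S y = s y"
      using flow_glue[OF f(1) f'(1) Bin(1)] f' d by fastforce
    have "B (Suc n) \<in> {min lo (B n - d)<..<max hi (B n + d)}" using Bstep[of n] by (auto simp: abs_less_iff)
    moreover have "y1 \<in> {min lo (B n - d)<..<max hi (B n + d)}" using Bin by auto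
    ultimately have "closed_segment y1 (B (Suc n)) \<subseteq> {min lo (B n - d)<..<max hi (B n + d)}"
      by (auto simp: closed_segment_eq_real_ivl split: if_splits)
    moreover have "X y1 = x1" "S y1 = s1" using XS(2) Bin f by auto
    ultimately show ?case using XS(1) by blast
  qed
  obtain n :: nat where "1 \<le> real n * \<eta>" using reals_Archimedean3[OF \<eta>(1)] less_imp_le by blast
  then have "B n = a" by (simp add: B_def)
  with ex[of n] show ?thesis by simp
qed

text \<open>
  The local solution is holomorphic, and by uniqueness it is the given one.
\<close>

lemma flow_holomorphic_extension:
  assumes f: "flow_on {a<..<b} x s" and y0: "y0 \<in> {a<..<b}"
  shows "\<exists>r>0. \<exists>X S. X holomorphic_on ball (of_real y0) r \<and> S holomorphic_on ball (of_real y0) r \<and>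
     (\<forall>y. \<bar>y - y0\<bar> < r \<longrightarrow> X (of_real y) = of_real (x y) \<and> S (of_real y) = of_real (s y))"
proof -
  have "flow_on {y0..y0} x s" using flow_on_subset[OF f] y0 by auto
  then obtain m R where m: "m > 0" "R \<ge> 1" "(y0, x y0, s y0) \<in> regular_box m R"
    using flow_in_box[of y0 y0 x s] by auto
  have pos: "y0 > 0" using flow_onD(1)[OF f y0] .
  obtain d x' s' X S where d: "d > 0" "flow_on {y0 - d<..<y0 + d} x' s'" "x' y0 = x y0" "s' y0 = s y0"
    "X holomorphic_on ball (of_real y0) d" "S holomorphic_on ball (of_real y0) d"
    "\<forall>y. \<bar>y - y0\<bar> < d \<longrightarrow> X (of_real y) = of_real (x' y) \<and> S (of_real y) = of_real (s' y)"
    using local_flow[OF m(1,2)] m(3) pos by metis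
  define r where "r = min d (min (y0 - a) (b - y0))"
  have r: "r > 0" "r \<le> d" using d y0 by (auto simp: r_def)
  have "x' y = x y \<and> s' y = s y" if "\<bar>y - y0\<bar> < r" for y
  proof (rule flow_unique[of "{y0 - r<..<y0 + r}" x' s' x s y0])
    show "flow_on {y0 - r<..<y0 + r} x' s'" by (rule flow_on_subset[OF d(2)]) (use r in auto)
    show "flow_on {y0 - r<..<y0 + r} x s" by (rule flow_on_subset[OF f]) (auto simp: r_def)
  qed (use that r d in \<open>auto simp: is_interval_1\<close>)
  moreover have "ball (complex_of_real y0) r \<subseteq> ball (of_real y0) d" using r by auto
  ultimately show ?thesis using d r
    by (intro exI[of _ r] conjI exI[of _ X] exI[of _ S]) (auto intro: holomorphic_on_subset)
qed

lemma last_zero_before: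
  fixes \<phi> :: "real \<Rightarrow> real"
  assumes c: "continuous_on {a..b} \<phi>" and b: "\<phi> b > 0" and y: "y \<in> {a..b}" "\<phi> y \<le> 0"
  shows "\<exists>w\<in>{a..<b}. \<phi> w = 0 \<and> (\<forall>y\<in>{w<..b}. \<phi> y > 0)"
proof -
  let ?S = "{y \<in> {a..b}. \<phi> y \<le> 0}"
  have "closed ({a..b} \<inter> \<phi> -` {..0})"
    by (rule continuous_closed_preimage[OF c closed_atLeastAtMost closed_atMost])
  then have "compact ({a..b} \<inter> ({a..b} \<inter> \<phi> -` {..0}))" by (rule compact_Int_closed[OF compact_Icc])
  moreover have "{a..b} \<inter> ({a..b} \<inter> \<phi> -` {..0}) = ?S" by auto
  ultimately have "compact ?S" by simp
  moreover have "?S \<noteq> {}" using y by auto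
  ultimately obtain w where w: "w \<in> ?S" "\<forall>y\<in>?S. y \<le> w" using compact_attains_sup[of ?S] by blast
  have wb: "w < b" using w b by (cases "w = b") auto
  have gt: "\<phi> v > 0" if "v \<in> {w<..b}" for v
  proof (rule ccontr)
    assume "\<not> \<phi> v > 0"
    then have "v \<in> ?S" using that w by auto
    then have "v \<le> w" using w(2) by blast
    then show False using that by auto
  qed
  have "\<phi> w = 0"
  proof (rule ccontr)
    assume "\<phi> w \<noteq> 0"
    then have "\<phi> w < 0" using w by auto
    have "continuous_on {w..b} \<phi>" by (rule continuous_on_subset[OF c]) (use w in auto)
    from IVT'[OF _ _ _ this, of 0] obtain v where "w \<le> v" "v \<le> b" "\<phi> v = 0"
      using \<open>\<phi> w < 0\<close> b wb by auto
    then show False using gt[of v] \<open>\<phi> w < 0\<close> by (cases "v = w") auto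
  qed
  with gt wb w show ?thesis by (intro bexI[of _ w]) auto
qed

lemma first_zero_after:
  fixes \<phi> :: "real \<Rightarrow> real"
  assumes c: "continuous_on {a..b} \<phi>" and a: "\<phi> a > 0" and y: "y \<in> {a..b}" "\<phi> y \<le> 0"
  shows "\<exists>w\<in>{a<..b}. \<phi> w = 0 \<and> (\<forall>y\<in>{a..<w}. \<phi> y > 0)"
proof -
  have "continuous_on {-b..-a} (\<lambda>y. \<phi> (- y))"
    by (rule continuous_on_compose2[OF c]) (auto intro!: continuous_intros)
  from last_zero_before[OF this, of "- y"] a y
  obtain w where w: "w \<in> {-b..<-a}" "\<phi> (- w) = 0" "\<forall>y\<in>{w<..-a}. \<phi> (- y) > 0" by auto
  have "\<phi> v > 0" if "v \<in> {a..<-w}" for v using w(3)[rule_format, of "- v"] that by auto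
  then show ?thesis using w by (intro bexI[of _ "- w"]) auto
qed

text \<open>
  The nearby solution is continued to the left by \<open>flow_continuation\<close>; the a priori bound is a bootstrap:
  at the last point where the gap still equals \<open>d\<^sup>2\<close>, Gronwall applied between this point and \<open>y\<^sub>1\<close> gives a
  gap smaller than \<open>d\<^sup>2\<close>.
\<close>

lemma flow_continuous_dependence:
  assumes f: "flow_on {lo<..<hi} x s" and ab: "{a..y1} \<subseteq> {lo<..<hi}" "a \<le> y1" and e: "\<epsilon> > 0"
  shows "\<exists>\<eta>>0. \<forall>x1 s1. \<bar>x1 - x y1\<bar> < \<eta> \<and> \<bar>s1 - s y1\<bar> < \<eta> \<longrightarrow>
    (\<exists>lo' hi' x' s'. flow_on {lo'<..<hi'} x' s' \<and> {a..y1} \<subseteq> {lo'<..<hi'} \<and> x' y1 = x1 \<and> s' y1 = s1 \<and>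
       (\<forall>y\<in>{a..y1}. \<bar>x' y - x y\<bar> < \<epsilon> \<and> \<bar>s' y - s y\<bar> < \<epsilon>))"
proof -
  have fI: "flow_on {a..y1} x s" by (rule flow_on_subset[OF f ab(1)])
  obtain m R where m: "m > 0" and R: "R \<ge> 1" and box: "\<forall>y\<in>{a..y1}. (y, x y, s y) \<in> regular_box m R"
    using flow_in_box[OF fI] by blast
  define d where "d = min \<epsilon> (min 1 (m / (8 * R)))"
  have d: "d > 0" "d \<le> \<epsilon>" "d \<le> 1" "8 * R * d \<le> m"
  proof -
    have "8 * R * d \<le> 8 * R * (m / (8 * R))" unfolding d_def using R by (intro mult_left_mono) auto
    then show "8 * R * d \<le> m" using R by simp
  qed (use m R e in \<open>auto simp: d_def\<close>)
  have m2: "m / 2 > 0" using m by simp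
  obtain L where L: "L \<ge> 0" "\<And>a b x s x' s'. flow_on {a..b} x s \<and> flow_on {a..b} x' s' \<and>
     (\<forall>y\<in>{a..b}. (y, x y, s y) \<in> regular_box (m / 2) (R + 1) \<and> (y, x' y, s' y) \<in> regular_box (m / 2) (R + 1)) \<Longrightarrow>
     (\<forall>y\<in>{a..b}. flow_gap x s x' s' y \<le> flow_gap x s x' s' a * exp (L * (y - a)) \<and>
        flow_gap x s x' s' y \<le> flow_gap x s x' s' b * exp (L * (b - y)))"
    using flow_stability[OF m2, of "R + 1"] by blast
  define E where "E = exp (L * (y1 - a))"
  have E: "E \<ge> 1" using L ab by (simp add: E_def)
  \<comment> \<open>\<open>E\<close> bounds the Gronwall factor, so a gap of at most \<open>2 \<eta>\<^sup>2\<close> at \<open>y\<^sub>1\<close> grows to less than \<open>d\<^sup>2\<close>.\<close>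
  define \<eta> where "\<eta> = d / (2 * E)"
  have \<eta>: "\<eta> > 0" using d E by (simp add: \<eta>_def)
  have \<eta>2: "2 * \<eta>\<^sup>2 * E < d\<^sup>2"
  proof -
    have "2 * \<eta>\<^sup>2 * E = d\<^sup>2 / (2 * E)" using E by (simp add: \<eta>_def power2_eq_square field_simps)
    also have "\<dots> < d\<^sup>2 / 1" using d E by (intro divide_strict_left_mono) auto
    finally show ?thesis by simp
  qed
  have close: "(y, x' y, s' y) \<in> regular_box (m / 2) (R + 1) \<and> \<bar>x' y - x y\<bar> < \<epsilon> \<and> \<bar>s' y - s y\<bar> < \<epsilon>"
    if f': "flow_on {lo'<..<hi'} x' s'" "{b..y1} \<subseteq> {lo'<..<hi'}" "b \<in> {a..y1}"
      and st: "\<bar>x' y1 - x y1\<bar> < \<eta>" "\<bar>s' y1 - s y1\<bar> < \<eta>" and y: "y \<in> {b..y1}" for lo' hi' x' s' b y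
  proof -
    let ?g = "flow_gap x s x' s'"
    have fb: "flow_on {b..y1} x s" by (rule flow_on_subset[OF fI]) (use that in auto)
    have fb': "flow_on {b..y1} x' s'" by (rule flow_on_subset[OF f'(1,2)])
    have box_y: "(y, x' y, s' y) \<in> regular_box (m / 2) (R + 1) \<and> \<bar>x' y - x y\<bar> \<le> d \<and> \<bar>s' y - s y\<bar> \<le> d"
      if "?g y \<le> d\<^sup>2" "y \<in> {b..y1}" for y
    proof -
      have "(x' y - x y)\<^sup>2 \<le> d\<^sup>2" "(s' y - s y)\<^sup>2 \<le> d\<^sup>2"
        using that(1) unfolding flow_gap_def power2_commute[of "x y"] power2_commute[of "s y"]
        by (smt (verit) zero_le_power2)+
      then have le: "\<bar>x' y - x y\<bar> \<le> d" "\<bar>s' y - s y\<bar> \<le> d" using d by (auto intro: power2_le_imp_le simp flip: abs_le_square_iff)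
      have "(y + 0, x y + (x' y - x y), s y + (s' y - s y)) \<in> regular_box (m / 2) (R + 1)"
        using box that f'(3) le d by (intro regular_box_shift[OF _ R m _ _ _ d(3,4)]) auto
      then show ?thesis using le by simp
    qed
    have g1: "?g y1 * E < d\<^sup>2"
    proof -
      have "(x y1 - x' y1)\<^sup>2 \<le> \<eta>\<^sup>2" "(s y1 - s' y1)\<^sup>2 \<le> \<eta>\<^sup>2"
        using st \<eta> by (auto simp: abs_minus_commute simp flip: abs_le_square_iff)
      then have "?g y1 * E \<le> 2 * \<eta>\<^sup>2 * E" using E unfolding flow_gap_def by (intro mult_right_mono) auto
      then show ?thesis using \<eta>2 by linarith
    qed
    have g0: "0 \<le> ?g y" for y by (simp add: flow_gap_def)
    have "?g y1 * 1 \<le> ?g y1 * E" using E g0 by (intro mult_left_mono) auto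
    then have gy1: "?g y1 < d\<^sup>2" using g1 by linarith
    have less: "?g y < d\<^sup>2" if y: "y \<in> {b..y1}" for y
    proof (rule ccontr)
      assume "\<not> ?g y < d\<^sup>2"
      have "continuous_on {b..y1} (\<lambda>y. d\<^sup>2 - ?g y)"
        unfolding flow_gap_def by (intro continuous_intros flow_on_continuous[OF fb] flow_on_continuous[OF fb'])
      from last_zero_before[OF this, of y] gy1 y \<open>\<not> ?g y < d\<^sup>2\<close>
      obtain w where w: "w \<in> {b..<y1}" "?g w = d\<^sup>2" "\<forall>y\<in>{w<..y1}. ?g y < d\<^sup>2" by auto
      have le: "?g y \<le> d\<^sup>2" if "y \<in> {w..y1}" for y using w that by (cases "y = w") (auto intro: less_imp_le)
      have sub: "{w..y1} \<subseteq> {b..y1}" using w by auto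
      have "\<forall>y\<in>{w..y1}. ?g y \<le> ?g w * exp (L * (y - w)) \<and> ?g y \<le> ?g y1 * exp (L * (y1 - y))"
      proof (rule L(2), intro conjI ballI)
        fix y assume y: "y \<in> {w..y1}"
        then have "y \<in> {b..y1}" using sub by auto
        then show "(y, x' y, s' y) \<in> regular_box (m / 2) (R + 1)" using box_y le[OF y] by blast
        have "(y, x y, s y) \<in> regular_box m R" using box \<open>y \<in> {b..y1}\<close> f'(3) by auto
        then show "(y, x y, s y) \<in> regular_box (m / 2) (R + 1)" by (rule regular_box_mono) (use m in auto)
      qed (use fb fb' sub in \<open>auto intro: flow_on_subset\<close>)
      then have "?g w \<le> ?g y1 * exp (L * (y1 - w))" using w(1) by (metis atLeastAtMost_iff atLeastLessThan_iff less_imp_le order_refl)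
      also have "\<dots> \<le> ?g y1 * E" unfolding E_def using L w f'(3) g0 by (intro mult_left_mono) (auto intro!: mult_left_mono)
      finally show False using g1 w by simp
    qed
    have "\<bar>x' y - x y\<bar> < d" "\<bar>s' y - s y\<bar> < d"
    proof -
      have "(x' y - x y)\<^sup>2 < d\<^sup>2" "(s' y - s y)\<^sup>2 < d\<^sup>2"
        using less[OF y] unfolding flow_gap_def power2_commute[of "x y"] power2_commute[of "s y"]
        by (smt (verit) zero_le_power2)+
      then have "\<bar>x' y - x y\<bar>\<^sup>2 < d\<^sup>2" "\<bar>s' y - s y\<bar>\<^sup>2 < d\<^sup>2" by simp_all
      then show "\<bar>x' y - x y\<bar> < d" "\<bar>s' y - s y\<bar> < d" using d by (auto intro: power2_less_imp_less)
    qed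
    then show ?thesis using box_y[OF less_imp_le[OF less[OF y]] y] d by linarith
  qed
  have "\<exists>lo' hi' x' s'. flow_on {lo'<..<hi'} x' s' \<and> {a..y1} \<subseteq> {lo'<..<hi'} \<and> x' y1 = x1 \<and> s' y1 = s1 \<and>
       (\<forall>y\<in>{a..y1}. \<bar>x' y - x y\<bar> < \<epsilon> \<and> \<bar>s' y - s y\<bar> < \<epsilon>)" if st: "\<bar>x1 - x y1\<bar> < \<eta>" "\<bar>s1 - s y1\<bar> < \<eta>" for x1 s1
  proof -
    have seg: "closed_segment y1 b = {b..y1}" if "b \<le> y1" for b using that by (simp add: closed_segment_eq_real_ivl)
    have pos: "a > 0" "y1 > 0" using flow_onD(1)[OF fI] ab by auto
    have "\<exists>lo' hi' x' s'. flow_on {lo'<..<hi'} x' s' \<and> closed_segment y1 a \<subseteq> {lo'<..<hi'} \<and> x' y1 = x1 \<and> s' y1 = s1"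
    proof (rule flow_continuation[OF m2 _ pos(2,1)])
      fix lo' hi' x' s' b
      assume "flow_on {lo'<..<hi'} x' s'" "x' y1 = x1" "s' y1 = s1" "b \<in> closed_segment y1 a" "closed_segment y1 b \<subseteq> {lo'<..<hi'}"
      then show "(b, x' b, s' b) \<in> regular_box (m / 2) (R + 1)"
        using close[of lo' hi' x' s' b b] st seg ab by auto
    next
      have "(y1 + 0, x y1 + (x1 - x y1), s y1 + (s1 - s y1)) \<in> regular_box (m / 2) (R + 1)"
      proof (rule regular_box_shift[OF _ R m _ _ _ d(3,4)])
        have "\<eta> \<le> d / 1" unfolding \<eta>_def using d E by (intro divide_left_mono) auto
        then show "norm (x1 - x y1) \<le> d" "norm (s1 - s y1) \<le> d" using st by auto
      qed (use box ab d in auto)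
      then show "(y1, x1, s1) \<in> regular_box (m / 2) (R + 1)" by simp
    qed (use R in auto)
    then obtain lo' hi' x' s' where f': "flow_on {lo'<..<hi'} x' s'" "{a..y1} \<subseteq> {lo'<..<hi'}" "x' y1 = x1" "s' y1 = s1"
      using seg ab by auto
    have "\<forall>y\<in>{a..y1}. \<bar>x' y - x y\<bar> < \<epsilon> \<and> \<bar>s' y - s y\<bar> < \<epsilon>"
      using close[OF f'(1,2)] st ab f'(3,4) by auto
    with f' show ?thesis by blast
  qed
  with \<eta> show ?thesis by blast
qed

text \<open>
  Solutions on larger and larger intervals agree by uniqueness and have a common extension.
\<close>

lemma flow_exhaust:
  assumes ex: "\<And>a. a \<in> I \<Longrightarrow> \<exists>lo hi x s. flow_on {lo<..<hi} x s \<and> closed_segment y1 a \<subseteq> {lo<..<hi} \<and> x y1 = x1 \<and> s y1 = s1"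
    and I: "open I" "y1 \<in> I"
  shows "\<exists>x s. flow_on I x s \<and> x y1 = x1 \<and> s y1 = s1"
proof -
  have "\<forall>a\<in>I. \<exists>w. (\<exists>lo hi. flow_on {lo<..<hi} (fst w) (snd w) \<and> closed_segment y1 a \<subseteq> {lo<..<hi}) \<and> fst w y1 = x1 \<and> snd w y1 = s1"
    using ex by (metis fst_conv snd_conv)
  then obtain w where w: "\<forall>a\<in>I. (\<exists>lo hi. flow_on {lo<..<hi} (fst (w a)) (snd (w a)) \<and> closed_segment y1 a \<subseteq> {lo<..<hi}) \<and> fst (w a) y1 = x1 \<and> snd (w a) y1 = s1"
    by (rule bchoice[THEN exE])
  have wv: "fst (w a) y1 = x1" "snd (w a) y1 = s1" if "a \<in> I" for a using w that by blast+
  define x s where "x y = fst (w y) y" and "s y = snd (w y) y" for y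
  have "flow_on I x s"
  proof -
    have "\<exists>J. open J \<and> y \<in> J \<and> flow_on J x s" if y: "y \<in> I" for y
    proof -
      obtain lo hi where f: "flow_on {lo<..<hi} (fst (w y)) (snd (w y))" "closed_segment y1 y \<subseteq> {lo<..<hi}"
        using w y by blast
      have yin: "y \<in> {lo<..<hi}" "y1 \<in> {lo<..<hi}" using f(2) by auto
      have eq: "x v = fst (w y) v \<and> s v = snd (w y) v" if v: "v \<in> {lo<..<hi} \<inter> I" for v
      proof -
        obtain lo' hi' where f': "flow_on {lo'<..<hi'} (fst (w v)) (snd (w v))" "closed_segment y1 v \<subseteq> {lo'<..<hi'}"
          using w v by blast
        have sub: "closed_segment y1 v \<subseteq> {lo<..<hi}"
          using v yin by (auto simp: closed_segment_eq_real_ivl split: if_splits)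
        have "fst (w v) v = fst (w y) v \<and> snd (w v) v = snd (w y) v"
        proof (rule flow_unique[OF flow_on_subset[OF f'(1,2)] flow_on_subset[OF f(1) sub]])
          show "is_interval (closed_segment y1 v)"
            unfolding closed_segment_eq_real_ivl by (cases "y1 \<le> v") (simp_all add: is_interval_cc)
          show "y1 \<in> closed_segment y1 v" "v \<in> closed_segment y1 v" by (rule ends_in_segment)+
          show "fst (w v) y1 = fst (w y) y1" "snd (w v) y1 = snd (w y) y1" using wv[of v] wv[of y] v y by auto
        qed
        then show ?thesis by (simp add: x_def s_def)
      qed
      have "flow_on ({lo<..<hi} \<inter> I) (fst (w y)) (snd (w y))" by (rule flow_on_subset[OF f(1)]) auto
      then have "flow_on ({lo<..<hi} \<inter> I) x s"
        by (rule flow_on_cong_open[OF _ open_Int[OF open_greaterThanLessThan I(1)] eq])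
      then show ?thesis using yin y I by (intro exI[of _ "{lo<..<hi} \<inter> I"]) auto
    qed
    then show ?thesis unfolding flow_on_def by blast
  qed
  moreover have "x y1 = x1" "s y1 = s1" using wv[OF I(2)] by (auto simp: x_def s_def)
  ultimately show ?thesis by blast
qed

section \<open>The germ at the sonic point\<close>

text \<open>
  With \<open>t = y - z\<close>, \<open>x = 1 + t g\<close>, \<open>g = (1 - 1/z) + t u\<close> and \<open>s = 1 + t\<^sup>2 v\<close>, the functions \<open>slope_rem\<close> and
  \<open>curv_rem\<close> are what is left of \<open>x'\<close> and \<open>s'\<close> once the leading terms and a power of \<open>t\<close> have been split off
  (\<open>xdot_slope\<close> and \<open>sdot_curv\<close>). They have no pole at \<open>t = 0\<close>.
\<close>

definition slope_rem :: "'a::field \<Rightarrow> 'a \<Rightarrow> 'a \<Rightarrow> 'a \<Rightarrow> 'a" where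
  "slope_rem t g v z = (2 - z * g + t * g - 2 * z * (1 + t * g)\<^sup>2 * v / g) / (z * (2 + t * g) * (z + t))"

definition curv_rem :: "'a::field \<Rightarrow> 'a \<Rightarrow> 'a \<Rightarrow> 'a \<Rightarrow> 'a \<Rightarrow> 'a" where
  "curv_rem t g u v z = - u / (2 * z) - u * v / (g * (z - 1))
     + ((g\<^sup>2 - 2 * v) * (2 + g * z + t * g) - 2 * z * (t * v * (g\<^sup>2 - 2 * v) - 2 * g * v - 2 * t\<^sup>2 * g * v\<^sup>2))
       / (2 * g * z * (2 + t * g) * (z + t))"

lemma xdot_slope:
  fixes z t g v :: "'a::real_normed_field"
  assumes nz: "z \<noteq> 0" "t \<noteq> 0" "g \<noteq> 0" "2 + t * g \<noteq> 0" "z + t \<noteq> 0"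
  shows "xdot (z + t) (1 + t * g) (1 + t\<^sup>2 * v) = (1 - 1 / z) + t * slope_rem t g v z"
proof -
  have a: "1 - (1 + t * g)\<^sup>2 = - (t * (g * (2 + t * g)))" by (simp add: power2_eq_square algebra_simps)
  have b: "1 - (1 + t * g) * (1 + t\<^sup>2 * v) = - (t * (g + t * v * (1 + t * g)))"
    by (simp add: power2_eq_square algebra_simps)
  have "xdot (z + t) (1 + t * g) (1 + t\<^sup>2 * v)
      = 1 - 2 * (1 + t * g) * (g + t * v * (1 + t * g)) / ((z + t) * (g * (2 + t * g)))"
    unfolding xdot_def a b using nz by (simp add: divide_simps)
  also have "\<dots> = (1 - 1 / z) + t * slope_rem t g v z"
    unfolding slope_rem_def using nz by (simp add: divide_simps) algebra
  finally show ?thesis .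
qed

text \<open>
  The term \<open>v / (z - 1)\<close> is linear in \<open>v\<close> and not small, so it is moved to the left-hand side of the
  equation for \<open>v\<close>, where it changes the exponent \<open>2\<close> to \<open>2 - 1/(z - 1)\<close>. Everything else that depends on
  \<open>u\<close> or \<open>v\<close> carries an additional factor \<open>t\<close>.
\<close>

lemma sdot_curv:
  fixes z t g u v :: "'a::real_normed_field"
  assumes nz: "z \<noteq> 0" "z - 1 \<noteq> 0" "t \<noteq> 0" "g \<noteq> 0" "2 + t * g \<noteq> 0" "z + t \<noteq> 0"
    and g: "g = (1 - 1 / z) + t * u"
  shows "sdot (z + t) (1 + t * g) (1 + t\<^sup>2 * v)
    = t * (- (1 - 1 / z) / (2 * z) + t * curv_rem t g u v z + v / (z - 1))"
proof -
  define A where "A = g\<^sup>2 - 2 * v"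
  define N where "N = A * (2 + g * z + t * g) - 2 * z * (t * v * A - 2 * g * v - 2 * t\<^sup>2 * g * v\<^sup>2)"
  have a: "1 - (1 + t * g)\<^sup>2 = - (t * (g * (2 + t * g)))" by (simp add: power2_eq_square algebra_simps)
  have b: "1 + (1 + t * g)\<^sup>2 - 2 * (1 + t * g) * (1 + t\<^sup>2 * v) = t\<^sup>2 * (A - 2 * t * g * v)"
    by (simp add: A_def power2_eq_square algebra_simps)
  have gz: "g * z = z - 1 + t * u * z" unfolding g using nz by (simp add: field_simps)
  have 1: "sdot (z + t) (1 + t * g) (1 + t\<^sup>2 * v) = - t * ((1 + t\<^sup>2 * v) * (A - 2 * t * g * v) / (g * (2 + t * g) * (z + t)))"
    unfolding sdot_def a b using nz by (simp add: divide_simps power2_eq_square)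
  have 2: "(1 + t\<^sup>2 * v) * (A - 2 * t * g * v) / (g * (2 + t * g) * (z + t))
      = A / (2 * g * z) - t * (N / (2 * g * z * (2 + t * g) * (z + t)))"
    using nz by (simp add: divide_simps) (simp add: N_def power2_eq_square algebra_simps)
  have 3: "A / (2 * g * z) = g / (2 * z) - v / (g * z)"
    unfolding A_def using nz by (simp add: divide_simps power2_eq_square)
  have 4: "v / (g * z) - v / (z - 1) = - t * (u * v / (g * (z - 1)))"
  proof -
    have "v / (g * z) - v / (z - 1) = v * ((z - 1) - g * z) / (g * z * (z - 1))"
      using nz by (simp add: divide_simps) (simp add: algebra_simps)
    also have "(z - 1) - g * z = - (t * u * z)" by (simp add: gz)
    also have "v * - (t * u * z) / (g * z * (z - 1)) = - t * (u * v / (g * (z - 1)))"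
      using nz by (simp add: divide_simps)
    finally show ?thesis .
  qed
  have 5: "g / (2 * z) = (1 - 1 / z) / (2 * z) + t * (u / (2 * z))"
    unfolding g by (simp add: add_divide_distrib)
  have 6: "curv_rem t g u v z = - u / (2 * z) - u * v / (g * (z - 1)) + N / (2 * g * z * (2 + t * g) * (z + t))"
    by (simp add: curv_rem_def N_def A_def)
  have combine: "X = - t * (a - t * n) \<Longrightarrow> a = g2 - w1 \<Longrightarrow> w1 - w2 = - t * uv \<Longrightarrow> g2 = h + t * u2 \<Longrightarrow>
      R = - u2 - uv + n \<Longrightarrow> X = t * (- h + t * R + w2)" for X a n g2 w1 w2 uv h u2 R :: 'a
    by algebra
  have "- (1 - 1 / z) / (2 * z) = - ((1 - 1 / z) / (2 * z))" by (rule minus_divide_left[symmetric])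
  moreover have "curv_rem t g u v z = - (u / (2 * z)) - u * v / (g * (z - 1)) + N / (2 * g * z * (2 + t * g) * (z + t))"
    unfolding 6 by (simp only: minus_divide_left)
  ultimately show ?thesis by (simp only: combine[OF 1[unfolded 2] 3 4 5])
qed

text \<open>
  The Taylor coefficients of the germ: \<open>x = 1 + slope0 z \<cdot> t + bend0 z \<cdot> t\<^sup>2 + \<dots>\<close> and
  \<open>s = 1 + curv0 z \<cdot> t\<^sup>2 + \<dots>\<close>. The value \<open>curv0 z\<close> is forced by the equation for \<open>v\<close> at \<open>t = 0\<close>, whose
  constant term is \<open>curv_forcing z\<close> and whose exponent is \<open>curv_exponent z\<close>.
\<close>

definition slope0 :: "real \<Rightarrow> real" where "slope0 z = 1 - 1 / z"
definition curv_forcing :: "real \<Rightarrow> real" where "curv_forcing z = - (1 - 1 / z) / (2 * z)"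
definition curv_exponent :: "real \<Rightarrow> real" where "curv_exponent z = 2 - 1 / (z - 1)"
definition curv0 :: "real \<Rightarrow> real" where "curv0 z = - (z - 1)\<^sup>2 / (2 * z\<^sup>2 * (2 * z - 3))"
definition bend0 :: "real \<Rightarrow> real" where "bend0 z = (- z\<^sup>2 + 5 * z - 5) / (2 * z\<^sup>2 * (2 * z - 3))"

abbreviation slope_at :: "real \<Rightarrow> complex \<Rightarrow> complex \<Rightarrow> complex" where
  "slope_at z t u \<equiv> of_real (slope0 z) + t * u"

lemma slope0_bounds: "z \<in> {2..3} \<Longrightarrow> 1 / 2 \<le> slope0 z \<and> slope0 z \<le> 2 / 3"
  by (auto simp: slope0_def field_simps)

lemma curv_exponent_ge_1: "z \<in> {2..3} \<Longrightarrow> 1 \<le> curv_exponent z"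
  by (simp add: curv_exponent_def field_simps)

lemma curv0_quotient:
  assumes "z \<in> {2..3}"
  shows "curv_forcing z / curv_exponent z = curv0 z"
proof -
  have e: "curv_exponent z = (2 * z - 3) / (z - 1)" using assms by (simp add: curv_exponent_def field_simps)
  have f: "curv_forcing z = - (z - 1) / (2 * z\<^sup>2)" using assms
    by (simp add: curv_forcing_def field_simps power2_eq_square)
  show ?thesis unfolding e f curv0_def using assms
    by (simp add: divide_simps) (simp add: power2_eq_square algebra_simps)
qed

lemma curv_forcing_bound:
  assumes "z \<in> {2..3}" shows "\<bar>curv_forcing z\<bar> \<le> 1"
proof -
  have "0 \<le> 1 / z" "1 / z \<le> 1" using assms by auto
  then have "\<bar>- (1 - 1 / z)\<bar> \<le> 1" by linarith
  then have "\<bar>- (1 - 1 / z)\<bar> / \<bar>2 * z\<bar> \<le> 1 / 1" using assms by (intro frac_le) auto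
  then show ?thesis by (simp only: curv_forcing_def abs_divide)
qed

lemma curv0_bounds: "z \<in> {2..3} \<Longrightarrow> - 1 \<le> curv0 z \<and> curv0 z \<le> - 1 / 54"
proof -
  assume z: "z \<in> {2..3}"
  have d: "2 * 2 * 2 * 1 \<le> 2 * z * z * (2 * z - 3)" using z by (intro mult_mono) auto
  have d': "2 * z * z * (2 * z - 3) \<le> 2 * 3 * 3 * 3" using z by (intro mult_mono) auto
  have n: "1 * 1 \<le> (z - 1) * (z - 1)" using z by (intro mult_mono) auto
  have n': "(z - 1) * (z - 1) \<le> 2 * 2" using z by (intro mult_mono) auto
  have "(z - 1) * (z - 1) / (2 * z * z * (2 * z - 3)) \<le> 8 / 8" using d n n' by (intro frac_le) auto
  moreover have "1 / 54 \<le> (z - 1) * (z - 1) / (2 * z * z * (2 * z - 3))" using d d' n by (intro frac_le) auto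
  ultimately show ?thesis by (simp add: curv0_def power2_eq_square)
qed

lemma slope_rem_holomorphic:
  assumes "g holomorphic_on S" "v holomorphic_on S"
    and "z \<noteq> 0" "\<And>t. t \<in> S \<Longrightarrow> g t \<noteq> 0" "\<And>t. t \<in> S \<Longrightarrow> 2 + t * g t \<noteq> 0" "\<And>t. t \<in> S \<Longrightarrow> z + t \<noteq> 0"
  shows "(\<lambda>t. slope_rem t (g t) (v t) z) holomorphic_on S"
  unfolding slope_rem_def by (intro holomorphic_intros assms(1,2)) (simp_all add: assms(3-6))

lemma curv_rem_holomorphic:
  assumes "g holomorphic_on S" "u holomorphic_on S" "v holomorphic_on S"
    and "z \<noteq> 0" "z - 1 \<noteq> 0" "\<And>t. t \<in> S \<Longrightarrow> g t \<noteq> 0" "\<And>t. t \<in> S \<Longrightarrow> 2 + t * g t \<noteq> 0" "\<And>t. t \<in> S \<Longrightarrow> z + t \<noteq> 0"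
  shows "(\<lambda>t. curv_rem t (g t) (u t) (v t) z) holomorphic_on S"
proof -
  have z1: "z \<noteq> 1" using assms(5) by auto
  show ?thesis
    unfolding curv_rem_def by (intro holomorphic_intros assms(1-3)) (simp_all add: z1 assms(4,6-8))
qed

text \<open>
  At \<open>t = 0\<close> the equation for \<open>u\<close> reads \<open>2 u = slope_rem\<close>, which gives the quadratic coefficient of \<open>x\<close>.
\<close>

lemma slope_rem_at_0:
  assumes "2 \<le> z" "z \<le> 3"
  shows "slope_rem 0 (1 - 1 / z) (curv0 z) z = 2 * bend0 z"
proof -
  have nz: "z \<noteq> 0" "z - 1 \<noteq> 0" "2 * z - 3 \<noteq> 0" using assms by auto
  have g: "1 - 1 / z = (z - 1) / z" using nz by (simp add: field_simps)
  have "curv0 z / (1 - 1 / z) = - (z - 1) / (2 * z * (2 * z - 3))"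
    unfolding g curv0_def using nz by (simp add: divide_simps) (simp add: power2_eq_square algebra_simps)
  then have "2 * z * (curv0 z / (1 - 1 / z)) = - (z - 1) / (2 * z - 3)"
    using nz by simp
  moreover have "z * (1 - 1 / z) = z - 1" using nz by (simp add: field_simps)
  ultimately have "slope_rem 0 (1 - 1 / z) (curv0 z) z = (2 - (z - 1) - - (z - 1) / (2 * z - 3)) / (2 * z\<^sup>2)"
    by (simp add: slope_rem_def power2_eq_square mult_ac)
  also have "\<dots> = 2 * bend0 z"
    unfolding bend0_def using nz by (simp add: divide_simps) (simp add: power2_eq_square algebra_simps)
  finally show ?thesis .
qed

lemma inverse_lipschitz:
  fixes a b :: real assumes "a \<ge> 1" "b \<ge> 1" shows "\<bar>1 / a - 1 / b\<bar> \<le> \<bar>a - b\<bar>"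
proof -
  have "1 / a - 1 / b = (b - a) / (a * b)" using assms by (simp add: field_simps)
  moreover have "\<bar>(b - a) / (a * b)\<bar> \<le> \<bar>b - a\<bar> / 1"
    unfolding abs_divide using assms mult_mono[of 1 a 1 b] by (intro divide_left_mono) (auto simp: abs_mult)
  ultimately show ?thesis by (simp add: abs_minus_commute)
qed

lemma euler_difference_quotient:
  assumes f: "f holomorphic_on ball 0 r" "g holomorphic_on ball 0 r" and t: "t \<in> ball 0 r" and \<theta>: "\<theta> \<in> {0<..1}"
  defines "w \<equiv> of_real \<theta> * t"
  shows "((\<lambda>\<theta>. f (of_real \<theta> * t) - g (of_real \<theta> * t)) has_vector_derivative t * deriv f w - t * deriv g w) (at \<theta>)"
    and "\<theta> *\<^sub>R (t * deriv f w - t * deriv g w) + k *\<^sub>R (f w - g w)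
        = (w * deriv f w + of_real k * f w) - (w * deriv g w + of_real k * g w)"
proof -
  show "((\<lambda>\<theta>. f (of_real \<theta> * t) - g (of_real \<theta> * t)) has_vector_derivative t * deriv f w - t * deriv g w) (at \<theta>)"
    unfolding w_def
    by (intro has_vector_derivative_diff euler_ray_derivative(1)[OF f(1) t \<theta>] euler_ray_derivative(1)[OF f(2) t \<theta>])
  show "\<theta> *\<^sub>R (t * deriv f w - t * deriv g w) + k *\<^sub>R (f w - g w)
        = (w * deriv f w + of_real k * f w) - (w * deriv g w + of_real k * g w)"
    by (simp add: w_def scaleR_conv_of_real algebra_simps)
qed

lemma dist_quad_le:
  fixes a b c d a' b' c' d' :: complex
  shows "dist (a, b, c, d) (a', b', c', d') \<le> dist a a' + (dist b b' + (dist c c' + dist d d'))"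
  using dist_Pair_le[of a "(b, c, d)" a' "(b', c', d')"] dist_Pair_le[of b "(c, d)" b' "(c', d')"]
    dist_Pair_le[of c d c' d'] by linarith

lemma dist_quint_le:
  fixes a b c d e a' b' c' d' e' :: complex
  shows "dist (a, b, c, d, e) (a', b', c', d', e') \<le> dist a a' + (dist b b' + (dist c c' + (dist d d' + dist e e')))"
  using dist_Pair_le[of a "(b, c, d, e)" a' "(b', c', d', e')"] dist_quad_le[of b c d e b' c' d' e'] by linarith

text \<open>
  The domain on which the iteration for the germ lives. The parameter \<open>z\<close> is one of the variables, so that
  the Lipschitz constant also covers the dependence on \<open>z\<close>. The slope \<open>g\<close> starts between
  \<open>1/2\<close> and \<open>2/3\<close> and moves by at most \<open>1/4\<close>.
\<close>

definition slope_dom :: "(complex \<times> complex \<times> complex \<times> complex) set" where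
  "slope_dom = {(t, g, v, z). norm t \<le> 1 / 8 \<and> 1 / 4 \<le> norm g \<and> norm g \<le> 1 \<and> norm v \<le> 2 \<and> (\<exists>x\<in>{2..3}. z = of_real x)}"

definition curv_dom :: "real \<Rightarrow> (complex \<times> complex \<times> complex \<times> complex \<times> complex) set" where
  "curv_dom K = {(t, g, u, v, z). (t, g, v, z) \<in> slope_dom \<and> norm u \<le> K}"

lemma slope_dom_bounds:
  assumes "(t, g, v, z) \<in> slope_dom"
  shows "norm (2 + t * g) \<ge> 1" "norm (z + t) \<ge> 1" "norm z \<ge> 1" "norm (z - 1) \<ge> 1" "norm g \<ge> 1 / 4" "norm z \<le> 3"
    "norm t \<le> 1" "norm g \<le> 1" "norm v \<le> 2"
proof -
  obtain x where x: "x \<in> {2..3}" "z = of_real x" and b: "norm t \<le> 1 / 8" "1 / 4 \<le> norm g" "norm g \<le> 1" "norm v \<le> 2"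
    using assms by (auto simp: slope_dom_def)
  have "norm t * norm g \<le> (1 / 8) * 1" using b by (intro mult_mono) auto
  then show "norm (2 + t * g) \<ge> 1" using norm_diff_ineq[of 2 "t * g"] by (simp add: norm_mult)
  have z: "norm z = x" using x by simp
  show "norm (z + t) \<ge> 1" using norm_diff_ineq[of z t] b z x by auto
  have "z - 1 = of_real (x - 1)" using x by simp
  then have "norm (z - 1) = \<bar>x - 1\<bar>" by (simp only: norm_of_real)
  then show "norm (z - 1) \<ge> 1" using x by auto
qed (use assms in \<open>auto simp: slope_dom_def\<close>)

lemma curv_dom_bounded: "bounded (curv_dom K)"
proof (rule boundedI)
  fix p assume p: "p \<in> curv_dom K"
  obtain t g u v z where e: "p = (t, g, u, v, z)" by (cases p)
  have m: "(t, g, v, z) \<in> slope_dom" "norm u \<le> K" using p e by (auto simp: curv_dom_def)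
  have "norm p \<le> norm t + (norm g + (norm u + (norm v + norm z)))"
    using dist_quint_le[of t g u v z 0 0 0 0 0] by (simp add: e dist_norm flip: zero_prod_def)
  then show "norm p \<le> 1 + (1 + (K + (2 + 3)))" using slope_dom_bounds[OF m(1)] m(2) by linarith
qed

lemma slope_dom_bounded: "bounded slope_dom"
proof (rule boundedI)
  fix p assume p: "p \<in> slope_dom"
  obtain t g v z where e: "p = (t, g, v, z)" by (cases p)
  have "norm p \<le> norm t + (norm g + (norm v + norm z))"
    using dist_quad_le[of t g v z 0 0 0 0] by (simp add: e dist_norm flip: zero_prod_def)
  then show "norm p \<le> 1 + (1 + (2 + 3))" using slope_dom_bounds p e by fastforce
qed

lemma bounded_lipschitz_slope_rem:
  "bounded_lipschitz slope_dom (\<lambda>p. slope_rem (fst p) (fst (snd p)) (fst (snd (snd p))) (snd (snd (snd p))))"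
proof -
  have id: "bounded_lipschitz slope_dom (\<lambda>p. p)" by (rule bounded_lipschitz_id[OF slope_dom_bounded])
  have c: "bounded_lipschitz slope_dom (\<lambda>p. fst p)" "bounded_lipschitz slope_dom (\<lambda>p. fst (snd p))"
    "bounded_lipschitz slope_dom (\<lambda>p. fst (snd (snd p)))" "bounded_lipschitz slope_dom (\<lambda>p. snd (snd (snd p)))"
    by (intro bounded_lipschitz_fst_snd id)+
  have l1: "\<exists>m>0. \<forall>p\<in>slope_dom. m \<le> norm (fst (snd p))"
    by (rule exI[of _ "1 / 4"]) (auto dest: slope_dom_bounds)
  have l2: "\<exists>m>0. \<forall>p\<in>slope_dom. m \<le> norm (snd (snd (snd p)) * (2 + fst p * fst (snd p)) * (snd (snd (snd p)) + fst p))"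
  proof (intro exI[of _ 1] conjI ballI)
    fix p assume "p \<in> slope_dom"
    moreover obtain t g v z where "p = (t, g, v, z)" by (cases p)
    ultimately have b: "1 \<le> norm z" "1 \<le> norm (2 + t * g)" "1 \<le> norm (z + t)" and p: "p = (t, g, v, z)"
      using slope_dom_bounds by auto
    have "1 * 1 * 1 \<le> norm z * norm (2 + t * g) * norm (z + t)" using b by (intro mult_mono) auto
    then show "1 \<le> norm (snd (snd (snd p)) * (2 + fst p * fst (snd p)) * (snd (snd (snd p)) + fst p))"
      by (simp add: p norm_mult)
  qed simp
  show ?thesis unfolding slope_rem_def by (intro bl_intros c l1 l2)
qed

lemma bounded_lipschitz_curv_rem:
  "bounded_lipschitz (curv_dom K) (\<lambda>p. curv_rem (fst p) (fst (snd p)) (fst (snd (snd p))) (fst (snd (snd (snd p)))) (snd (snd (snd (snd p)))))"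
proof -
  let ?S = "curv_dom K"
  have id: "bounded_lipschitz ?S (\<lambda>p. p)" by (rule bounded_lipschitz_id[OF curv_dom_bounded])
  have c: "bounded_lipschitz ?S (\<lambda>p. fst p)" "bounded_lipschitz ?S (\<lambda>p. fst (snd p))"
    "bounded_lipschitz ?S (\<lambda>p. fst (snd (snd p)))" "bounded_lipschitz ?S (\<lambda>p. fst (snd (snd (snd p))))"
    "bounded_lipschitz ?S (\<lambda>p. snd (snd (snd (snd p))))"
    by (intro bounded_lipschitz_fst_snd id)+
  have b: "1 \<le> norm z" "1 \<le> norm (2 + t * g)" "1 \<le> norm (z + t)" "1 / 4 \<le> norm g" "1 \<le> norm (z - 1)"
    if "(t, g, u, v, z) \<in> ?S" for t g u v z
    using that slope_dom_bounds[of t g v z] by (auto simp: curv_dom_def)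
  have l1: "\<exists>m>0. \<forall>p\<in>?S. m \<le> norm (2 * snd (snd (snd (snd p))))"
    by (rule exI[of _ 1]) (auto dest!: b(1) simp: norm_mult)
  have l2: "\<exists>m>0. \<forall>p\<in>?S. m \<le> norm (fst (snd p) * (snd (snd (snd (snd p))) - 1))"
  proof (intro exI[of _ "1 / 4"] conjI ballI)
    fix p assume "p \<in> ?S"
    moreover obtain t g u v z where p: "p = (t, g, u, v, z)" by (cases p)
    ultimately have "1 / 4 * 1 \<le> norm g * norm (z - 1)" using b[of t g u v z] by (intro mult_mono) auto
    then show "1 / 4 \<le> norm (fst (snd p) * (snd (snd (snd (snd p))) - 1))" by (simp add: p norm_mult)
  qed simp
  have l3: "\<exists>m>0. \<forall>p\<in>?S. m \<le> norm (2 * fst (snd p) * snd (snd (snd (snd p))) * (2 + fst p * fst (snd p)) * (snd (snd (snd (snd p))) + fst p))"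
  proof (intro exI[of _ "1 / 4"] conjI ballI)
    fix p assume "p \<in> ?S"
    moreover obtain t g u v z where p: "p = (t, g, u, v, z)" by (cases p)
    ultimately have "2 * (1 / 4) * 1 * 1 * 1 \<le> 2 * norm g * norm z * norm (2 + t * g) * norm (z + t)"
      using b[of t g u v z] by (intro mult_mono) auto
    then show "1 / 4 \<le> norm (2 * fst (snd p) * snd (snd (snd (snd p))) * (2 + fst p * fst (snd p)) * (snd (snd (snd (snd p))) + fst p))"
      by (simp add: p norm_mult)
  qed simp
  show ?thesis unfolding curv_rem_def by (intro bl_intros c l1 l2 l3)
qed

text \<open>
  The constants of the contraction argument, chosen once for all \<open>z\<close> in \<open>[2,3]\<close>: \<open>A\<close> and \<open>B\<close> for the two
  remainders, \<open>C\<close> for the hypotheses of the Briot-Bouquet theorem, and \<open>r\<close> for the radius of the disc.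
\<close>

locale sonic_constants =
  fixes A B C r :: real
  assumes A: "A \<ge> 1" and B: "B \<ge> 1" and C: "C \<ge> 1" "A \<le> C" "2 * B \<le> C"
    and r: "r > 0" "16 * C\<^sup>2 * r \<le> 1" "r \<le> 1 / 8" "r * A \<le> 1 / 4"
    and slope_bound: "\<And>t g v z. (t, g, v, z) \<in> slope_dom \<Longrightarrow> norm (slope_rem t g v z) \<le> A"
    and slope_lip: "\<And>t g v z t' g' v' z'. (t, g, v, z) \<in> slope_dom \<Longrightarrow> (t', g', v', z') \<in> slope_dom \<Longrightarrow>
      norm (slope_rem t g v z - slope_rem t' g' v' z') \<le> A * (dist t t' + (dist g g' + (dist v v' + dist z z')))"
    and curv_bound: "\<And>t g u v z. (t, g, u, v, z) \<in> curv_dom A \<Longrightarrow> norm (curv_rem t g u v z) \<le> B"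
    and curv_lip: "\<And>t g u v z t' g' u' v' z'. (t, g, u, v, z) \<in> curv_dom A \<Longrightarrow> (t', g', u', v', z') \<in> curv_dom A \<Longrightarrow>
      norm (curv_rem t g u v z - curv_rem t' g' u' v' z')
      \<le> B * (dist t t' + (dist g g' + (dist u u' + (dist v v' + dist z z'))))"
begin

text \<open>
  \<open>U\<close> and \<open>V\<close> are the functions \<open>u\<close> and \<open>v\<close> of the ansatz, as holomorphic functions of \<open>t = y - z\<close>.
\<close>

definition sonic_remainders :: "real \<Rightarrow> (complex \<Rightarrow> complex) \<Rightarrow> (complex \<Rightarrow> complex) \<Rightarrow> bool" where
  "sonic_remainders z U V \<longleftrightarrow> z \<in> {2..3} \<and> U holomorphic_on ball 0 r \<and> V holomorphic_on ball 0 r \<and> (\<forall>t\<in>ball 0 r.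
      norm (U t) \<le> A \<and> norm (V t - of_real (curv0 z)) \<le> C * norm t \<and> norm (V t - of_real (curv0 z)) \<le> 1 \<and>
      t * deriv U t + of_real 2 * U t = slope_rem t (slope_at z t (U t)) (V t) (of_real z) \<and>
      t * deriv V t + of_real (curv_exponent z) * V t
        = of_real (curv_forcing z) + t * curv_rem t (slope_at z t (U t)) (U t) (V t) (of_real z) \<and>
      (t \<in> \<real> \<longrightarrow> U t \<in> \<real> \<and> V t \<in> \<real>))"

lemma sonic_remaindersD:
  assumes "sonic_remainders z U V"
  shows "z \<in> {2..3}" "U holomorphic_on ball 0 r" "V holomorphic_on ball 0 r"
    and "t \<in> ball 0 r \<Longrightarrow> norm (U t) \<le> A"
    and "t \<in> ball 0 r \<Longrightarrow> norm (V t - of_real (curv0 z)) \<le> C * norm t"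
    and "t \<in> ball 0 r \<Longrightarrow> norm (V t - of_real (curv0 z)) \<le> 1"
    and "t \<in> ball 0 r \<Longrightarrow> t * deriv U t + of_real 2 * U t = slope_rem t (slope_at z t (U t)) (V t) (of_real z)"
    and "t \<in> ball 0 r \<Longrightarrow> t * deriv V t + of_real (curv_exponent z) * V t
        = of_real (curv_forcing z) + t * curv_rem t (slope_at z t (U t)) (U t) (V t) (of_real z)"
    and "t \<in> ball 0 r \<Longrightarrow> t \<in> \<real> \<Longrightarrow> U t \<in> \<real> \<and> V t \<in> \<real>"
  using assms unfolding sonic_remainders_def by blast+

lemma ansatz_in_dom:
  assumes z: "z \<in> {2..3}" and t: "t \<in> ball 0 r" and u: "norm u \<le> A" and v: "norm (v - of_real (curv0 z)) \<le> 1"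
  shows "(t, slope_at z t u, v, of_real z) \<in> slope_dom" "(t, slope_at z t u, u, v, of_real z) \<in> curv_dom A"
proof -
  have "norm t * norm u \<le> r * A" using t u A r by (intro mult_mono) auto
  then have tu: "norm (t * u) \<le> 1 / 4" using r by (simp add: norm_mult)
  have "1 / 4 \<le> norm (slope_at z t u)" "norm (slope_at z t u) \<le> 1"
    using norm_diff_ineq[of "of_real (slope0 z)" "t * u"] norm_triangle_ineq[of "of_real (slope0 z)" "t * u"] tu
      slope0_bounds[OF z] by auto
  moreover have "norm v \<le> 2"
    using norm_triangle_ineq[of "v - of_real (curv0 z)" "of_real (curv0 z)"] v curv0_bounds[OF z] by simp
  ultimately show "(t, slope_at z t u, v, of_real z) \<in> slope_dom" using t r z by (auto simp: slope_dom_def)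
  then show "(t, slope_at z t u, u, v, of_real z) \<in> curv_dom A" using u by (simp add: curv_dom_def)
qed

lemma sonic_remainders_dom:
  assumes g: "sonic_remainders z U V" and t: "t \<in> ball 0 r"
  shows "(t, slope_at z t (U t), V t, of_real z) \<in> slope_dom" "(t, slope_at z t (U t), U t, V t, of_real z) \<in> curv_dom A"
  using ansatz_in_dom[OF sonic_remaindersD(1)[OF g] t] sonic_remaindersD(4,6)[OF g t] by auto

text \<open>
  The bound \<open>2 B \<le> C\<close> is needed because \<open>u\<close> enters \<open>curv_rem\<close> twice, directly and through the slope.
\<close>

lemma sonic_remainders_exist:
  assumes z: "z \<in> {2..3}"
  shows "\<exists>U V. sonic_remainders z U V"
proof -
  let ?B = "ball (0::complex) r"
  define G1 G2 where "G1 t u v = slope_rem t (slope_at z t u) v (of_real z)"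
    and "G2 t u v = of_real (curv_forcing z) + t * curv_rem t (slope_at z t u) u v (of_real z)" for t u v
  show ?thesis
  proof (rule triangular_briot_bouquet[of C A r 2 "curv_exponent z" "curv_forcing z" G1 G2,
        OF C(1) A r(1,2) _ curv_exponent_ge_1[OF z], unfolded curv0_quotient[OF z]])
    fix U V assume "U holomorphic_on ?B" "V holomorphic_on ?B" "\<And>t. t \<in> ?B \<Longrightarrow> norm (U t) \<le> A"
      "\<And>t. t \<in> ?B \<Longrightarrow> norm (V t - of_real (curv0 z)) \<le> C * norm t"
      "\<And>t. t \<in> ?B \<Longrightarrow> norm (V t - of_real (curv0 z)) \<le> 1"
      "\<And>t. t \<in> ?B \<Longrightarrow> t * deriv U t + of_real 2 * U t = G1 t (U t) (V t)"
      "\<And>t. t \<in> ?B \<Longrightarrow> t * deriv V t + of_real (curv_exponent z) * V t = G2 t (U t) (V t)"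
      "\<And>t. t \<in> ?B \<Longrightarrow> t \<in> \<real> \<Longrightarrow> U t \<in> \<real> \<and> V t \<in> \<real>"
    with z have "sonic_remainders z U V" unfolding sonic_remainders_def G1_def G2_def by blast
    then show ?thesis by blast
  next
    fix u v assume hol: "u holomorphic_on ?B" "v holomorphic_on ?B"
      and bd: "\<And>t. t \<in> ?B \<Longrightarrow> norm (u t) \<le> A \<and> norm (v t - of_real (curv0 z)) \<le> 1"
    have nz: "of_real z \<noteq> (0::complex)" "of_real z - 1 \<noteq> (0::complex)"
      "2 + t * slope_at z t (u t) \<noteq> 0" "of_real z + t \<noteq> (0::complex)" "slope_at z t (u t) \<noteq> 0" if t: "t \<in> ?B" for t
      using slope_dom_bounds[OF ansatz_in_dom(1)[OF z t conjunct1[OF bd[OF t]] conjunct2[OF bd[OF t]]]] by auto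
    have z0: "(0::complex) \<in> ?B" using r by simp
    show "(\<lambda>t. G1 t (u t) (v t)) holomorphic_on ?B \<and> (\<lambda>t. G2 t (u t) (v t)) holomorphic_on ?B"
      unfolding G1_def G2_def
      by (intro conjI holomorphic_intros slope_rem_holomorphic curv_rem_holomorphic hol)
          (rule nz(1,2)[OF z0] | erule nz(3-5))+
  next
    fix t u v :: complex assume t: "t \<in> ?B" and u: "norm u \<le> A" and v: "norm (v - of_real (curv0 z)) \<le> 1"
    note d = ansatz_in_dom[OF z t u v]
    show "norm (G1 t u v) \<le> A" unfolding G1_def by (rule slope_bound[OF d(1)])
    have "norm t * norm (curv_rem t (slope_at z t u) u v (of_real z)) \<le> norm t * C"
      using curv_bound[OF d(2)] C B by (intro mult_left_mono) auto
    then show "norm (G2 t u v - of_real (curv_forcing z)) \<le> C * norm t" by (simp add: G2_def norm_mult mult.commute)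
  next
    fix t u v u' v' :: complex assume t: "t \<in> ?B" and u: "norm u \<le> A" and v: "norm (v - of_real (curv0 z)) \<le> 1"
      and u': "norm u' \<le> A" and v': "norm (v' - of_real (curv0 z)) \<le> 1"
    note d = ansatz_in_dom[OF z t u v] and d' = ansatz_in_dom[OF z t u' v']
    have "norm (G1 t u v - G1 t u' v') \<le> A * (norm t * norm (u - u') + norm (v - v'))"
      using slope_lip[OF d(1) d'(1)] by (simp add: G1_def dist_mult_left dist_norm[of v])
    also have "\<dots> \<le> C * (norm t * norm (u - u') + norm (v - v'))" using C by (intro mult_right_mono) auto
    finally show "norm (G1 t u v - G1 t u' v') \<le> C * (norm t * norm (u - u') + norm (v - v'))" .
    have "norm t * norm (u - u') \<le> 1 * norm (u - u')" using t r by (intro mult_right_mono) auto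
    then have t2: "norm t * norm (u - u') + (norm (u - u') + norm (v - v')) \<le> 2 * (norm (u - u') + norm (v - v'))"
      using norm_ge_zero[of "v - v'"] by argo
    have "norm (G2 t u v - G2 t u' v')
        = norm t * norm (curv_rem t (slope_at z t u) u v (of_real z) - curv_rem t (slope_at z t u') u' v' (of_real z))"
      unfolding G2_def norm_mult[symmetric] by (simp only: add_diff_cancel_left right_diff_distrib)
    also have "\<dots> \<le> norm t * (B * (norm t * norm (u - u') + (norm (u - u') + norm (v - v'))))"
      using curv_lip[OF d(2) d'(2)] by (intro mult_left_mono) (simp_all add: dist_mult_left dist_norm[of v] dist_norm[of u])
    also have "\<dots> \<le> norm t * (B * (2 * (norm (u - u') + norm (v - v'))))"
      using t2 B by (intro mult_left_mono) auto
    also have "\<dots> = (2 * B) * norm t * (norm (u - u') + norm (v - v'))" by simp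
    also have "\<dots> \<le> C * norm t * (norm (u - u') + norm (v - v'))" using C by (intro mult_right_mono) auto
    finally show "norm (G2 t u v - G2 t u' v') \<le> C * norm t * (norm (u - u') + norm (v - v'))" .
  next
    fix t u v :: complex assume "t \<in> \<real>" "u \<in> \<real>" "v \<in> \<real>"
    then show "G1 t u v \<in> \<real> \<and> G2 t u v \<in> \<real>"
      unfolding G1_def G2_def slope_rem_def curv_rem_def by auto
  qed simp_all
qed

text \<open>
  \<open>U - bend0 z\<close> solves the Euler equation with a right-hand side that vanishes at \<open>t = 0\<close>.
\<close>

lemma sonic_remainders_bend:
  assumes g: "sonic_remainders z U V" and t: "t \<in> ball 0 r"
  shows "norm (U t - of_real (bend0 z)) \<le> A * (1 + A + C) * norm t"
proof -
  note D = sonic_remaindersD[OF g]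
  have "norm ((\<lambda>t. U t - of_real (bend0 z)) t) \<le> (A * (1 + A + C) * norm t) / 2"
  proof (rule euler_holomorphic_bound[OF _ _ t])
    show "(\<lambda>t. U t - of_real (bend0 z)) holomorphic_on ball 0 r" by (intro holomorphic_intros D)
    fix s :: complex assume s: "s \<in> ball 0 r" "norm s \<le> norm t"
    have "((\<lambda>t. U t - of_real (bend0 z)) has_field_derivative deriv U s) (at s)"
      using holomorphic_derivI[OF D(2) open_ball s(1), of UNIV] by (auto intro!: derivative_eq_intros)
    then have ds: "deriv (\<lambda>t. U t - of_real (bend0 z)) s = deriv U s" by (rule DERIV_imp_deriv)
    have "(0::complex) \<in> ball 0 r" using r by simp
    have d0: "(0, of_real (slope0 z), of_real (curv0 z), of_real z) \<in> slope_dom"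
      using ansatz_in_dom(1)[OF D(1) \<open>0 \<in> ball 0 r\<close>, of 0 "of_real (curv0 z)"] A by simp
    have "complex_of_real (slope_rem 0 (slope0 z) (curv0 z) z) = of_real (2 * bend0 z)"
      using slope_rem_at_0[of z] D(1) by (simp add: slope0_def)
    then have b0: "slope_rem 0 (of_real (slope0 z)) (of_real (curv0 z)) (of_real z) = complex_of_real 2 * of_real (bend0 z)"
      by (simp add: slope_rem_def)
    have "s * deriv (\<lambda>t. U t - of_real (bend0 z)) s + of_real 2 * (U s - of_real (bend0 z))
        = slope_rem s (slope_at z s (U s)) (V s) (of_real z) - slope_rem 0 (of_real (slope0 z)) (of_real (curv0 z)) (of_real z)"
      unfolding ds b0 D(7)[OF s(1), symmetric] by (simp add: algebra_simps)
    also have "norm \<dots> \<le> A * (dist s 0 + (dist (slope_at z s (U s)) (of_real (slope0 z))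
        + (dist (V s) (of_real (curv0 z)) + dist (complex_of_real z) (of_real z))))"
      by (rule slope_lip[OF sonic_remainders_dom(1)[OF g s(1)] d0])
    also have "\<dots> \<le> A * (norm t + (norm t * A + (C * norm t + 0)))"
    proof (intro mult_left_mono add_mono)
      show "dist s 0 \<le> norm t" using s by simp
      show "dist (slope_at z s (U s)) (of_real (slope0 z)) \<le> norm t * A"
        using s D(4)[OF s(1)] by (auto simp: dist_norm norm_mult intro!: mult_mono)
      have "C * norm s \<le> C * norm t" using s C by (intro mult_left_mono) auto
      then show "dist (V s) (of_real (curv0 z)) \<le> C * norm t" using D(5)[OF s(1)] by (simp add: dist_norm)
    qed (use A in auto)
    finally show "norm (s * deriv (\<lambda>t. U t - of_real (bend0 z)) s + of_real 2 * (U s - of_real (bend0 z)))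
        \<le> A * (1 + A + C) * norm t" by (simp add: algebra_simps)
  qed simp
  moreover have "0 \<le> A * (1 + A + C) * norm t" using A C by (intro mult_nonneg_nonneg) auto
  ultimately show ?thesis by linarith
qed

text \<open>
  The constant of \<open>euler_system_stability\<close> for the perturbation \<open>z - z'\<close>: a change of \<open>z\<close> acts on the right-hand
  sides, on the forcing and on the exponent, with total weight at most \<open>3 + 2 A + 2 B\<close>.
\<close>

definition Q where "Q = 2 * (1 + 4 * C) * (3 + 2 * A + 2 * B)"

lemma Q: "Q \<ge> 0" using A B C by (simp add: Q_def)

text \<open>
  The differences \<open>U - U'\<close> and \<open>V - V'\<close> at equal \<open>t\<close> solve a system to which \<open>euler_system_stability\<close>
  applies. The exponent of the second equation depends on \<open>z\<close> too; the exponent of \<open>z\<close> is used for both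
  solutions and the discrepancy, times the bounded \<open>V'\<close>, is counted as forcing.
\<close>

lemma sonic_remainders_lipschitz:
  assumes g: "sonic_remainders z U V" and g': "sonic_remainders z' U' V'" and t: "t \<in> ball 0 r"
  shows "norm (U t - U' t) \<le> Q * \<bar>z - z'\<bar>" "norm (V t - V' t) \<le> Q * \<bar>z - z'\<bar>"
proof -
  note D = sonic_remaindersD[OF g] and D' = sonic_remaindersD[OF g']
  note z = D(1) and z' = D'(1)
  let ?d = "\<bar>z - z'\<bar>" and ?E = "3 + 2 * A + 2 * B"
  have inv: "\<bar>1 / z - 1 / z'\<bar> \<le> ?d" "\<bar>1 / (z - 1) - 1 / (z' - 1)\<bar> \<le> ?d"
    using z z' inverse_lipschitz[of z z'] inverse_lipschitz[of "z - 1" "z' - 1"] by auto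
  have dg: "\<bar>slope0 z - slope0 z'\<bar> \<le> ?d" using inv by (simp add: slope0_def abs_minus_commute)
  have dk: "\<bar>curv_exponent z - curv_exponent z'\<bar> \<le> ?d" using inv by (simp add: curv_exponent_def abs_minus_commute)
  have dc: "\<bar>curv_forcing z - curv_forcing z'\<bar> \<le> ?d"
  proof -
    have "curv_forcing z - curv_forcing z' = - (1 / z - 1 / z') / 2 + (1 / z - 1 / z') * (1 / z + 1 / z') / 2"
      using z z' by (simp add: curv_forcing_def field_simps)
    also have "\<bar>\<dots>\<bar> \<le> \<bar>1 / z - 1 / z'\<bar> / 2 + \<bar>1 / z - 1 / z'\<bar> * 1 / 2"
    proof (rule abs_triangle_ineq[THEN order_trans], intro add_mono)
      have "1 / z \<le> 1 / 2" "1 / z' \<le> 1 / 2" "0 \<le> 1 / z" "0 \<le> 1 / z'" using z z' by (auto simp: field_simps)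
      then have "\<bar>1 / z + 1 / z'\<bar> \<le> 1" by linarith
      then show "\<bar>(1 / z - 1 / z') * (1 / z + 1 / z') / 2\<bar> \<le> \<bar>1 / z - 1 / z'\<bar> * 1 / 2"
        using mult_left_mono[OF _ abs_ge_zero[of "1 / z - 1 / z'"], of "\<bar>1 / z + 1 / z'\<bar>" 1]
        by (simp add: abs_mult)
    qed simp
    finally show ?thesis using inv by simp
  qed
  let ?w = "\<lambda>\<theta>. complex_of_real \<theta> * t"
  let ?p = "\<lambda>\<theta>. U (?w \<theta>) - U' (?w \<theta>)" and ?q = "\<lambda>\<theta>. V (?w \<theta>) - V' (?w \<theta>)"
  have gw: "dist (slope_at z w (U w)) (slope_at z' w (U' w)) \<le> ?d + r * norm (U w - U' w)" if w: "w \<in> ball 0 r" for w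
  proof -
    have "slope_at z w (U w) - slope_at z' w (U' w) = of_real (slope0 z - slope0 z') + w * (U w - U' w)"
      by (simp add: algebra_simps)
    also have "norm \<dots> \<le> norm (complex_of_real (slope0 z - slope0 z')) + norm (w * (U w - U' w))" by (rule norm_triangle_ineq)
    also have "\<dots> \<le> ?d + r * norm (U w - U' w)"
      using dg w unfolding norm_mult norm_of_real by (intro add_mono mult_right_mono) auto
    finally show ?thesis by (simp add: dist_norm)
  qed
  have dz: "dist (complex_of_real z) (of_real z') = ?d" by (simp add: dist_of_real dist_real_def)
  have "norm (?p 1) + 4 * C * norm (?q 1) \<le> 2 * (1 + 4 * C) * (?E * ?d)"
  proof (rule euler_system_stability[where p = ?p and q = ?q and T = 1 and r = r and ?k1.0 = 2
        and ?k2.0 = "curv_exponent z" and B = "2 * A + 4"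
        and p' = "\<lambda>\<theta>. t * deriv U (?w \<theta>) - t * deriv U' (?w \<theta>)"
        and q' = "\<lambda>\<theta>. t * deriv V (?w \<theta>) - t * deriv V' (?w \<theta>)",
        OF C(1) _ r(2) _ curv_exponent_ge_1[OF z] zero_less_one])
    fix \<theta> :: real assume \<theta>: "\<theta> \<in> {0<..1}"
    let ?W = "?w \<theta>"
    have w: "?W \<in> ball 0 r" using euler_ray_derivative(2)[OF D(2) t \<theta>] .
    show "(?p has_vector_derivative t * deriv U ?W - t * deriv U' ?W) (at \<theta>)"
      by (rule euler_difference_quotient(1)[OF D(2) D'(2) t \<theta>])
    show "(?q has_vector_derivative t * deriv V ?W - t * deriv V' ?W) (at \<theta>)"
      by (rule euler_difference_quotient(1)[OF D(3) D'(3) t \<theta>])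
    have "norm (\<theta> *\<^sub>R (t * deriv U ?W - t * deriv U' ?W) + 2 *\<^sub>R ?p \<theta>)
        = norm (slope_rem ?W (slope_at z ?W (U ?W)) (V ?W) (of_real z) - slope_rem ?W (slope_at z' ?W (U' ?W)) (V' ?W) (of_real z'))"
      unfolding euler_difference_quotient(2)[OF D(2) D'(2) t \<theta>] D(7)[OF w] D'(7)[OF w] ..
    also have "\<dots> \<le> A * (dist ?W ?W + (dist (slope_at z ?W (U ?W)) (slope_at z' ?W (U' ?W)) + (dist (V ?W) (V' ?W) + ?d)))"
      using slope_lip[OF sonic_remainders_dom(1)[OF g w] sonic_remainders_dom(1)[OF g' w]] unfolding dz .
    also have "\<dots> \<le> A * (0 + (?d + r * norm (?p \<theta>) + (norm (?q \<theta>) + ?d)))"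
      using A gw[OF w] by (intro mult_left_mono add_mono) (auto simp: dist_norm[of "V ?W"])
    also have "\<dots> = A * (r * norm (?p \<theta>) + norm (?q \<theta>)) + 2 * A * ?d" by (simp add: algebra_simps)
    also have "\<dots> \<le> C * (r * norm (?p \<theta>) + norm (?q \<theta>)) + ?E * ?d"
      using C r B by (intro add_mono mult_right_mono) auto
    finally show "norm (\<theta> *\<^sub>R (t * deriv U ?W - t * deriv U' ?W) + 2 *\<^sub>R ?p \<theta>)
        \<le> C * (r * norm (?p \<theta>) + norm (?q \<theta>)) + ?E * ?d" .
    let ?R = "curv_rem ?W (slope_at z ?W (U ?W)) (U ?W) (V ?W) (of_real z)"
      and ?R' = "curv_rem ?W (slope_at z' ?W (U' ?W)) (U' ?W) (V' ?W) (of_real z')"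
    have "norm (?R - ?R') \<le> B * (dist ?W ?W + (dist (slope_at z ?W (U ?W)) (slope_at z' ?W (U' ?W))
        + (dist (U ?W) (U' ?W) + (dist (V ?W) (V' ?W) + ?d))))"
      using curv_lip[OF sonic_remainders_dom(2)[OF g w] sonic_remainders_dom(2)[OF g' w]] unfolding dz .
    also have "\<dots> \<le> B * (0 + (?d + r * norm (?p \<theta>) + (norm (?p \<theta>) + (norm (?q \<theta>) + ?d))))"
      using B gw[OF w] by (intro mult_left_mono add_mono) (auto simp: dist_norm[of "V ?W"] dist_norm[of "U ?W"])
    also have "\<dots> \<le> B * (2 * (norm (?p \<theta>) + norm (?q \<theta>)) + 2 * ?d)"
    proof (rule mult_left_mono)
      have "r * norm (?p \<theta>) \<le> 1 * norm (?p \<theta>)" using r by (intro mult_right_mono) auto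
      then show "0 + (?d + r * norm (?p \<theta>) + (norm (?p \<theta>) + (norm (?q \<theta>) + ?d))) \<le> 2 * (norm (?p \<theta>) + norm (?q \<theta>)) + 2 * ?d"
        using norm_ge_zero[of "?q \<theta>"] by argo
    qed (use B in simp)
    finally have RR: "norm (?R - ?R') \<le> B * (2 * (norm (?p \<theta>) + norm (?q \<theta>)) + 2 * ?d)" .
    have "norm ?W * norm (?R - ?R') \<le> r * (B * (2 * (norm (?p \<theta>) + norm (?q \<theta>)) + 2 * ?d))"
      using w RR r by (intro mult_mono) auto
    also have "\<dots> = (2 * B) * (r * (norm (?p \<theta>) + norm (?q \<theta>))) + r * (2 * B * ?d)" by (simp add: algebra_simps)
    also have "\<dots> \<le> C * (r * (norm (?p \<theta>) + norm (?q \<theta>))) + 1 * (2 * B * ?d)"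
      using C r B by (intro add_mono mult_right_mono) auto
    finally have wRR: "norm ?W * norm (?R - ?R') \<le> C * r * (norm (?p \<theta>) + norm (?q \<theta>)) + 2 * B * ?d" by simp
    have V2: "norm (V ?W) \<le> 2" "norm (V' ?W) \<le> 2"
      using slope_dom_bounds(9) sonic_remainders_dom(1)[OF g w] sonic_remainders_dom(1)[OF g' w] by blast+
    have e2: "?W * deriv V' ?W + of_real (curv_exponent z) * V' ?W
        = of_real (curv_forcing z') + ?W * ?R' + of_real (curv_exponent z - curv_exponent z') * V' ?W"
      using D'(8)[OF w] by (simp add: algebra_simps)
    have "norm (\<theta> *\<^sub>R (t * deriv V ?W - t * deriv V' ?W) + curv_exponent z *\<^sub>R ?q \<theta>)
        = norm (of_real (curv_forcing z - curv_forcing z') + ?W * (?R - ?R') - of_real (curv_exponent z - curv_exponent z') * V' ?W)"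
      unfolding euler_difference_quotient(2)[OF D(3) D'(3) t \<theta>] D(8)[OF w] e2 by (simp add: algebra_simps)
    also have "\<dots> \<le> norm (complex_of_real (curv_forcing z - curv_forcing z')) + norm (?W * (?R - ?R'))
        + norm (complex_of_real (curv_exponent z - curv_exponent z') * V' ?W)"
      by (intro order_trans[OF norm_triangle_ineq4] add_mono norm_triangle_ineq order_refl)
    also have "\<dots> \<le> ?d + (C * r * (norm (?p \<theta>) + norm (?q \<theta>)) + 2 * B * ?d) + ?d * 2"
      using dc dk wRR V2 unfolding norm_mult norm_of_real by (intro add_mono mult_mono) auto
    also have "\<dots> \<le> C * r * (norm (?p \<theta>) + norm (?q \<theta>)) + ?E * ?d"
      using A by (simp add: algebra_simps)
    finally show "norm (\<theta> *\<^sub>R (t * deriv V ?W - t * deriv V' ?W) + curv_exponent z *\<^sub>R ?q \<theta>)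
        \<le> C * r * (norm (?p \<theta>) + norm (?q \<theta>)) + ?E * ?d" .
    show "norm (?q \<theta>) \<le> 2 * A + 4" using V2 norm_triangle_ineq4[of "V ?W" "V' ?W"] A by linarith
    show "norm (?p \<theta>) \<le> 2 * A + 4" using D(4)[OF w] D'(4)[OF w] norm_triangle_ineq4[of "U ?W" "U' ?W"] by linarith
  qed (use r A B in auto)
  then have m: "norm (U t - U' t) + 4 * C * norm (V t - V' t) \<le> Q * ?d" by (simp add: Q_def)
  have "1 * norm (V t - V' t) \<le> 4 * C * norm (V t - V' t)" using C by (intro mult_right_mono) auto
  then show "norm (U t - U' t) \<le> Q * ?d" "norm (V t - V' t) \<le> Q * ?d"
    using m norm_ge_zero[of "U t - U' t"] norm_ge_zero[of "V t - V' t"] by linarith+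
qed

definition sonic_x :: "real \<Rightarrow> (complex \<Rightarrow> complex) \<Rightarrow> complex \<Rightarrow> complex" where
  "sonic_x z U w = 1 + (w - of_real z) * slope_at z (w - of_real z) (U (w - of_real z))"

definition sonic_s :: "real \<Rightarrow> (complex \<Rightarrow> complex) \<Rightarrow> complex \<Rightarrow> complex" where
  "sonic_s z V w = 1 + (w - of_real z)\<^sup>2 * V (w - of_real z)"

lemma shift_in_ball: "w \<in> ball (of_real z) r \<Longrightarrow> w - of_real z \<in> ball (0::complex) r"
  by (auto simp: dist_norm norm_minus_commute)

lemma sonic_derivatives:
  assumes g: "sonic_remainders z U V" and w: "w \<in> ball (of_real z) r"
  defines "t \<equiv> w - of_real z"
  shows "(sonic_x z U has_field_derivative of_real (slope0 z) + t * slope_rem t (slope_at z t (U t)) (V t) (of_real z)) (at w)"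
    and "(sonic_s z V has_field_derivative t * (of_real (curv_forcing z)
         + t * curv_rem t (slope_at z t (U t)) (U t) (V t) (of_real z) + V t / (of_real z - 1))) (at w)"
proof -
  note D = sonic_remaindersD[OF g]
  have t: "t \<in> ball 0 r" unfolding t_def by (rule shift_in_ball[OF w])
  have shift: "((\<lambda>w. w - of_real z) has_field_derivative 1) (at w)" by (auto intro!: derivative_eq_intros)
  have du: "((\<lambda>w. U (w - of_real z)) has_field_derivative deriv U t) (at w)"
    using DERIV_chain2[where f = U and g = "\<lambda>w. w - of_real z" and x = w and s = UNIV,
        OF holomorphic_derivI[OF D(2) open_ball t, of UNIV, unfolded t_def] shift] by (simp add: t_def)
  have dv: "((\<lambda>w. V (w - of_real z)) has_field_derivative deriv V t) (at w)"
    using DERIV_chain2[where f = V and g = "\<lambda>w. w - of_real z" and x = w and s = UNIV,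
        OF holomorphic_derivI[OF D(3) open_ball t, of UNIV, unfolded t_def] shift] by (simp add: t_def)
  have "(sonic_x z U has_field_derivative of_real (slope0 z) + t * (t * deriv U t + of_real 2 * U t)) (at w)"
    unfolding sonic_x_def[abs_def] by (rule derivative_eq_intros du refl)+ (simp add: t_def algebra_simps)
  then show "(sonic_x z U has_field_derivative of_real (slope0 z) + t * slope_rem t (slope_at z t (U t)) (V t) (of_real z)) (at w)"
    unfolding D(7)[OF t] .
  have "complex_of_real (curv_exponent z) = 2 - 1 / (of_real z - 1)" by (simp add: curv_exponent_def)
  then have "t * deriv V t + 2 * V t = t * deriv V t + of_real (curv_exponent z) * V t + V t / (of_real z - 1)"
    by (simp only: left_diff_distrib) simp
  moreover have "(sonic_s z V has_field_derivative t * (t * deriv V t + 2 * V t)) (at w)"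
    unfolding sonic_s_def[abs_def] by (rule derivative_eq_intros dv refl)+ (simp add: t_def algebra_simps power2_eq_square)
  ultimately show "(sonic_s z V has_field_derivative t * (of_real (curv_forcing z)
         + t * curv_rem t (slope_at z t (U t)) (U t) (V t) (of_real z) + V t / (of_real z - 1))) (at w)"
    unfolding D(8)[OF t] by (simp only:)
qed

lemma sonic_holomorphic:
  assumes g: "sonic_remainders z U V"
  shows "sonic_x z U holomorphic_on ball (of_real z) r" "sonic_s z V holomorphic_on ball (of_real z) r"
  unfolding holomorphic_on_open[OF open_ball] using sonic_derivatives[OF g] by blast+

lemma sonic_real:
  assumes g: "sonic_remainders z U V" and y: "\<bar>y - z\<bar> < r"
  shows "sonic_x z U (of_real y) = of_real (Re (sonic_x z U (of_real y)))"
    "sonic_s z V (of_real y) = of_real (Re (sonic_s z V (of_real y)))"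
proof -
  have "of_real y - complex_of_real z \<in> \<real>" by auto
  with sonic_remaindersD(9)[OF g shift_in_ball[OF of_real_in_ball[OF y]]]
  have "sonic_x z U (of_real y) \<in> \<real>" "sonic_s z V (of_real y) \<in> \<real>"
    unfolding sonic_x_def sonic_s_def by auto
  then show "sonic_x z U (of_real y) = of_real (Re (sonic_x z U (of_real y)))"
    "sonic_s z V (of_real y) = of_real (Re (sonic_s z V (of_real y)))" by auto
qed

lemma sonic_flow:
  assumes g: "sonic_remainders z U V"
  shows "flow_on ({z - r<..<z + r} - {z}) (\<lambda>y. Re (sonic_x z U (of_real y))) (\<lambda>y. Re (sonic_s z V (of_real y)))"
  unfolding flow_on_def
proof (intro ballI conjI)
  fix y assume "y \<in> {z - r<..<z + r} - {z}"
  then have y: "\<bar>y - z\<bar> < r" "y \<noteq> z" by auto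
  let ?w = "complex_of_real y" let ?t = "?w - of_real z"
  note wb = of_real_in_ball[OF y(1)]
  note t = shift_in_ball[OF wb] and z = sonic_remaindersD(1)[OF g] and R = sonic_real[OF g y(1), symmetric]
  define gg where "gg = slope_at z ?t (U ?t)"
  note b = slope_dom_bounds[OF sonic_remainders_dom(1)[OF g t], folded gg_def]
  have nz: "of_real z \<noteq> (0::complex)" "of_real z - 1 \<noteq> (0::complex)" "?t \<noteq> 0" "gg \<noteq> 0" "2 + ?t * gg \<noteq> 0" "of_real z + ?t \<noteq> 0"
    using b y by auto
  have Fw: "sonic_x z U ?w = 1 + ?t * gg" "sonic_s z V ?w = 1 + ?t\<^sup>2 * V ?t"
    by (auto simp: sonic_x_def sonic_s_def gg_def)
  show "y > 0" using y r z by auto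
  have "1 - (sonic_x z U ?w)\<^sup>2 = - (?t * gg * (2 + ?t * gg))" unfolding Fw by (simp add: power2_eq_square algebra_simps)
  then have "(sonic_x z U ?w)\<^sup>2 \<noteq> 1" using nz by auto
  then show "(Re (sonic_x z U ?w))\<^sup>2 \<noteq> 1" by (metis R(1) of_real_1 of_real_power)
  have g0: "complex_of_real (slope0 z) = 1 - 1 / of_real z" by (simp add: slope0_def)
  have "of_real (slope0 z) + ?t * slope_rem ?t (slope_at z ?t (U ?t)) (V ?t) (of_real z) = xdot ?w (sonic_x z U ?w) (sonic_s z V ?w)"
    using xdot_slope[OF nz(1,3,4,5,6), of "V ?t"] unfolding Fw gg_def[symmetric] by (simp add: g0)
  with sonic_derivatives(1)[OF g wb]
  have "(sonic_x z U has_field_derivative xdot ?w (sonic_x z U ?w) (sonic_s z V ?w)) (at ?w)" by simp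
  moreover have "xdot ?w (sonic_x z U ?w) (sonic_s z V ?w) = of_real (xdot y (Re (sonic_x z U ?w)) (Re (sonic_s z V ?w)))"
    by (simp only: of_real_xdot[symmetric] R)
  ultimately have "(sonic_x z U has_field_derivative of_real (xdot y (Re (sonic_x z U ?w)) (Re (sonic_s z V ?w)))) (at ?w)"
    by (simp only:)
  from real_part_has_derivative[OF this]
  show "((\<lambda>y. Re (sonic_x z U (of_real y))) has_real_derivative xdot y (Re (sonic_x z U ?w)) (Re (sonic_s z V ?w))) (at y)"
    by simp
  have cc: "complex_of_real (curv_forcing z) = - (1 - 1 / of_real z) / (2 * of_real z)" by (simp add: curv_forcing_def)
  have gge: "gg = (1 - 1 / of_real z) + ?t * U ?t" by (simp add: gg_def g0)
  have "?t * (of_real (curv_forcing z) + ?t * curv_rem ?t gg (U ?t) (V ?t) (of_real z) + V ?t / (of_real z - 1))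
      = sdot ?w (sonic_x z U ?w) (sonic_s z V ?w)"
    using sdot_curv[OF nz gge, of "V ?t"] unfolding Fw cc by simp
  with sonic_derivatives(2)[OF g wb]
  have "(sonic_s z V has_field_derivative sdot ?w (sonic_x z U ?w) (sonic_s z V ?w)) (at ?w)" unfolding gg_def by simp
  moreover have "sdot ?w (sonic_x z U ?w) (sonic_s z V ?w) = of_real (sdot y (Re (sonic_x z U ?w)) (Re (sonic_s z V ?w)))"
    by (simp only: of_real_sdot[symmetric] R)
  ultimately have "(sonic_s z V has_field_derivative of_real (sdot y (Re (sonic_x z U ?w)) (Re (sonic_s z V ?w)))) (at ?w)"
    by (simp only:)
  from real_part_has_derivative[OF this]
  show "((\<lambda>y. Re (sonic_s z V (of_real y))) has_real_derivative sdot y (Re (sonic_x z U ?w)) (Re (sonic_s z V ?w))) (at y)"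
    by simp
qed

text \<open>
  Equal \<open>y\<close> means different \<open>t\<close> for different \<open>z\<close>. The comparison therefore goes through the point
  \<open>z' + (y - z)\<close>: first equal \<open>t\<close>, where \<open>sonic_remainders_lipschitz\<close> applies, then a shift by \<open>z - z'\<close>, controlled by
  the derivative.
\<close>

lemma sonic_lipschitz:
  assumes g: "sonic_remainders z U V" and g': "sonic_remainders z' U' V'"
    and y: "\<bar>y - z\<bar> < r" "\<bar>y - z'\<bar> < r"
  shows "norm (sonic_x z U (of_real y) - sonic_x z' U' (of_real y)) \<le> (5 + A + B + Q) * \<bar>z - z'\<bar>"
    and "norm (sonic_s z V (of_real y) - sonic_s z' V' (of_real y)) \<le> (5 + A + B + Q) * \<bar>z - z'\<bar>"
proof -
  let ?d = "\<bar>z - z'\<bar>" and ?w = "complex_of_real y" and ?t = "complex_of_real y - of_real z"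
  let ?w' = "of_real z' + ?t"
  note z = sonic_remaindersD(1)[OF g] and z' = sonic_remaindersD(1)[OF g']
  have t: "?t \<in> ball 0 r" by (rule shift_in_ball[OF of_real_in_ball[OF y(1)]])
  have t1: "norm ?t \<le> 1" using t r by auto
  then have t2: "norm (?t\<^sup>2) \<le> 1" by (simp add: norm_power power_le_one)
  have w': "?w' \<in> ball (of_real z') r" "?w \<in> ball (of_real z') r"
    using t of_real_in_ball[OF y(2)] by (auto simp: dist_norm norm_minus_commute)
  have "?w' - ?w = of_real (z' - z)" by simp
  then have nd: "norm (?w' - ?w) = ?d" by (simp only: norm_of_real abs_minus_commute)
  have "\<bar>slope0 z - slope0 z'\<bar> \<le> ?d"
    using inverse_lipschitz[of z z'] z z' by (auto simp: slope0_def abs_minus_commute)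
  then have g0d: "norm (complex_of_real (slope0 z) - of_real (slope0 z')) \<le> ?d"
    by (metis norm_of_real of_real_diff real_norm_def)
  have "sonic_x z U ?w - sonic_x z' U' ?w' = ?t * (of_real (slope0 z) - of_real (slope0 z')) + ?t\<^sup>2 * (U ?t - U' ?t)"
    by (simp add: sonic_x_def power2_eq_square algebra_simps)
  also have "norm \<dots> \<le> 1 * ?d + 1 * (Q * ?d)"
    using sonic_remainders_lipschitz(1)[OF g g' t] g0d t1 t2 unfolding norm_mult
    by (intro order_trans[OF norm_triangle_ineq] add_mono, unfold norm_mult) (intro mult_mono; simp)+
  finally have "norm (sonic_x z U ?w - sonic_x z' U' ?w') \<le> (1 + Q) * ?d" by (simp add: algebra_simps)
  moreover have "norm (sonic_x z' U' ?w' - sonic_x z' U' ?w) \<le> (4 + A + B) * norm (?w' - ?w)"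
  proof (rule field_differentiable_bound[OF convex_ball[of "of_real z'" r]])
    fix w assume w: "w \<in> ball (complex_of_real z') r"
    let ?s = "w - of_real z'"
    note dm = sonic_remainders_dom(1)[OF g' shift_in_ball[OF w]]
    show "(sonic_x z' U' has_field_derivative of_real (slope0 z')
        + ?s * slope_rem ?s (slope_at z' ?s (U' ?s)) (V' ?s) (of_real z')) (at w within ball (of_real z') r)"
      using sonic_derivatives(1)[OF g' w] by (rule has_field_derivative_at_within)
    have "norm ?s * norm (slope_rem ?s (slope_at z' ?s (U' ?s)) (V' ?s) (of_real z')) \<le> 1 * A"
      using slope_dom_bounds(7)[OF dm] slope_bound[OF dm] by (intro mult_mono) auto
    then show "norm (of_real (slope0 z') + ?s * slope_rem ?s (slope_at z' ?s (U' ?s)) (V' ?s) (of_real z')) \<le> 4 + A + B"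
      using slope0_bounds[OF z'] B by (intro order_trans[OF norm_triangle_ineq]) (simp add: norm_mult)
  qed (use w' in auto)
  ultimately show "norm (sonic_x z U ?w - sonic_x z' U' ?w) \<le> (5 + A + B + Q) * ?d"
    using norm_triangle_ineq[of "sonic_x z U ?w - sonic_x z' U' ?w'" "sonic_x z' U' ?w' - sonic_x z' U' ?w"]
    unfolding nd by (simp add: algebra_simps)
  have "sonic_s z V ?w - sonic_s z' V' ?w' = ?t\<^sup>2 * (V ?t - V' ?t)" by (simp add: sonic_s_def algebra_simps)
  also have "norm \<dots> \<le> 1 * (Q * ?d)"
    using sonic_remainders_lipschitz(2)[OF g g' t] t2 unfolding norm_mult by (intro mult_mono) auto
  finally have "norm (sonic_s z V ?w - sonic_s z' V' ?w') \<le> (1 + Q) * ?d" by (simp add: algebra_simps)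
  moreover have "norm (sonic_s z' V' ?w' - sonic_s z' V' ?w) \<le> (4 + A + B) * norm (?w' - ?w)"
  proof (rule field_differentiable_bound[OF convex_ball[of "of_real z'" r]])
    fix w assume w: "w \<in> ball (complex_of_real z') r"
    let ?s = "w - of_real z'"
    note dm = sonic_remainders_dom[OF g' shift_in_ball[OF w]]
    let ?R = "curv_rem ?s (slope_at z' ?s (U' ?s)) (U' ?s) (V' ?s) (of_real z')"
    show "(sonic_s z' V' has_field_derivative ?s * (of_real (curv_forcing z') + ?s * ?R + V' ?s / (of_real z' - 1)))
        (at w within ball (of_real z') r)"
      using sonic_derivatives(2)[OF g' w] by (rule has_field_derivative_at_within)
    have s1: "norm ?s \<le> 1" using slope_dom_bounds(7)[OF dm(1)] .
    have a1: "norm (complex_of_real (curv_forcing z')) \<le> 1" using curv_forcing_bound[OF z'] by simp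
    have a2: "norm (?s * ?R) \<le> 1 * B" unfolding norm_mult using s1 curv_bound[OF dm(2)] by (intro mult_mono) auto
    have a3: "norm (V' ?s / (of_real z' - 1)) \<le> 2 / 1" unfolding norm_divide
      using slope_dom_bounds[OF dm(1)] by (intro frac_le) auto
    have "norm (of_real (curv_forcing z') + ?s * ?R + V' ?s / (of_real z' - 1)) \<le> 1 + 1 * B + 2 / 1"
      by (intro order_trans[OF norm_triangle_ineq] add_mono a1 a2 a3)
    with s1 have "norm (?s * (of_real (curv_forcing z') + ?s * ?R + V' ?s / (of_real z' - 1))) \<le> 1 * (1 + 1 * B + 2 / 1)"
      unfolding norm_mult[of ?s] by (intro mult_mono) auto
    then show "norm (?s * (of_real (curv_forcing z') + ?s * ?R + V' ?s / (of_real z' - 1))) \<le> 4 + A + B" using A by simp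
  qed (use w' in auto)
  ultimately show "norm (sonic_s z V ?w - sonic_s z' V' ?w) \<le> (5 + A + B + Q) * ?d"
    using norm_triangle_ineq[of "sonic_s z V ?w - sonic_s z' V' ?w'" "sonic_s z' V' ?w' - sonic_s z' V' ?w"]
    unfolding nd by (simp add: algebra_simps)
qed

lemma sonic_taylor:
  assumes g: "sonic_remainders z U V" and y: "\<bar>y - z\<bar> < r"
  shows "\<bar>Re (sonic_x z U (of_real y)) - (1 + (1 - 1 / z) * (y - z) + bend0 z * (y - z)\<^sup>2)\<bar> \<le> A * (1 + A + C) * \<bar>y - z\<bar> ^ 3"
    and "\<bar>Re (sonic_s z V (of_real y)) - (1 + curv0 z * (y - z)\<^sup>2)\<bar> \<le> C * \<bar>y - z\<bar> ^ 3"
proof -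
  let ?t = "complex_of_real y - of_real z"
  note t = shift_in_ball[OF of_real_in_ball[OF y]]
  have nt: "norm ?t = \<bar>y - z\<bar>" by (simp flip: of_real_diff)
  have cube: "\<bar>y - z\<bar>\<^sup>2 * (K * \<bar>y - z\<bar>) = K * \<bar>y - z\<bar> ^ 3" for K
    by (simp add: power2_eq_square power3_eq_cube algebra_simps)
  have "complex_of_real (Re (sonic_x z U (of_real y)) - (1 + (1 - 1 / z) * (y - z) + bend0 z * (y - z)\<^sup>2))
      = ?t\<^sup>2 * (U ?t - of_real (bend0 z))"
    unfolding slope0_def[symmetric] of_real_diff sonic_real(1)[OF g y, symmetric]
    by (simp add: sonic_x_def power2_eq_square algebra_simps)
  then have "\<bar>Re (sonic_x z U (of_real y)) - (1 + (1 - 1 / z) * (y - z) + bend0 z * (y - z)\<^sup>2)\<bar>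
      = \<bar>y - z\<bar>\<^sup>2 * norm (U ?t - of_real (bend0 z))"
    by (metis norm_of_real norm_mult norm_power nt real_norm_def)
  also have "\<dots> \<le> \<bar>y - z\<bar>\<^sup>2 * (A * (1 + A + C) * \<bar>y - z\<bar>)"
    using sonic_remainders_bend[OF g t] unfolding nt by (intro mult_left_mono) auto
  finally show "\<bar>Re (sonic_x z U (of_real y)) - (1 + (1 - 1 / z) * (y - z) + bend0 z * (y - z)\<^sup>2)\<bar>
      \<le> A * (1 + A + C) * \<bar>y - z\<bar> ^ 3" unfolding cube .
  have "complex_of_real (Re (sonic_s z V (of_real y)) - (1 + curv0 z * (y - z)\<^sup>2)) = ?t\<^sup>2 * (V ?t - of_real (curv0 z))"
    unfolding of_real_diff sonic_real(2)[OF g y, symmetric] by (simp add: sonic_s_def power2_eq_square algebra_simps)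
  then have "\<bar>Re (sonic_s z V (of_real y)) - (1 + curv0 z * (y - z)\<^sup>2)\<bar> = \<bar>y - z\<bar>\<^sup>2 * norm (V ?t - of_real (curv0 z))"
    by (metis norm_of_real norm_mult norm_power nt real_norm_def)
  also have "\<dots> \<le> \<bar>y - z\<bar>\<^sup>2 * (C * \<bar>y - z\<bar>)"
    using sonic_remaindersD(5)[OF g t] unfolding nt by (intro mult_left_mono) auto
  finally show "\<bar>Re (sonic_s z V (of_real y)) - (1 + curv0 z * (y - z)\<^sup>2)\<bar> \<le> C * \<bar>y - z\<bar> ^ 3" unfolding cube .
qed

end

lemma sonic_constants_exist: "\<exists>A B C r. sonic_constants A B C r"
proof -
  obtain A where A: "A \<ge> 1"
    "\<And>p. p \<in> slope_dom \<Longrightarrow> norm (slope_rem (fst p) (fst (snd p)) (fst (snd (snd p))) (snd (snd (snd p)))) \<le> A"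
    "\<And>p q. p \<in> slope_dom \<Longrightarrow> q \<in> slope_dom \<Longrightarrow> norm (slope_rem (fst p) (fst (snd p)) (fst (snd (snd p))) (snd (snd (snd p)))
       - slope_rem (fst q) (fst (snd q)) (fst (snd (snd q))) (snd (snd (snd q)))) \<le> A * dist p q"
    using bounded_lipschitzD[OF bounded_lipschitz_slope_rem] by blast
  obtain B where B: "B \<ge> 1"
    "\<And>p. p \<in> curv_dom A \<Longrightarrow> norm (curv_rem (fst p) (fst (snd p)) (fst (snd (snd p))) (fst (snd (snd (snd p)))) (snd (snd (snd (snd p))))) \<le> B"
    "\<And>p q. p \<in> curv_dom A \<Longrightarrow> q \<in> curv_dom A \<Longrightarrow>
       norm (curv_rem (fst p) (fst (snd p)) (fst (snd (snd p))) (fst (snd (snd (snd p)))) (snd (snd (snd (snd p))))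
       - curv_rem (fst q) (fst (snd q)) (fst (snd (snd q))) (fst (snd (snd (snd q)))) (snd (snd (snd (snd q))))) \<le> B * dist p q"
    using bounded_lipschitzD[OF bounded_lipschitz_curv_rem[of A]] by blast
  define C where "C = 2 * (A + B)"
  define r where "r = min (1 / (16 * C\<^sup>2)) (min (1 / 8) (1 / (4 * A)))"
  have "sonic_constants A B C r"
  proof
    show C: "C \<ge> 1" "A \<le> C" "2 * B \<le> C" using A B by (auto simp: C_def)
    show "A \<ge> 1" "B \<ge> 1" by fact+
    show "r > 0" using C A by (simp add: r_def)
    have "16 * C\<^sup>2 * r \<le> 16 * C\<^sup>2 * (1 / (16 * C\<^sup>2))" unfolding r_def by (intro mult_left_mono) auto
    then show "16 * C\<^sup>2 * r \<le> 1" using C by simp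
    have "r * A \<le> 1 / (4 * A) * A" unfolding r_def using A by (intro mult_right_mono) auto
    then show "r * A \<le> 1 / 4" using A by simp
    show "r \<le> 1 / 8" by (simp add: r_def)
  next
    fix t g v z t' g' v' z' :: complex assume p: "(t, g, v, z) \<in> slope_dom"
    show "norm (slope_rem t g v z) \<le> A" using A(2)[OF p] by simp
    assume q: "(t', g', v', z') \<in> slope_dom"
    have "norm (slope_rem t g v z - slope_rem t' g' v' z') \<le> A * dist (t, g, v, z) (t', g', v', z')" using A(3)[OF p q] by simp
    also have "\<dots> \<le> A * (dist t t' + (dist g g' + (dist v v' + dist z z')))" using A(1) by (intro mult_left_mono dist_quad_le) auto
    finally show "norm (slope_rem t g v z - slope_rem t' g' v' z') \<le> A * (dist t t' + (dist g g' + (dist v v' + dist z z')))" .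
  next
    fix t g u v z t' g' u' v' z' :: complex assume p: "(t, g, u, v, z) \<in> curv_dom A"
    show "norm (curv_rem t g u v z) \<le> B" using B(2)[OF p] by simp
    assume q: "(t', g', u', v', z') \<in> curv_dom A"
    have "norm (curv_rem t g u v z - curv_rem t' g' u' v' z') \<le> B * dist (t, g, u, v, z) (t', g', u', v', z')"
      using B(3)[OF p q] by simp
    also have "\<dots> \<le> B * (dist t t' + (dist g g' + (dist u u' + (dist v v' + dist z z'))))"
      using B(1) by (intro mult_left_mono dist_quint_le) auto
    finally show "norm (curv_rem t g u v z - curv_rem t' g' u' v' z')
      \<le> B * (dist t t' + (dist g g' + (dist u u' + (dist v v' + dist z z'))))" .
  qed
  then show ?thesis by blast
qed

text \<open>
  The germs of all candidates \<open>z\<close> on a neighbourhood of common size \<open>\<delta>\<close>, with uniform Taylor remainders and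
  Lipschitz in \<open>z\<close>. The rest of the argument uses nothing else about the sonic point.
\<close>

theorem sonic_germ_exists:
  obtains \<delta> M :: real and X S :: "real \<Rightarrow> real \<Rightarrow> real" where
    "0 < \<delta>" "\<delta> \<le> 1 / 8" "M \<ge> 1"
    "\<And>z. z \<in> {2..3} \<Longrightarrow> flow_on ({z - \<delta><..<z + \<delta>} - {z}) (X z) (S z)"
    "\<And>z. z \<in> {2..3} \<Longrightarrow> \<exists>F G. F holomorphic_on ball (of_real z) \<delta> \<and> G holomorphic_on ball (of_real z) \<delta> \<and>
        (\<forall>y. \<bar>y - z\<bar> < \<delta> \<longrightarrow> F (of_real y) = of_real (X z y) \<and> G (of_real y) = of_real (S z y))"
    "\<And>z y. z \<in> {2..3} \<Longrightarrow> \<bar>y - z\<bar> < \<delta> \<Longrightarrow>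
        \<bar>X z y - (1 + (1 - 1 / z) * (y - z) + bend0 z * (y - z)\<^sup>2)\<bar> \<le> M * \<bar>y - z\<bar> ^ 3"
    "\<And>z y. z \<in> {2..3} \<Longrightarrow> \<bar>y - z\<bar> < \<delta> \<Longrightarrow> \<bar>S z y - (1 + curv0 z * (y - z)\<^sup>2)\<bar> \<le> M * \<bar>y - z\<bar> ^ 3"
    "\<And>z z' y. z \<in> {2..3} \<Longrightarrow> z' \<in> {2..3} \<Longrightarrow> \<bar>y - z\<bar> < \<delta> \<Longrightarrow> \<bar>y - z'\<bar> < \<delta> \<Longrightarrow>
        \<bar>X z y - X z' y\<bar> \<le> M * \<bar>z - z'\<bar> \<and> \<bar>S z y - S z' y\<bar> \<le> M * \<bar>z - z'\<bar>"
proof -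
  obtain A B C r where "sonic_constants A B C r" using sonic_constants_exist by blast
  then interpret sonic_constants A B C r .
  have "\<forall>z\<in>{2..3}. \<exists>W. sonic_remainders z (fst W) (snd W)" using sonic_remainders_exist by (metis fst_conv snd_conv)
  then obtain W where W: "\<forall>z\<in>{2..3}. sonic_remainders z (fst (W z)) (snd (W z))" by (rule bchoice[THEN exE])
  define U V where "U z = fst (W z)" and "V z = snd (W z)" for z
  have g: "sonic_remainders z (U z) (V z)" if "z \<in> {2..3}" for z using W that by (auto simp: U_def V_def)
  define X S where "X z y = Re (sonic_x z (U z) (of_real y))" and "S z y = Re (sonic_s z (V z) (of_real y))" for z y
  have R: "sonic_x z (U z) (of_real y) = of_real (X z y)" "sonic_s z (V z) (of_real y) = of_real (S z y)"
    if "z \<in> {2..3}" "\<bar>y - z\<bar> < r" for z y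
    using sonic_real[OF g[OF that(1)] that(2)] by (simp_all add: X_def S_def)
  define M where "M = A * (1 + A + C) + C + (5 + A + B + Q)"
  have M: "M \<ge> 1" "A * (1 + A + C) \<le> M" "C \<le> M" "5 + A + B + Q \<le> M"
  proof -
    have "0 \<le> A * (1 + A + C)" using A C by (intro mult_nonneg_nonneg) auto
    then show "M \<ge> 1" "A * (1 + A + C) \<le> M" "C \<le> M" "5 + A + B + Q \<le> M" using A B C Q unfolding M_def by auto
  qed
  show thesis
  proof (rule that[of r M X S, OF r(1,3) M(1)])
    fix z assume z: "z \<in> {2..3::real}"
    show "flow_on ({z - r<..<z + r} - {z}) (X z) (S z)"
      using sonic_flow[OF g[OF z]] unfolding X_def[abs_def] S_def[abs_def] .
    show "\<exists>F G. F holomorphic_on ball (of_real z) r \<and> G holomorphic_on ball (of_real z) r \<and>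
        (\<forall>y. \<bar>y - z\<bar> < r \<longrightarrow> F (of_real y) = of_real (X z y) \<and> G (of_real y) = of_real (S z y))"
      using sonic_holomorphic[OF g[OF z]] R[OF z] by blast
    fix y assume y: "\<bar>y - z\<bar> < r"
    note T = sonic_taylor[OF g[OF z] y, folded X_def S_def]
    show "\<bar>X z y - (1 + (1 - 1 / z) * (y - z) + bend0 z * (y - z)\<^sup>2)\<bar> \<le> M * \<bar>y - z\<bar> ^ 3"
      by (rule order_trans[OF T(1) mult_right_mono[OF M(2)]]) simp
    show "\<bar>S z y - (1 + curv0 z * (y - z)\<^sup>2)\<bar> \<le> M * \<bar>y - z\<bar> ^ 3"
      by (rule order_trans[OF T(2) mult_right_mono[OF M(3)]]) simp
    fix z' assume z': "z' \<in> {2..3}" and y': "\<bar>y - z'\<bar> < r"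
    note L = sonic_lipschitz[OF g[OF z] g[OF z'] y y', unfolded R[OF z y] R[OF z' y'], folded of_real_diff, unfolded norm_of_real]
    from order_trans[OF L(1) mult_right_mono[OF M(4)]] order_trans[OF L(2) mult_right_mono[OF M(4)]]
    show "\<bar>X z y - X z' y\<bar> \<le> M * \<bar>z - z'\<bar> \<and> \<bar>S z y - S z' y\<bar> \<le> M * \<bar>z - z'\<bar>" by simp
  qed
qed

section \<open>Shooting towards the centre\<close>

text \<open>
  How a solution meets the wall \<open>3 x = y\<close>: there the sign of \<open>3 x' - 1\<close> is that of \<open>(s - x) / (1 - x\<^sup>2)\<close>.
\<close>

lemma slope_identity:
  assumes "y \<noteq> 0" "x\<^sup>2 \<noteq> (1::real)"
  shows "3 * xdot y x s - 1 = (- 2 * (3 * x - y) + 6 * x\<^sup>2 * (s - x) / (1 - x\<^sup>2)) / y"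
  unfolding xdot_def using assms by (simp add: divide_simps) (simp add: power2_eq_square algebra_simps)

text \<open>
  How a solution meets the wall \<open>s = x\<close>: there \<open>s' - x'\<close> has the sign of \<open>3 x - y\<close>.
\<close>

lemma gap_identity:
  assumes "y \<noteq> 0" "x\<^sup>2 \<noteq> (1::real)"
  shows "sdot y x s - xdot y x s = ((3 * x - y) + (s - x) * (1 - 2 * x * (s + x) / (1 - x\<^sup>2))) / y"
  unfolding xdot_def sdot_def using assms by (simp add: divide_simps) (simp add: power2_eq_square algebra_simps)

text \<open>
  How a solution meets the wall \<open>2 x = y\<close> inside the sonic point.
\<close>

lemma half_identity:
  assumes "x \<noteq> 0" "x\<^sup>2 \<noteq> (1::real)"
  shows "1 - 2 * xdot (2 * x) x s = (1 + x\<^sup>2 - 2 * x * s) / (1 - x\<^sup>2)"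
  unfolding xdot_def using assms by (simp add: divide_simps power2_eq_square)

lemma sdot_at_1: "x\<^sup>2 \<noteq> (1::real) \<Longrightarrow> sdot y x 1 = (1 - x)\<^sup>2 / (y * (1 - x\<^sup>2))"
  by (simp add: sdot_def power2_eq_square algebra_simps)

text \<open>
  The homogeneous collapse, the corner \<open>s = x = y/3\<close> of the region on the left.
\<close>

lemma friedmann_flow:
  assumes "I \<subseteq> {0<..<3}"
  shows "flow_on I (\<lambda>y. y / 3) (\<lambda>y. y / 3)"
  unfolding flow_on_def
proof (intro ballI conjI)
  fix y assume "y \<in> I"
  then have y: "0 < y" "y < 3" using assms by auto
  have "(y / 3)\<^sup>2 < 1" using y by (simp add: abs_square_less_1)
  then show D: "(y / 3)\<^sup>2 \<noteq> 1" by simp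
  have "3 * xdot y (y / 3) (y / 3) - 1 = 0" by (subst slope_identity) (use y D in auto)
  then have 1: "xdot y (y / 3) (y / 3) = 1 / 3" by simp
  have "sdot y (y / 3) (y / 3) - xdot y (y / 3) (y / 3) = 0" by (subst gap_identity) (use y D in auto)
  then have 2: "sdot y (y / 3) (y / 3) = 1 / 3" using 1 by simp
  show "((\<lambda>y. y / 3) has_real_derivative xdot y (y / 3) (y / 3)) (at y)"
    "((\<lambda>y. y / 3) has_real_derivative sdot y (y / 3) (y / 3)) (at y)"
    unfolding 1 2 by (auto intro!: derivative_eq_intros)
qed (use assms in auto)

lemma bend0_bound: "z \<in> {2..3} \<Longrightarrow> \<bar>bend0 z\<bar> \<le> 1"
proof -
  assume z: "z \<in> {2..3}"
  have "0 \<le> (z - 2) * (3 - z)" using z by (intro mult_nonneg_nonneg) auto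
  then have n1: "- z\<^sup>2 + 5 * z - 5 \<ge> 1" by (simp add: power2_eq_square algebra_simps)
  have "0 \<le> (z - 5 / 2)\<^sup>2" by simp
  then have n2: "- z\<^sup>2 + 5 * z - 5 \<le> 8" by (simp add: power2_eq_square algebra_simps)
  have "2 * 2 * 2 * 1 \<le> 2 * z * z * (2 * z - 3)" using z by (intro mult_mono) auto
  then have d: "8 \<le> 2 * z\<^sup>2 * (2 * z - 3)" by (simp add: power2_eq_square)
  have "\<bar>bend0 z\<bar> \<le> 8 / 8" unfolding bend0_def abs_divide using n1 n2 d by (intro frac_le) auto
  then show ?thesis by simp
qed

lemma positive_on_compact:
  fixes \<phi> :: "real \<Rightarrow> real"
  assumes "continuous_on {a..b} \<phi>" "\<And>y. y \<in> {a..b} \<Longrightarrow> \<phi> y > 0"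
  obtains m where "m > 0" "\<And>y. y \<in> {a..b} \<Longrightarrow> m \<le> \<phi> y"
proof (cases "a \<le> b")
  case True
  then obtain w where "w \<in> {a..b}" "\<forall>y\<in>{a..b}. \<phi> w \<le> \<phi> y"
    using continuous_attains_inf[OF compact_Icc _ assms(1)] by auto
  then show ?thesis using assms(2) that by blast
next
  case False
  then show ?thesis using that[of 1] by auto
qed

lemma eventually_left_pos:
  fixes \<phi> :: "real \<Rightarrow> real"
  assumes "isCont \<phi> w" "\<phi> w > 0"
  shows "\<exists>d>0. \<forall>y\<in>{w - d..w}. \<phi> y > 0"
proof -
  obtain d where d: "d > 0" "\<forall>y. \<bar>y - w\<bar> < d \<longrightarrow> \<phi> y > 0"
    using assms(1)[unfolded continuous_at_eps_delta, rule_format, OF assms(2)] by (force simp: dist_real_def)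
  then show ?thesis by (intro exI[of _ "d / 2"]) auto
qed

locale sonic_germ =
  fixes \<delta> M :: real and X S :: "real \<Rightarrow> real \<Rightarrow> real"
  assumes \<delta>: "0 < \<delta>" "\<delta> \<le> 1 / 8" and M: "M \<ge> 1"
    and germ_flow: "\<And>z. z \<in> {2..3} \<Longrightarrow> flow_on ({z - \<delta><..<z + \<delta>} - {z}) (X z) (S z)"
    and germ_X: "\<And>z y. z \<in> {2..3} \<Longrightarrow> \<bar>y - z\<bar> < \<delta> \<Longrightarrow>
        \<bar>X z y - (1 + (1 - 1 / z) * (y - z) + bend0 z * (y - z)\<^sup>2)\<bar> \<le> M * \<bar>y - z\<bar> ^ 3"
    and germ_S: "\<And>z y. z \<in> {2..3} \<Longrightarrow> \<bar>y - z\<bar> < \<delta> \<Longrightarrow> \<bar>S z y - (1 + curv0 z * (y - z)\<^sup>2)\<bar> \<le> M * \<bar>y - z\<bar> ^ 3"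
    and germ_lipschitz: "\<And>z z' y. z \<in> {2..3} \<Longrightarrow> z' \<in> {2..3} \<Longrightarrow> \<bar>y - z\<bar> < \<delta> \<Longrightarrow> \<bar>y - z'\<bar> < \<delta> \<Longrightarrow>
        \<bar>X z y - X z' y\<bar> \<le> M * \<bar>z - z'\<bar> \<and> \<bar>S z y - S z' y\<bar> \<le> M * \<bar>z - z'\<bar>"
begin

text \<open>
  For \<open>\<bar>t\<bar> < d\<close> the number \<open>(1 + M) \<bar>t\<bar>\<close> is at most \<open>1/60\<close>. This makes the quadratic remainder small against
  the linear term of \<open>x\<close>, and the cubic remainder of \<open>s\<close> smaller than its quadratic term, as \<open>1/60 < 1/54 \<le> - curv0 z\<close>.
\<close>

definition d where "d = min \<delta> (1 / (60 * (1 + M)))"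

lemma d: "0 < d" "d \<le> \<delta>" "60 * (1 + M) * d \<le> 1"
proof -
  have "60 * (1 + M) * d \<le> 60 * (1 + M) * (1 / (60 * (1 + M)))"
    unfolding d_def using M by (intro mult_left_mono) auto
  then show "60 * (1 + M) * d \<le> 1" using M by simp
qed (use \<delta> M in \<open>auto simp: d_def\<close>)

lemma near_sonic:
  assumes z: "z \<in> {2..3}" and y: "\<bar>y - z\<bar> < d"
  shows "\<bar>X z y - (1 + (1 - 1 / z) * (y - z))\<bar> \<le> (1 + M) * (y - z)\<^sup>2"
    and "\<bar>S z y - 1\<bar> \<le> (1 + M) * (y - z)\<^sup>2"
    and "y \<noteq> z \<Longrightarrow> S z y < 1"
    and "60 * ((1 + M) * (y - z)\<^sup>2) \<le> \<bar>y - z\<bar>"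
proof -
  let ?t = "y - z"
  have dM: "(60 * (1 + M)) * \<bar>?t\<bar> \<le> 1"
  proof -
    have "(60 * (1 + M)) * \<bar>?t\<bar> \<le> (60 * (1 + M)) * d" using y M by (intro mult_left_mono) auto
    then show ?thesis using d by linarith
  qed
  have t1: "\<bar>?t\<bar> \<le> 1" using y d \<delta> by linarith
  have cube: "M * \<bar>?t\<bar> ^ 3 \<le> M * ?t\<^sup>2"
  proof -
    have "\<bar>?t\<bar> ^ 3 = \<bar>?t\<bar> * ?t\<^sup>2" by (simp add: power3_eq_cube power2_eq_square abs_mult_self_eq)
    also have "\<dots> \<le> 1 * ?t\<^sup>2" using t1 by (intro mult_right_mono) auto
    finally show ?thesis using M by simp
  qed
  have yd: "\<bar>?t\<bar> < \<delta>" using y d by linarith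
  have "\<bar>bend0 z * ?t\<^sup>2\<bar> \<le> 1 * ?t\<^sup>2" unfolding abs_mult using bend0_bound[OF z] by (intro mult_mono) auto
  then show "\<bar>X z y - (1 + (1 - 1 / z) * (y - z))\<bar> \<le> (1 + M) * (y - z)\<^sup>2"
    using germ_X[OF z yd] cube by (simp add: algebra_simps abs_le_iff)
  have "\<bar>curv0 z * ?t\<^sup>2\<bar> \<le> 1 * ?t\<^sup>2" unfolding abs_mult using curv0_bounds[OF z] by (intro mult_mono) auto
  then show "\<bar>S z y - 1\<bar> \<le> (1 + M) * (y - z)\<^sup>2"
    using germ_S[OF z yd] cube by (simp add: algebra_simps abs_le_iff)
  show "60 * ((1 + M) * (y - z)\<^sup>2) \<le> \<bar>y - z\<bar>"
  proof -
    have "?t\<^sup>2 = \<bar>?t\<bar> * \<bar>?t\<bar>" by (simp add: power2_eq_square)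
    then have "60 * ((1 + M) * ?t\<^sup>2) = (60 * (1 + M)) * \<bar>?t\<bar> * \<bar>?t\<bar>" by (simp only: mult.assoc)
    then show ?thesis using mult_right_mono[OF dM abs_ge_zero[of ?t]] by simp
  qed
  show "S z y < 1" if "y \<noteq> z"
  proof -
    have tp: "?t\<^sup>2 > 0" using that by simp
    have "\<bar>?t\<bar> ^ 3 = \<bar>?t\<bar> * ?t\<^sup>2" by (simp add: power3_eq_cube power2_eq_square abs_mult_self_eq)
    then have "S z y - (1 + curv0 z * ?t\<^sup>2) \<le> M * (\<bar>?t\<bar> * ?t\<^sup>2)"
      using order_trans[OF abs_ge_self germ_S[OF z yd]] by simp
    then have "S z y - 1 \<le> curv0 z * ?t\<^sup>2 + M * (\<bar>?t\<bar> * ?t\<^sup>2)" by simp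
    also have "\<dots> \<le> (- 1 / 54) * ?t\<^sup>2 + (M * \<bar>?t\<bar>) * ?t\<^sup>2"
      using mult_right_mono[OF conjunct2[OF curv0_bounds[OF z]] zero_le_power2[of ?t]] by simp
    also have "\<dots> < (- 1 / 54) * ?t\<^sup>2 + (1 / 54) * ?t\<^sup>2"
    proof -
      have "60 * (M * \<bar>?t\<bar>) \<le> (60 * (1 + M)) * \<bar>?t\<bar>" by (simp add: algebra_simps)
      then have "M * \<bar>?t\<bar> < 1 / 54" using dM by linarith
      then show ?thesis using tp by (intro add_strict_left_mono mult_strict_right_mono) auto
    qed
    finally show ?thesis by simp
  qed
qed

text \<open>
  Just inside the sonic point the germ satisfies \<open>x < s < 1\<close> for every \<open>z\<close>, and the position relative to the
  lines \<open>x = y/2\<close> and \<open>x = y/3\<close> is decided by \<open>z - 2\<close> and \<open>3 - z\<close>.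
\<close>

lemma near_sonic_left:
  assumes z: "z \<in> {2..3}" and y: "z - d < y" "y < z"
  shows "X z y < S z y" "S z y < 1" "0 < X z y" "y - 2 * X z y \<ge> (z - 2) - (z - y)"
    "3 * X z y - y \<ge> (3 - z) - 2 * (z - y)"
proof -
  define T Q P where "T = z - y" and "Q = (1 + M) * (y - z)\<^sup>2" and "P = (1 - 1 / z) * T"
  have yT: "y = z - T" and T: "0 < T" "T < d" using y by (auto simp: T_def)
  have ya: "\<bar>y - z\<bar> < d" using T by (simp add: T_def)
  note n = near_sonic[OF z ya, folded Q_def]
  note g = slope0_bounds[OF z, unfolded slope0_def]
  have sq: "60 * Q \<le> T" using n(4) T by (simp add: T_def)
  have P: "1 / 2 * T \<le> P" "P \<le> 2 / 3 * T"
    unfolding P_def by (rule mult_right_mono; use g T in linarith)+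
  have e: "(1 - 1 / z) * (y - z) = - P" unfolding P_def T_def by (metis minus_diff_eq mult_minus_right)
  have n1: "X z y \<le> 1 - P + Q" "1 - P - Q \<le> X z y"
    using n(1) unfolding e by (auto simp only: abs_le_iff)
  have n2: "1 - Q \<le> S z y" using n(2) by (auto simp only: abs_le_iff)
  show "S z y < 1" using n(3) y by simp
  show "X z y < S z y" using n1 n2 P sq T by linarith
  have "T \<le> 1 / 8" using T d \<delta> by linarith
  then show "0 < X z y" using n1 P sq T by linarith
  show "y - 2 * X z y \<ge> (z - 2) - (z - y)" unfolding T_def[symmetric] using n1 P sq T yT by linarith
  have "3 - z - 2 * T \<le> 3 * X z y - y" using n1 P sq T yT by linarith
  then show "3 * X z y - y \<ge> (3 - z) - 2 * (z - y)" by (simp add: T_def)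
qed

text \<open>
  The continuation of the germ of \<open>z\<close> to the left, slightly beyond \<open>a\<close> so that a crossing at \<open>a\<close> can be
  prolonged. Within distance \<open>\<delta>\<close> of \<open>z\<close> the functions are pinned to the germ.
\<close>

definition leftsol :: "real \<Rightarrow> real \<Rightarrow> (real \<Rightarrow> real) \<Rightarrow> (real \<Rightarrow> real) \<Rightarrow> bool" where
  "leftsol z a x s \<longleftrightarrow> (\<exists>lo<a. flow_on {lo<..<z} x s) \<and> a < z \<and>
     (\<forall>y\<in>{z - \<delta><..<z + \<delta>}. x y = X z y \<and> s y = S z y)"

text \<open>
  The two ways of missing the centre: passing below the Friedmann line \<open>x = y/3\<close> while the walls \<open>x = s\<close> and
  \<open>x = y/2\<close> are still respected, or passing one of these walls while still above the Friedmann line. Strict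
  inequalities at the end point \<open>a\<close> make both conditions stable under perturbation of \<open>z\<close>.
\<close>

definition falls_below where
  "falls_below z \<longleftrightarrow> (\<exists>a x s. leftsol z a x s \<and> (\<forall>y\<in>{a..<z}. x y < s y \<and> 2 * x y < y) \<and> 3 * x a < a)"

definition rises_above where
  "rises_above z \<longleftrightarrow> (\<exists>a x s. leftsol z a x s \<and> (\<forall>y\<in>{a..<z}. y < 3 * x y) \<and> (s a < x a \<or> a < 2 * x a))"

lemma germ_leftsol:
  assumes "z \<in> {2..3}" "z - \<delta> < a" "a < z"
  shows "leftsol z a (X z) (S z)"
proof -
  have "flow_on {z - \<delta><..<z} (X z) (S z)" by (rule flow_on_subset[OF germ_flow[OF assms(1)]]) (use \<delta> in auto)
  then show ?thesis unfolding leftsol_def using assms by blast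
qed

lemma leftsol_unique:
  assumes l: "leftsol z a x s" "leftsol z a' x' s'" and y: "a \<le> y" "a' \<le> y" "y < z"
  shows "x y = x' y \<and> s y = s' y"
proof -
  obtain lo lo' where f: "lo < a" "flow_on {lo<..<z} x s" "lo' < a'" "flow_on {lo'<..<z} x' s'"
    using l unfolding leftsol_def by blast
  define c where "c = max y (z - \<delta> / 2)"
  have c: "c \<in> {z - \<delta><..<z + \<delta>}" "y \<le> c" "c < z" using y \<delta> by (auto simp: c_def)
  show ?thesis
  proof (rule flow_unique[of "{y..c}" x s x' s' c])
    show "flow_on {y..c} x s" by (rule flow_on_subset[OF f(2)]) (use f y c in auto)
    show "flow_on {y..c} x' s'" by (rule flow_on_subset[OF f(4)]) (use f y c in auto)
  qed (use c l in \<open>auto simp: leftsol_def is_interval_1\<close>)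
qed

text \<open>
  Whichever violation comes first contradicts the inequalities that the other condition still requires there.
\<close>

lemma not_both: "\<not> (falls_below z \<and> rises_above z)"
proof
  assume "falls_below z \<and> rises_above z"
  then obtain a x s a' x' s' where l: "leftsol z a x s" "\<forall>y\<in>{a..<z}. x y < s y \<and> 2 * x y < y" "3 * x a < a"
    "leftsol z a' x' s'" "\<forall>y\<in>{a'..<z}. y < 3 * x' y" "s' a' < x' a' \<or> a' < 2 * x' a'"
    unfolding falls_below_def rises_above_def by blast
  have az: "a < z" "a' < z" using l by (auto simp: leftsol_def)
  show False
  proof (cases "a \<le> a'")
    case True
    from leftsol_unique[OF l(1,4), of a'] True az have "x a' = x' a'" "s a' = s' a'" by auto
    moreover have "x a' < s a' \<and> 2 * x a' < a'" using l(2) True az by auto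
    ultimately show False using l(6) by auto
  next
    case False
    from leftsol_unique[OF l(1,4), of a] False az have "x a = x' a" by auto
    moreover have "a < 3 * x' a" using l(5) False az by auto
    ultimately show False using l(3) by auto
  qed
qed

lemma extend_to_leftsol:
  assumes z: "z \<in> {2..3}" and f: "flow_on {lo<..<hi} x s" and p: "p \<in> {lo<..<hi}" "z - \<delta> < p" "p < z"
    and eq: "x p = X z p" "s p = S z p" and a: "lo < a" "a \<le> p"
  shows "\<exists>x' s'. leftsol z a x' s' \<and> (\<forall>y\<in>{lo<..<hi}. y < z \<longrightarrow> x' y = x y \<and> s' y = s y)"
proof -
  have f1: "flow_on {lo<..<min hi z} x s" by (rule flow_on_subset[OF f]) auto
  have f2: "flow_on {z - \<delta><..<z} (X z) (S z)" by (rule flow_on_subset[OF germ_flow[OF z]]) (use \<delta> in auto)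
  obtain x1 s1 where g: "flow_on {min lo (z - \<delta>)<..<max (min hi z) z} x1 s1"
    "\<forall>y\<in>{lo<..<min hi z}. x1 y = x y \<and> s1 y = s y" "\<forall>y\<in>{z - \<delta><..<z}. x1 y = X z y \<and> s1 y = S z y"
    using flow_glue[OF f1 f2, of p] p eq by auto
  define x' s' where "x' y = (if y < z then x1 y else X z y)" and "s' y = (if y < z then s1 y else S z y)" for y
  have "flow_on {min lo (z - \<delta>)<..<z} x1 s1" by (rule flow_on_subset[OF g(1)]) auto
  then have "flow_on {min lo (z - \<delta>)<..<z} x' s'"
    by (rule flow_on_cong_open) (auto simp: x'_def s'_def)
  then have "leftsol z a x' s'" unfolding leftsol_def
    using a p g(3) by (intro conjI exI[of _ "min lo (z - \<delta>)"]) (auto simp: x'_def s'_def)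
  moreover have "\<forall>y\<in>{lo<..<hi}. y < z \<longrightarrow> x' y = x y \<and> s' y = s y" using g(2) by (auto simp: x'_def s'_def)
  ultimately show ?thesis by blast
qed

text \<open>
  Near \<open>z\<close>, where the equation is singular, the Lipschitz bound for the germs gives the dependence on the
  parameter; to the left of a point \<open>p < z\<close> the regular theory takes over, with the values of the germ at
  \<open>p\<close> as initial values.
\<close>

lemma leftsol_dependence:
  assumes z: "z \<in> {2..3}" and l: "leftsol z a x s" and e: "\<epsilon> > 0"
  shows "\<exists>\<eta>>0. \<forall>z'\<in>{2..3}. \<bar>z' - z\<bar> < \<eta> \<longrightarrow> (\<exists>x' s'. leftsol z' a x' s' \<and>
     (\<forall>y\<in>{a..<z}. y < z' \<longrightarrow> \<bar>x' y - x y\<bar> < \<epsilon> \<and> \<bar>s' y - s y\<bar> < \<epsilon>))"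
proof -
  obtain lo where f: "lo < a" "flow_on {lo<..<z} x s" and az: "a < z"
    and ge: "\<And>y. y \<in> {z - \<delta><..<z + \<delta>} \<Longrightarrow> x y = X z y \<and> s y = S z y"
    using l unfolding leftsol_def by blast
  define p where "p = max a (z - \<delta> / 2)"
  have p: "a \<le> p" "p < z" "z - \<delta> < p" "z - \<delta> / 2 \<le> p" using az \<delta> by (auto simp: p_def)
  have sub: "{a..p} \<subseteq> {lo<..<z}" using f p by auto
  from flow_continuous_dependence[OF f(2) sub p(1) e]
  obtain \<eta>1 where \<eta>1: "\<eta>1 > 0" "\<And>x1 s1. \<bar>x1 - x p\<bar> < \<eta>1 \<Longrightarrow> \<bar>s1 - s p\<bar> < \<eta>1 \<Longrightarrow>
    (\<exists>lo' hi' x' s'. flow_on {lo'<..<hi'} x' s' \<and> {a..p} \<subseteq> {lo'<..<hi'} \<and> x' p = x1 \<and> s' p = s1 \<and>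
       (\<forall>y\<in>{a..p}. \<bar>x' y - x y\<bar> < \<epsilon> \<and> \<bar>s' y - s y\<bar> < \<epsilon>))" by blast
  define \<eta> where "\<eta> = min (min (\<delta> / 4) (z - p)) (min \<eta>1 \<epsilon> / (2 * M))"
  have \<eta>: "\<eta> > 0" "\<eta> \<le> \<delta> / 4" "\<eta> \<le> z - p" "M * \<eta> < \<eta>1" "M * \<eta> < \<epsilon>"
  proof -
    show "\<eta> > 0" using \<delta> p \<eta>1 e M by (simp add: \<eta>_def)
    have "M * \<eta> \<le> M * (min \<eta>1 \<epsilon> / (2 * M))" unfolding \<eta>_def using M by (intro mult_left_mono) auto
    also have "\<dots> = min \<eta>1 \<epsilon> / 2" using M by simp
    finally show "M * \<eta> < \<eta>1" "M * \<eta> < \<epsilon>" using \<eta>1 e by auto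
    show "\<eta> \<le> \<delta> / 4" "\<eta> \<le> z - p" unfolding \<eta>_def by linarith+
  qed
  have "\<exists>x' s'. leftsol z' a x' s' \<and> (\<forall>y\<in>{a..<z}. y < z' \<longrightarrow> \<bar>x' y - x y\<bar> < \<epsilon> \<and> \<bar>s' y - s y\<bar> < \<epsilon>)"
    if z': "z' \<in> {2..3}" and zz: "\<bar>z' - z\<bar> < \<eta>" for z'
  proof -
    have Mz: "M * \<bar>z' - z\<bar> \<le> M * \<eta>" using zz M by (intro mult_left_mono) auto
    have close: "\<bar>X z' y - x y\<bar> < \<epsilon> \<and> \<bar>S z' y - s y\<bar> < \<epsilon> \<and> \<bar>X z' y - x y\<bar> < \<eta>1 \<and> \<bar>S z' y - s y\<bar> < \<eta>1"
      if y: "p \<le> y" "y \<le> z" for y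
    proof -
      have "\<bar>y - z'\<bar> < \<delta>" "\<bar>y - z\<bar> < \<delta>" using y p \<eta> zz \<delta> by auto
      from germ_lipschitz[OF z' z this] have "\<bar>X z' y - X z y\<bar> \<le> M * \<eta>" "\<bar>S z' y - S z y\<bar> \<le> M * \<eta>" using Mz by auto
      moreover have "x y = X z y" "s y = S z y" using ge[of y] \<open>\<bar>y - z\<bar> < \<delta>\<close> by (auto simp: abs_less_iff)
      ultimately show ?thesis using \<eta> by auto
    qed
    obtain lo' hi' x1 s1 where f1: "flow_on {lo'<..<hi'} x1 s1" "{a..p} \<subseteq> {lo'<..<hi'}" "x1 p = X z' p" "s1 p = S z' p"
      "\<forall>y\<in>{a..p}. \<bar>x1 y - x y\<bar> < \<epsilon> \<and> \<bar>s1 y - s y\<bar> < \<epsilon>"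
      using \<eta>1(2)[of "X z' p" "S z' p"] close[of p] p by auto
    have pz: "z' - \<delta> < p" "p < z'" using p \<eta> zz \<delta> by auto
    have "p \<in> {lo'<..<hi'}" "lo' < a" using f1(2) p by auto
    from extend_to_leftsol[OF z' f1(1) this(1) pz f1(3,4) this(2) p(1)]
    obtain x' s' where x': "leftsol z' a x' s'" "\<forall>y\<in>{lo'<..<hi'}. y < z' \<longrightarrow> x' y = x1 y \<and> s' y = s1 y" by blast
    have "\<bar>x' y - x y\<bar> < \<epsilon> \<and> \<bar>s' y - s y\<bar> < \<epsilon>" if y: "y \<in> {a..<z}" "y < z'" for y
    proof (cases "y \<le> p")
      case True
      then have "y \<in> {lo'<..<hi'}" using f1(2) y by auto
      then show ?thesis using x'(2) f1(5) True y by auto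
    next
      case False
      then have "y \<in> {z' - \<delta><..<z' + \<delta>}" using pz y \<delta> by auto
      then have "x' y = X z' y" "s' y = S z' y" using x'(1) unfolding leftsol_def by auto
      then show ?thesis using close[of y] False y by auto
    qed
    with x'(1) show ?thesis by blast
  qed
  with \<eta>(1) show ?thesis by blast
qed

lemma leftsol_continuous:
  assumes "leftsol z a x s" "b < z" shows "continuous_on {a..b} x" "continuous_on {a..b} s"
proof -
  obtain lo where "lo < a" "flow_on {lo<..<z} x s" using assms unfolding leftsol_def by blast
  then have "flow_on {a..b} x s" using assms(2) by (auto intro: flow_on_subset)
  then show "continuous_on {a..b} x" "continuous_on {a..b} s" by (rule flow_on_continuous)+
qed

text \<open>
  On \<open>[a, z - k/2]\<close> the strict inequalities hold with a margin and survive a small perturbation. On the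
  remaining piece up to the perturbed sonic point the margin degenerates, but there the germ estimates hold
  for every parameter.
\<close>

lemma falls_below_open:
  assumes z: "z \<in> {2<..<3}" and fb: "falls_below z"
  shows "\<exists>\<eta>>0. \<forall>z'\<in>{2<..<3}. \<bar>z' - z\<bar> < \<eta> \<longrightarrow> falls_below z'"
proof -
  obtain a x s where l: "leftsol z a x s" and pos: "\<And>y. y \<in> {a..<z} \<Longrightarrow> x y < s y \<and> 2 * x y < y" and neg: "3 * x a < a"
    using fb unfolding falls_below_def by blast
  have az: "a < z" using l by (simp add: leftsol_def)
  have z': "2 < z" "z < 3" using z by auto
  \<comment> \<open>Within distance \<open>k\<close> of any parameter near \<open>z\<close> the bound \<open>near_sonic_left\<close> on \<open>y - 2 x\<close> is positive.\<close>
  define k where "k = min d ((z - 2) / 2)"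
  have "0 < k" "k \<le> d" using d(1) z' by (simp_all add: k_def)
  moreover have "k \<le> (z - 2) / 2" unfolding k_def by (rule min.cobounded2)
  ultimately have k: "0 < k" "k \<le> d" "2 * k \<le> z - 2" by simp_all
  have kz: "z - k / 2 < z" using k by simp
  note c = leftsol_continuous[OF l kz]
  obtain m1 where m1: "m1 > 0" "\<And>y. y \<in> {a..z - k / 2} \<Longrightarrow> m1 \<le> s y - x y"
    by (rule positive_on_compact[of a "z - k / 2" "\<lambda>y. s y - x y"]) (use pos k in \<open>auto intro!: continuous_intros c\<close>)
  obtain m2 where m2: "m2 > 0" "\<And>y. y \<in> {a..z - k / 2} \<Longrightarrow> m2 \<le> y - 2 * x y"
    by (rule positive_on_compact[of a "z - k / 2" "\<lambda>y. y - 2 * x y"]) (use pos k in \<open>auto intro!: continuous_intros c\<close>)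
  define \<epsilon> where "\<epsilon> = min (min (m1 / 2) (m2 / 2)) ((a - 3 * x a) / 3)"
  have "\<epsilon> \<le> m1 / 2" "\<epsilon> \<le> m2 / 2" "\<epsilon> \<le> (a - 3 * x a) / 3"
    unfolding \<epsilon>_def by (rule min.coboundedI1[OF min.cobounded1] min.coboundedI1[OF min.cobounded2] min.cobounded2)+
  moreover have "\<epsilon> > 0" using m1 m2 neg by (simp add: \<epsilon>_def)
  ultimately have \<epsilon>: "\<epsilon> > 0" "2 * \<epsilon> \<le> m1" "2 * \<epsilon> \<le> m2" "3 * \<epsilon> \<le> a - 3 * x a" by simp_all
  have z23: "z \<in> {2..3}" using z by auto
  obtain \<eta> where \<eta>: "\<eta> > 0" "\<And>z'. z' \<in> {2..3} \<Longrightarrow> \<bar>z' - z\<bar> < \<eta> \<Longrightarrow> (\<exists>x' s'. leftsol z' a x' s' \<and>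
     (\<forall>y\<in>{a..<z}. y < z' \<longrightarrow> \<bar>x' y - x y\<bar> < \<epsilon> \<and> \<bar>s' y - s y\<bar> < \<epsilon>))"
    using leftsol_dependence[OF z23 l \<epsilon>(1)] by blast
  have "falls_below z'" if z': "z' \<in> {2<..<3}" and zz: "\<bar>z' - z\<bar> < min \<eta> (k / 2)" for z'
  proof -
    have z'23: "z' \<in> {2..3}" using z' by auto
    obtain x' s' where x': "leftsol z' a x' s'" "\<And>y. y \<in> {a..<z} \<Longrightarrow> y < z' \<Longrightarrow> \<bar>x' y - x y\<bar> < \<epsilon> \<and> \<bar>s' y - s y\<bar> < \<epsilon>"
      using \<eta>(2)[OF z'23] zz by auto
    have az': "a < z'" using x'(1) by (simp add: leftsol_def)
    have "x' y < s' y \<and> 2 * x' y < y" if y: "y \<in> {a..<z'}" for y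
    proof (cases "y \<le> z - k / 2")
      case True
      then show ?thesis using x'(2)[of y] m1(2)[of y] m2(2)[of y] y k \<epsilon> by (auto simp: abs_less_iff)
    next
      case False
      have zk: "\<bar>z' - z\<bar> < k / 2" using zz by simp
      then have yk: "z' - k < y" using False by linarith
      then have "y \<in> {z' - \<delta><..<z' + \<delta>}" using y k d \<delta> by auto
      then have "x' y = X z' y" "s' y = S z' y" using x'(1) unfolding leftsol_def by auto
      moreover have "z' - y < z' - 2" "z' - d < y" using yk zk k by linarith+
      ultimately show ?thesis using near_sonic_left(1,4)[OF z'23, of y] y by simp
    qed
    moreover have "3 * x' a < a" using x'(2)[of a] az az' \<epsilon> by (auto simp: abs_less_iff)
    ultimately show ?thesis unfolding falls_below_def using x'(1) by blast
  qed
  then show ?thesis using \<eta> k by (intro exI[of _ "min \<eta> (k / 2)"]) auto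
qed

lemma rises_above_open:
  assumes z: "z \<in> {2<..<3}" and ra: "rises_above z"
  shows "\<exists>\<eta>>0. \<forall>z'\<in>{2<..<3}. \<bar>z' - z\<bar> < \<eta> \<longrightarrow> rises_above z'"
proof -
  obtain a x s where l: "leftsol z a x s" and pos: "\<And>y. y \<in> {a..<z} \<Longrightarrow> y < 3 * x y" and neg: "s a < x a \<or> a < 2 * x a"
    using ra unfolding rises_above_def by blast
  have az: "a < z" using l by (simp add: leftsol_def)
  have z': "2 < z" "z < 3" using z by auto
  define k where "k = min d ((3 - z) / 4)"
  have "0 < k" "k \<le> d" using d(1) z' by (simp_all add: k_def)
  moreover have "k \<le> (3 - z) / 4" unfolding k_def by (rule min.cobounded2)
  ultimately have k: "0 < k" "k \<le> d" "4 * k \<le> 3 - z" by simp_all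
  have kz: "z - k / 2 < z" using k by simp
  note c = leftsol_continuous[OF l kz]
  obtain m1 where m1: "m1 > 0" "\<And>y. y \<in> {a..z - k / 2} \<Longrightarrow> m1 \<le> 3 * x y - y"
    by (rule positive_on_compact[of a "z - k / 2" "\<lambda>y. 3 * x y - y"]) (use pos k in \<open>auto intro!: continuous_intros c\<close>)
  define n where "n = max (x a - s a) (2 * x a - a)"
  have n: "n > 0" using neg by (auto simp: n_def)
  define \<epsilon> where "\<epsilon> = min (m1 / 3) (n / 2)"
  have \<epsilon>: "\<epsilon> > 0" "3 * \<epsilon> \<le> m1" "2 * \<epsilon> \<le> n" using m1 n by (auto simp: \<epsilon>_def)
  have z23: "z \<in> {2..3}" using z by auto
  obtain \<eta> where \<eta>: "\<eta> > 0" "\<And>z'. z' \<in> {2..3} \<Longrightarrow> \<bar>z' - z\<bar> < \<eta> \<Longrightarrow> (\<exists>x' s'. leftsol z' a x' s' \<and>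
     (\<forall>y\<in>{a..<z}. y < z' \<longrightarrow> \<bar>x' y - x y\<bar> < \<epsilon> \<and> \<bar>s' y - s y\<bar> < \<epsilon>))"
    using leftsol_dependence[OF z23 l \<epsilon>(1)] by blast
  have "rises_above z'" if z': "z' \<in> {2<..<3}" and zz: "\<bar>z' - z\<bar> < min \<eta> (k / 2)" for z'
  proof -
    have z'23: "z' \<in> {2..3}" using z' by auto
    obtain x' s' where x': "leftsol z' a x' s'" "\<And>y. y \<in> {a..<z} \<Longrightarrow> y < z' \<Longrightarrow> \<bar>x' y - x y\<bar> < \<epsilon> \<and> \<bar>s' y - s y\<bar> < \<epsilon>"
      using \<eta>(2)[OF z'23] zz by auto
    have az': "a < z'" using x'(1) by (simp add: leftsol_def)
    have "y < 3 * x' y" if y: "y \<in> {a..<z'}" for y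
    proof (cases "y \<le> z - k / 2")
      case True
      then show ?thesis using x'(2)[of y] m1(2)[of y] y k \<epsilon> by (auto simp: abs_less_iff)
    next
      case False
      have zk: "\<bar>z' - z\<bar> < k / 2" using zz by simp
      then have yk: "z' - k < y" using False by linarith
      then have "y \<in> {z' - \<delta><..<z' + \<delta>}" using y k d \<delta> by auto
      then have "x' y = X z' y" using x'(1) unfolding leftsol_def by auto
      moreover have "2 * z' - 2 * y < 3 - z'" "z' - d < y" using yk zk k by linarith+
      ultimately show ?thesis using near_sonic_left(5)[OF z'23, of y] y by simp
    qed
    moreover have "s' a < x' a \<or> a < 2 * x' a"
      using x'(2)[of a] az az' \<epsilon> by (auto simp: abs_less_iff n_def max_def split: if_splits)
    ultimately show ?thesis unfolding rises_above_def using x'(1) by blast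
  qed
  then show ?thesis using \<eta> k by (intro exI[of _ "min \<eta> (k / 2)"]) auto
qed

text \<open>
  For \<open>z = 3\<close> the germ has \<open>x = 1 - 2/3 \<tau> + O(\<tau>\<^sup>2)\<close> at \<open>y = 3 - \<tau>\<close>, below \<open>y/3 = 1 - 1/3 \<tau>\<close>. The parameter is
  taken so close to \<open>3\<close> that this is preserved.
\<close>

lemma falls_below_near_3: "\<exists>z\<in>{2<..<3}. falls_below z"
proof -
  define \<tau> where "\<tau> = d / 2"
  have \<tau>: "0 < \<tau>" "\<tau> < d" "\<tau> \<le> 1 / 16" using d \<delta> by (auto simp: \<tau>_def)
  define z where "z = 3 - \<tau> / (12 * M)"
  have zz: "M * (3 - z) = \<tau> / 12" "z < 3" "3 - z \<le> \<tau> / 12"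
  proof -
    show "M * (3 - z) = \<tau> / 12" "z < 3" using M \<tau> by (auto simp: z_def)
    have "1 * (3 - z) \<le> M * (3 - z)" using M \<open>z < 3\<close> by (intro mult_right_mono) auto
    then show "3 - z \<le> \<tau> / 12" using \<open>M * (3 - z) = \<tau> / 12\<close> by simp
  qed
  define a where "a = 3 - \<tau>"
  have z: "z \<in> {2..3}" using zz \<tau> by auto
  have a: "z - d < a" "a < z" using zz \<tau> by (auto simp: a_def)
  have a3: "\<bar>a - 3\<bar> < d" using \<tau> by (simp add: a_def)
  have "\<bar>X 3 a - (1 - 2 / 3 * \<tau>)\<bar> \<le> (1 + M) * \<tau>\<^sup>2" "60 * ((1 + M) * \<tau>\<^sup>2) \<le> \<tau>"
    using near_sonic(1,4)[OF _ a3] \<tau> by (auto simp: a_def)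
  moreover have "\<bar>X z a - X 3 a\<bar> \<le> \<tau> / 12"
    using germ_lipschitz[OF z, of 3 a] a a3 zz d by auto
  ultimately have neg: "3 * X z a < a" using \<tau> unfolding abs_le_iff a_def by linarith
  have "X z y < S z y \<and> 2 * X z y < y" if y: "y \<in> {a..<z}" for y
    using near_sonic_left(1,4)[OF z, of y] y a zz \<tau> by (auto simp: a_def)
  moreover have "leftsol z a (X z) (S z)" by (rule germ_leftsol[OF z]) (use a d in auto)
  ultimately have "falls_below z" unfolding falls_below_def using neg by blast
  then show ?thesis using zz \<tau> by (intro bexI[of _ z]) auto
qed

text \<open>
  For \<open>z = 2\<close> the germ is tangent to \<open>x = y/2\<close>, so the second-order coefficient decides: \<open>bend0 2 = 1/8 > 0\<close>
  puts \<open>x\<close> above \<open>y/2\<close> by about \<open>\<tau>\<^sup>2 / 8\<close> at \<open>y = 2 - \<tau>\<close>. This is why the quadratic term of \<open>x\<close> must be known,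
  and why \<open>z - 2\<close> has to be of the order \<open>\<tau>\<^sup>2\<close>.
\<close>

lemma rises_above_near_2: "\<exists>z\<in>{2<..<3}. rises_above z"
proof -
  define \<tau> where "\<tau> = d / 2"
  have \<tau>: "0 < \<tau>" "\<tau> < d" "\<tau> \<le> 1 / 16" using d \<delta> by (auto simp: \<tau>_def)
  define z where "z = 2 + \<tau>\<^sup>2 / (16 * M)"
  have zz: "M * (z - 2) = \<tau>\<^sup>2 / 16" "2 < z" "z - 2 \<le> 1 / 16"
  proof -
    show "M * (z - 2) = \<tau>\<^sup>2 / 16" "2 < z" using M \<tau> by (auto simp: z_def)
    have "1 * (z - 2) \<le> M * (z - 2)" using M \<open>2 < z\<close> by (intro mult_right_mono) auto
    moreover have "\<tau>\<^sup>2 \<le> 1" using \<tau> by (simp add: abs_square_le_1)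
    ultimately show "z - 2 \<le> 1 / 16" using \<open>M * (z - 2) = \<tau>\<^sup>2 / 16\<close> by simp
  qed
  define a where "a = 2 - \<tau>"
  have z: "z \<in> {2..3}" using zz by auto
  have z2: "z - 2 \<le> \<tau> / 16"
  proof -
    have "1 * (z - 2) \<le> M * (z - 2)" using M zz by (intro mult_right_mono) auto
    moreover have "\<tau> * \<tau> \<le> \<tau> * 1" using \<tau> by (intro mult_left_mono) auto
    ultimately show ?thesis using zz by (simp add: power2_eq_square)
  qed
  have a: "z - d < a" "a < z" using zz z2 \<tau> by (auto simp: a_def \<tau>_def)
  have a2: "\<bar>a - 2\<bar> < \<delta>" using \<tau> d by (simp add: a_def)
  have b2: "bend0 2 = 1 / 8" by (simp add: bend0_def)
  have "\<bar>X 2 a - (1 - \<tau> / 2 + 1 / 8 * \<tau>\<^sup>2)\<bar> \<le> M * \<tau> ^ 3"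
    using germ_X[OF _ a2] \<tau> by (simp add: a_def b2)
  moreover have "M * \<tau> ^ 3 \<le> 1 / 60 * \<tau>\<^sup>2"
  proof -
    have "60 * (1 + M) * \<tau> \<le> 60 * (1 + M) * d" using \<tau> M by (intro mult_left_mono) auto
    then have "60 * (M * \<tau>) \<le> 1" using d \<tau> by (simp add: algebra_simps)
    then have "M * \<tau> \<le> 1 / 60" by simp
    then have "(M * \<tau>) * \<tau>\<^sup>2 \<le> 1 / 60 * \<tau>\<^sup>2" by (intro mult_right_mono) auto
    then show ?thesis by (simp add: power3_eq_cube power2_eq_square mult.assoc)
  qed
  moreover have "\<bar>X z a - X 2 a\<bar> \<le> \<tau>\<^sup>2 / 16"
    using germ_lipschitz[OF z, of 2 a] a a2 zz d by auto
  moreover have "\<tau>\<^sup>2 > 0" using \<tau> by simp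
  ultimately have neg: "a < 2 * X z a" unfolding abs_le_iff a_def by linarith
  have "y < 3 * X z y" if y: "y \<in> {a..<z}" for y
    using near_sonic_left(5)[OF z, of y] y a zz \<tau> by (auto simp: a_def)
  moreover have "leftsol z a (X z) (S z)" by (rule germ_leftsol[OF z]) (use a d in auto)
  ultimately have "rises_above z" unfolding rises_above_def using neg by blast
  then show ?thesis using zz by (intro bexI[of _ z]) auto
qed

text \<open>
  The connected interval \<open>(2,3)\<close> is not the union of two disjoint nonempty open sets.
\<close>

lemma critical_parameter: "\<exists>z\<in>{2<..<3}. \<not> falls_below z \<and> \<not> rises_above z"
proof (rule ccontr)
  assume no: "\<not> ?thesis"
  define A B where "A = {z\<in>{2<..<3}. falls_below z}" and "B = {z\<in>{2<..<3}. rises_above z}"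
  have op: "open {z\<in>{2<..<3::real}. P z}" if P: "\<And>z. z \<in> {2<..<3} \<Longrightarrow> P z \<Longrightarrow> \<exists>\<eta>>0. \<forall>z'\<in>{2<..<3}. \<bar>z' - z\<bar> < \<eta> \<longrightarrow> P z'" for P
    unfolding open_dist
  proof (intro ballI)
    fix z assume z: "z \<in> {z\<in>{2<..<3}. P z}"
    then obtain \<eta> where \<eta>: "\<eta> > 0" "\<forall>z'\<in>{2<..<3}. \<bar>z' - z\<bar> < \<eta> \<longrightarrow> P z'" using P by blast
    show "\<exists>e>0. \<forall>y. dist y z < e \<longrightarrow> y \<in> {z \<in> {2<..<3}. P z}"
      using \<eta> z by (intro exI[of _ "min \<eta> (min (z - 2) (3 - z))"]) (auto simp: dist_real_def abs_less_iff)
  qed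
  have o: "open A" "open B" unfolding A_def B_def
    by (rule op, rule falls_below_open, assumption+) (rule op, rule rises_above_open, assumption+)
  have "A \<inter> {2<..<3} = {} \<or> B \<inter> {2<..<3} = {}"
    by (rule connectedD[OF connected_Ioo o]) (use not_both no in \<open>auto simp: A_def B_def\<close>)
  then show False using falls_below_near_3 rises_above_near_2 unfolding A_def B_def by blast
qed

end

section \<open>Invariant regions on both sides of the sonic point\<close>

text \<open>
  A transversal zero of \<open>\<phi>\<close> is prolonged to a point where \<open>\<phi>\<close> is negative, while a condition \<open>\<psi> > 0\<close>
  persists. This produces the end point \<open>a\<close> of \<open>falls_below\<close> and \<open>rises_above\<close>.
\<close>

lemma crossing_to_the_left:
  fixes \<phi> \<psi> :: "real \<Rightarrow> real"
  assumes d: "(\<phi> has_real_derivative l) (at w)" "l > 0" "\<phi> w = 0" and c: "isCont \<psi> w" "\<psi> w > 0" and lo: "lo < w"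
  shows "\<exists>a. lo < a \<and> a < w \<and> \<phi> a < 0 \<and> (\<forall>y\<in>{a..w}. \<psi> y > 0)"
proof -
  obtain d1 where d1: "d1 > 0" "\<And>h. 0 < h \<Longrightarrow> h < d1 \<Longrightarrow> \<phi> (w - h) < \<phi> w"
    using DERIV_pos_inc_left[OF d(1,2)] by blast
  obtain d2 where d2: "d2 > 0" "\<forall>y\<in>{w - d2..w}. \<psi> y > 0" using eventually_left_pos[OF c] by blast
  define h where "h = min (d1 / 2) (min d2 ((w - lo) / 2))"
  have h: "0 < h" "h < d1" "h \<le> d2" "h < w - lo" using d1 d2 lo by (auto simp: h_def min_def field_simps)
  show ?thesis using d1(2)[OF h(1,2)] d2 h d(3) by (intro exI[of _ "w - h"]) auto
qed

text \<open>
  Monotonicity of \<open>x\<close> keeps the solution away from the sonic line \<open>x = 1\<close>, here and on the other side.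
\<close>

lemma xdot_pos_inside:
  assumes x: "0 < x" "x < (1::real)" "x \<le> s" and y: "2 * x < y"
  shows "xdot y x s > 0"
proof -
  have D: "1 - x\<^sup>2 > 0" using x by (simp add: abs_square_less_1)
  have "x * x \<le> x * s" using x by (intro mult_left_mono) auto
  then have "2 * x * (1 - x * s) \<le> 2 * x * (1 - x\<^sup>2)" using x by (intro mult_left_mono) (auto simp: power2_eq_square)
  also have "\<dots> < y * (1 - x\<^sup>2)" using y D by (intro mult_strict_right_mono) auto
  finally have "2 * x * (1 - x * s) / (y * (1 - x\<^sup>2)) < 1" using x y D by simp
  then show ?thesis by (simp add: xdot_def)
qed

lemma xdot_pos_outside:
  assumes x: "(1::real) < x" "x \<le> y" "s \<le> 1"
  shows "xdot y x s > 0"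
proof -
  have D: "x\<^sup>2 - 1 > 0" using x by (simp add: power2_eq_square less_1_mult)
  have "x * s - 1 \<le> x - 1" using x by (simp add: mult_left_le)
  then have "2 * x * (x * s - 1) \<le> 2 * x * (x - 1)" using x by (intro mult_left_mono) auto
  also have "\<dots> < (x + 1) * x * (x - 1)" using x by (intro mult_strict_right_mono) auto
  also have "\<dots> = x * (x\<^sup>2 - 1)" by (simp add: power2_eq_square algebra_simps)
  also have "\<dots> \<le> y * (x\<^sup>2 - 1)" using x D by (intro mult_right_mono) auto
  finally have "2 * x * (x * s - 1) / (y * (x\<^sup>2 - 1)) < 1" using x D by simp
  moreover have "2 * x * (x * s - 1) / (y * (x\<^sup>2 - 1)) = 2 * x * (1 - x * s) / (y * (1 - x\<^sup>2))"
  proof -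
    have "2 * x * (1 - x * s) = - (2 * x * (x * s - 1))" "y * (1 - x\<^sup>2) = - (y * (x\<^sup>2 - 1))"
      by (simp_all add: algebra_simps)
    then show ?thesis by (simp only: minus_divide_divide)
  qed
  ultimately show ?thesis by (simp add: xdot_def)
qed

text \<open>
  The factor \<open>1 - x\<^sup>2\<close> cancels, so \<open>x s\<close> is monotone as long as \<open>x \<le> y\<close>, on both sides of the sonic line.
\<close>

lemma product_identity:
  assumes "y \<noteq> 0" "x\<^sup>2 \<noteq> (1::real)"
  shows "xdot y x s * s + sdot y x s * x = s * (1 - x / y)"
proof -
  have "1 - x\<^sup>2 \<noteq> 0" using assms by simp
  then show ?thesis unfolding xdot_def sdot_def using assms(1)
    by (simp add: divide_simps) (simp add: power2_eq_square algebra_simps)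
qed

lemma sdot_neg_at_1:
  assumes "y > 0" "x > (1::real)" shows "sdot y x 1 < 0"
proof -
  have D: "1 - x\<^sup>2 < 0" using assms by (simp add: power2_eq_square less_1_mult)
  then have "sdot y x 1 = (1 - x)\<^sup>2 / (y * (1 - x\<^sup>2))" by (intro sdot_at_1) auto
  also have "\<dots> < 0" using assms D by (intro divide_pos_neg mult_pos_neg) auto
  finally show ?thesis .
qed

lemma sdot_pos_at_1:
  assumes "y > 0" "0 < x" "x < (1::real)" shows "sdot y x 1 > 0"
proof -
  have D: "1 - x\<^sup>2 > 0" using assms by (simp add: abs_square_less_1)
  then have "sdot y x 1 = (1 - x)\<^sup>2 / (y * (1 - x\<^sup>2))" by (intro sdot_at_1) auto
  also have "\<dots> > 0" using assms D by (intro divide_pos_pos mult_pos_pos) auto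
  finally show ?thesis .
qed

context sonic_germ
begin

lemma near_sonic_right:
  assumes z: "z \<in> {2..3}" and y: "z < y" "y < z + d"
  shows "1 < X z y" "S z y < 1" "1 < X z y * S z y" "X z y < y" "y < 3 * X z y"
proof -
  define T Q P where "T = y - z" and "Q = (1 + M) * (y - z)\<^sup>2" and "P = (1 - 1 / z) * T"
  have yT: "y = z + T" and T: "0 < T" "T < d" using y by (auto simp: T_def)
  have ya: "\<bar>y - z\<bar> < d" using T by (simp add: T_def)
  note n = near_sonic[OF z ya, folded Q_def]
  note g = slope0_bounds[OF z, unfolded slope0_def]
  have sq: "60 * Q \<le> T" using n(4) T by (simp add: T_def)
  have P: "1 / 2 * T \<le> P" "P \<le> 2 / 3 * T"
    unfolding P_def by (rule mult_right_mono; use g T in linarith)+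
  have e: "(1 - 1 / z) * (y - z) = P" unfolding P_def T_def ..
  have n1: "X z y \<le> 1 + P + Q" "1 + P - Q \<le> X z y"
    using n(1) unfolding e by (auto simp only: abs_le_iff)
  have n2: "1 - Q \<le> S z y" using n(2) by (auto simp only: abs_le_iff)
  have T8: "T \<le> 1 / 8" using T d \<delta> by linarith
  have Q0: "0 \<le> Q" using M by (simp add: Q_def)
  show "S z y < 1" using n(3) y by simp
  show x1: "1 < X z y" using n1 P sq T by linarith
  have z2: "2 \<le> z" "z \<le> 3" using z by auto
  show "X z y < y" using n1 P sq T T8 yT z2 by linarith
  show "y < 3 * X z y" using n1 P sq T T8 yT z2 by linarith
  have "X z y * Q \<le> 2 * Q" using n1 P sq T T8 Q0 by (intro mult_right_mono) linarith+
  then have "1 < X z y * (1 - Q)" using n1 P sq T by (simp add: right_diff_distrib)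
  also have "\<dots> \<le> X z y * S z y" using n2 x1 by (intro mult_left_mono) auto
  finally show "1 < X z y * S z y" .
qed

text \<open>
  Let \<open>w\<close> be the last point to the left of \<open>z\<close> at which one of the four strict inequalities fails. At \<open>w\<close> the
  solution sits on a wall, coming from the region on the right. The case \<open>s = 1\<close> is impossible because
  \<open>s' > 0\<close> there. Contact with \<open>3 x = y\<close> only would be a transversal crossing and give \<open>falls_below\<close>; contact
  with \<open>s = x\<close> or \<open>2 x = y\<close> above the Friedmann line would give \<open>rises_above\<close>. In the corner \<open>3 x = y\<close>,
  \<open>s = x\<close> the solution would coincide with the Friedmann solution, which is not in the region.
\<close>

lemma left_invariant:
  assumes z: "z \<in> {2<..<3}" and no: "\<not> falls_below z" "\<not> rises_above z" and l: "leftsol z a x s"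
    and y0: "y0 \<in> {a..<z}"
  shows "y0 < 3 * x y0 \<and> 2 * x y0 < y0 \<and> x y0 < s y0 \<and> s y0 < 1"
proof (rule ccontr)
  assume bad: "\<not> ?thesis"
  have z23: "z \<in> {2..3}" using z by auto
  obtain lo where f: "lo < a" "flow_on {lo<..<z} x s" and "a < z"
    and ge: "\<And>y. y \<in> {z - \<delta><..<z + \<delta>} \<Longrightarrow> x y = X z y \<and> s y = S z y"
    using l unfolding leftsol_def by blast
  define k where "k = min d (min (z - 2) ((3 - z) / 2))"
  have k: "0 < k" "k \<le> d" "k \<le> z - 2" "k \<le> (3 - z) / 2"
  proof -
    show "0 < k" using d z by (simp add: k_def)
    show "k \<le> d" "k \<le> z - 2" "k \<le> (3 - z) / 2"
      unfolding k_def by (rule min.cobounded1 min.coboundedI2[OF min.cobounded1] min.coboundedI2[OF min.cobounded2])+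
  qed
  have near: "y < 3 * x y \<and> 2 * x y < y \<and> x y < s y \<and> s y < 1" if y: "z - k < y" "y < z" for y
  proof -
    have "x y = X z y" "s y = S z y" using ge[of y] y k d \<delta> by auto
    moreover have "z - d < y" "0 < (z - 2) - (z - y)" using y k by linarith+
    moreover have "2 * k \<le> 3 - z" using k(4) by simp
    then have "0 < (3 - z) - 2 * (z - y)" using y by argo
    ultimately show ?thesis using near_sonic_left[OF z23, of y] y by auto
  qed
  define y1 where "y1 = z - k / 2"
  have y1: "z - k < y1" "y1 < z" using k by (auto simp: y1_def)
  have y0k: "y0 \<le> z - k" using near[of y0] bad y0 by force
  define \<phi> where "\<phi> y = min (min (3 * x y - y) (s y - x y)) (min (y - 2 * x y) (1 - s y))" for y
  have \<phi>_pos: "\<phi> y > 0 \<longleftrightarrow> y < 3 * x y \<and> 2 * x y < y \<and> x y < s y \<and> s y < 1" for y by (auto simp: \<phi>_def)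
  have fI: "flow_on {a..y1} x s" by (rule flow_on_subset[OF f(2)]) (use f y1 in auto)
  have "continuous_on {a..y1} \<phi>" unfolding \<phi>_def by (intro continuous_intros flow_on_continuous[OF fI])
  moreover have "\<phi> y1 > 0" using near[OF y1] \<phi>_pos by simp
  moreover have "y0 \<in> {a..y1}" "\<phi> y0 \<le> 0" using y0 y0k y1 bad \<phi>_pos[of y0] by auto
  ultimately obtain w where w: "w \<in> {a..<y1}" "\<phi> w = 0" "\<And>y. y \<in> {w<..y1} \<Longrightarrow> \<phi> y > 0"
    using last_zero_before[of a y1 \<phi> y0] by blast
  have after: "y < 3 * x y \<and> 2 * x y < y \<and> x y < s y \<and> s y < 1" if "w < y" "y < z" for y
    using near[of y] w(3)[of y] \<phi>_pos[of y] that y1 by (cases "y \<le> y1") auto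
  have wlo: "lo < w" "w < z" using w f y1 by auto
  note D = flow_onD[OF f(2), of w]
  have w0: "w > 0" and xn: "(x w)\<^sup>2 \<noteq> 1" and dx: "(x has_real_derivative xdot w (x w) (s w)) (at w)"
    and ds: "(s has_real_derivative sdot w (x w) (s w)) (at w)" and cx: "isCont x w" and cs: "isCont s w"
    using D wlo by auto
  have ge0: "w \<le> 3 * x w" "2 * x w \<le> w" "x w \<le> s w" "s w \<le> 1" using w(2) by (auto simp: \<phi>_def min_def split: if_splits)
  have xw: "0 < x w" "x w < 1"
  proof -
    show "0 < x w" using ge0 w0 by linarith
    have "x w \<noteq> 1" using xn by auto
    then show "x w < 1" using ge0 by linarith
  qed
  have D0: "1 - (x w)\<^sup>2 > 0" using xw by (simp add: abs_square_less_1)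
  have s1: "s w < 1"
  proof (rule ccontr)
    assume "\<not> s w < 1"
    then have sw: "s w = 1" using ge0 by simp
    have "sdot w (x w) (s w) > 0" unfolding sw using sdot_pos_at_1 w0 xw by blast
    from DERIV_pos_inc_right[OF ds this] obtain e where e: "e > 0" "\<And>h. 0 < h \<Longrightarrow> h < e \<Longrightarrow> s w < s (w + h)" by blast
    define h where "h = min (e / 2) ((z - w) / 2)"
    have h: "0 < h" "h < e" "w + h < z" using e wlo by (auto simp: h_def min_def field_simps)
    show False using e(2)[OF h(1,2)] after[of "w + h"] h sw by auto
  qed
  have df: "((\<lambda>y. 3 * x y - y) has_real_derivative 3 * xdot w (x w) (s w) - 1) (at w)"
    by (auto intro!: derivative_eq_intros dx)
  have de: "((\<lambda>y. s y - x y) has_real_derivative sdot w (x w) (s w) - xdot w (x w) (s w)) (at w)"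
    by (auto intro!: derivative_eq_intros dx ds)
  have dh: "((\<lambda>y. y - 2 * x y) has_real_derivative 1 - 2 * xdot w (x w) (s w)) (at w)"
    by (auto intro!: derivative_eq_intros dx)
  \<comment> \<open>The same pair \<open>x\<close>, \<open>s\<close> is a continuation to any point of its interval of existence.\<close>
  have ls: "leftsol z b x s" if "lo < b" "b < z" for b using l f(2) that unfolding leftsol_def by blast
  consider (both) "3 * x w = w" "s w = x w" | (fall) "3 * x w = w" "x w < s w"
    | (gap) "w < 3 * x w" "s w = x w" | (top) "w < 3 * x w" "2 * x w = w"
  proof -
    have "3 * x w = w \<or> s w = x w \<or> 2 * x w = w"
      using w(2) s1 by (auto simp: \<phi>_def min_def split: if_splits)
    with ge0 that show ?thesis by (metis order_le_less)
  qed
  then show False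
  proof cases
    case both
    have "flow_on {w..y1} x s" by (rule flow_on_subset[OF f(2)]) (use wlo y1 in auto)
    moreover have "flow_on {w..y1} (\<lambda>y. y / 3) (\<lambda>y. y / 3)" by (rule friedmann_flow) (use w0 y1 z in auto)
    ultimately have "x y1 = y1 / 3"
      using flow_unique[of "{w..y1}" x s "\<lambda>y. y / 3" "\<lambda>y. y / 3" w y1] both w by (auto simp: is_interval_cc)
    then show False using near[OF y1] by simp
  next
    case fall
    have "3 * xdot w (x w) (s w) - 1 = (6 * (x w)\<^sup>2 * (s w - x w) / (1 - (x w)\<^sup>2)) / w"
      using slope_identity[of w "x w" "s w"] w0 xn fall by simp
    also have "\<dots> > 0" using fall xw D0 w0 by (intro divide_pos_pos mult_pos_pos) auto
    finally have "3 * xdot w (x w) (s w) - 1 > 0" .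
    moreover have "isCont (\<lambda>y. min (s y - x y) (y - 2 * x y)) w"
      by (intro continuous_min continuous_intros cx cs)
    ultimately have "\<exists>b. lo < b \<and> b < w \<and> 3 * x b - b < 0 \<and> (\<forall>y\<in>{b..w}. min (s y - x y) (y - 2 * x y) > 0)"
      using fall w0 wlo by (intro crossing_to_the_left[OF df]) auto
    then obtain b where b: "lo < b" "b < w" "3 * x b - b < 0" "\<forall>y\<in>{b..w}. min (s y - x y) (y - 2 * x y) > 0"
      by blast
    have "x y < s y \<and> 2 * x y < y" if "y \<in> {b..<z}" for y
      using b(4) after[of y] that by (cases "y \<le> w") auto
    then have "falls_below z" unfolding falls_below_def using ls[of b] b wlo by (intro exI[of _ b] exI[of _ x] exI[of _ s]) auto
    then show False using no by simp
  next
    case gap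
    have "sdot w (x w) (s w) - xdot w (x w) (s w) = (3 * x w - w) / w"
      using gap_identity[of w "x w" "s w"] w0 xn gap by simp
    also have "\<dots> > 0" using gap w0 by simp
    finally have "sdot w (x w) (s w) - xdot w (x w) (s w) > 0" .
    from crossing_to_the_left[OF de this, of "\<lambda>y. 3 * x y - y" lo]
    obtain b where b: "lo < b" "b < w" "s b - x b < 0" "\<forall>y\<in>{b..w}. 3 * x y - y > 0"
      using gap wlo cx by (auto intro!: continuous_intros)
    have "y < 3 * x y" if "y \<in> {b..<z}" for y using b(4) after[of y] that by (cases "y \<le> w") auto
    then have "rises_above z" unfolding rises_above_def using ls[of b] b wlo by (intro exI[of _ b] exI[of _ x] exI[of _ s]) auto
    then show False using no by simp
  next
    case top
    have "1 - 2 * xdot w (x w) (s w) = (1 + (x w)\<^sup>2 - 2 * x w * s w) / (1 - (x w)\<^sup>2)"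
      using half_identity[of "x w" "s w"] xw xn top by simp
    moreover have "1 + (x w)\<^sup>2 - 2 * x w * s w > 0"
    proof -
      have "x w * s w < x w * 1" using xw s1 by (intro mult_strict_left_mono) auto
      moreover have "0 \<le> (1 - x w)\<^sup>2" by simp
      ultimately show ?thesis by (simp add: power2_eq_square algebra_simps)
    qed
    ultimately have "1 - 2 * xdot w (x w) (s w) > 0" using D0 by simp
    from crossing_to_the_left[OF dh this, of "\<lambda>y. 3 * x y - y" lo]
    obtain b where b: "lo < b" "b < w" "b - 2 * x b < 0" "\<forall>y\<in>{b..w}. 3 * x y - y > 0"
      using top wlo cx by (auto intro!: continuous_intros)
    have "y < 3 * x y" if "y \<in> {b..<z}" for y using b(4) after[of y] that by (cases "y \<le> w") auto
    then have "rises_above z" unfolding rises_above_def using ls[of b] b wlo by (intro exI[of _ b] exI[of _ x] exI[of _ s]) auto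
    then show False using no by simp
  qed
qed

text \<open>
  By \<open>left_invariant\<close> every continuation stays in the region, where \<open>x\<close> increases with \<open>y\<close>. Hence
  \<open>x \<le> x(y\<^sub>1) < 1\<close> to the left of \<open>y\<^sub>1\<close>, which is the a priori bound for \<open>flow_continuation\<close> down to any
  \<open>a > 0\<close>.
\<close>

theorem left_solution:
  assumes z: "z \<in> {2<..<3}" and no: "\<not> falls_below z" "\<not> rises_above z"
  shows "\<exists>x s. flow_on {0<..<z} x s \<and> (\<forall>y\<in>{z - d<..<z}. x y = X z y \<and> s y = S z y) \<and>
    (\<forall>y\<in>{0<..<z}. y < 3 * x y \<and> 2 * x y < y \<and> x y < s y \<and> s y < 1)"
proof -
  have z23: "z \<in> {2..3}" using z by auto
  define y1 where "y1 = z - d / 2"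
  have y1: "z - d < y1" "y1 < z" "0 < y1" "z - \<delta> < y1" using d \<delta> z by (auto simp: y1_def)
  have gflow: "flow_on {z - \<delta><..<z} (X z) (S z)" by (rule flow_on_subset[OF germ_flow[OF z23]]) (use \<delta> in auto)
  have x1: "0 < X z y1" "X z y1 < 1" using near_sonic_left[OF z23 y1(1,2)] by auto
  have region: "y < 3 * x y \<and> 2 * x y < y \<and> x y < s y \<and> s y < 1"
    if f: "flow_on {lo<..<hi} x s" "x y1 = X z y1" "s y1 = S z y1" "{b..y1} \<subseteq> {lo<..<hi}" "b \<le> y1" and y: "y \<in> {b..y1}"
    for lo hi x s b y
  proof -
    have p: "y1 \<in> {lo<..<hi}" "lo < b" using f by auto
    obtain x' s' where l: "leftsol z b x' s'" "\<forall>y\<in>{lo<..<hi}. y < z \<longrightarrow> x' y = x y \<and> s' y = s y"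
      using extend_to_leftsol[OF z23 f(1) p(1) y1(4,2) f(2,3) p(2) f(5)] by blast
    have "y \<in> {b..<z}" "y \<in> {lo<..<hi}" using y y1 f(4) by auto
    then show ?thesis using left_invariant[OF z no l(1), of y] l(2) by auto
  qed
  have ex: "\<exists>lo hi x s. flow_on {lo<..<hi} x s \<and> closed_segment y1 a \<subseteq> {lo<..<hi} \<and> x y1 = X z y1 \<and> s y1 = S z y1"
    if a: "a \<in> {0<..<z}" for a
  proof (cases "y1 \<le> a")
    case True
    then have "closed_segment y1 a \<subseteq> {z - \<delta><..<z}" using a y1 by (auto simp: closed_segment_eq_real_ivl)
    then show ?thesis using gflow by blast
  next
    case False
    define m where "m = min a (1 - (X z y1)\<^sup>2)"
    have m: "m > 0" using a x1 by (simp add: m_def abs_square_less_1)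
    show ?thesis
    proof (rule flow_continuation[OF m, of 3])
      fix lo hi x s b
      assume f: "flow_on {lo<..<hi} x s" "x y1 = X z y1" "s y1 = S z y1" and b: "b \<in> closed_segment y1 a"
        and sub: "closed_segment y1 b \<subseteq> {lo<..<hi}"
      have b': "a \<le> b" "b \<le> y1" using b False by (auto simp: closed_segment_eq_real_ivl)
      have sub': "{b..y1} \<subseteq> {lo<..<hi}" using sub b' by (auto simp: closed_segment_eq_real_ivl)
      note R = region[OF f sub' b'(2)]
      have x01: "0 < x y \<and> x y < 1" if "y \<in> {b..y1}" for y using R[OF that] that b' a by auto
      have "x b \<le> x y1"
      proof (rule DERIV_nonneg_imp_nondecreasing[OF b'(2)])
        fix y assume y: "b \<le> y" "y \<le> y1"
        then have "(x has_real_derivative xdot y (x y) (s y)) (at y)" using flow_onD(3)[OF f(1)] sub' by auto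
        moreover have "xdot y (x y) (s y) > 0" using R[of y] x01[of y] y by (intro xdot_pos_inside) auto
        ultimately show "\<exists>D. (x has_real_derivative D) (at y) \<and> 0 \<le> D" using less_imp_le by blast
      qed
      then have "(x b)\<^sup>2 \<le> (X z y1)\<^sup>2" using x01[of b] b' f(2) by (intro power_mono) auto
      moreover have "(X z y1)\<^sup>2 < 1" using x1 by (simp add: abs_square_less_1)
      ultimately have "m \<le> norm (1 - (x b)\<^sup>2)" by (auto simp: m_def min_le_iff_disj)
      moreover have "m \<le> norm b" using b' a by (simp add: m_def)
      ultimately show "(b, x b, s b) \<in> regular_box m 3"
        using R[of b] x01[of b] b' a z y1 by (auto simp: regular_box_def)
    next
      have "m \<le> norm (1 - (X z y1)\<^sup>2)" by (simp add: m_def)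
      moreover have "m \<le> norm y1" using False y1 by (simp add: m_def)
      ultimately show "(y1, X z y1, S z y1) \<in> regular_box m 3"
        using near_sonic_left[OF z23 y1(1,2)] y1 z x1 by (auto simp: regular_box_def)
    qed (use a y1 in auto)
  qed
  obtain x s where f: "flow_on {0<..<z} x s" "x y1 = X z y1" "s y1 = S z y1"
  proof -
    have "y1 \<in> {0<..<z}" using y1 by simp
    from flow_exhaust[OF ex open_greaterThanLessThan this] that show ?thesis by blast
  qed
  have agree: "x y = X z y \<and> s y = S z y" if y: "y \<in> {z - d<..<z}" for y
  proof (rule flow_unique[of "{z - d<..<z}" x s "X z" "S z" y1])
    show "flow_on {z - d<..<z} x s" by (rule flow_on_subset[OF f(1)]) (use d \<delta> z in auto)
    show "flow_on {z - d<..<z} (X z) (S z)" by (rule flow_on_subset[OF gflow]) (use d in auto)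
  qed (use y y1 f in \<open>auto simp: is_interval_1\<close>)
  have "y < 3 * x y \<and> 2 * x y < y \<and> x y < s y \<and> s y < 1" if y: "y \<in> {0<..<z}" for y
  proof (cases "y \<le> y1")
    case True
    moreover have "{y..y1} \<subseteq> {0<..<z}" using y y1 by auto
    ultimately show ?thesis using region[OF f, of y y] by auto
  next
    case False
    have "leftsol z y1 (X z) (S z)" by (rule germ_leftsol[OF z23]) (use y1 in auto)
    from left_invariant[OF z no this, of y] False y
    have "y < 3 * X z y \<and> 2 * X z y < y \<and> X z y < S z y \<and> S z y < 1" by auto
    moreover have "x y = X z y \<and> s y = S z y" using agree[of y] False y y1 by auto
    ultimately show ?thesis by simp
  qed
  with f(1) agree show ?thesis by blast
qed

text \<open>
  At the first contact with a wall, \<open>x s > 1\<close> persists because \<open>x s\<close> is nondecreasing while \<open>x \<le> y\<close>. The other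
  three walls are repelling: \<open>s' < 0\<close> at \<open>s = 1\<close>, \<open>x' < 1\<close> at \<open>x = y\<close> because \<open>x s > 1\<close>, and \<open>3 x' > 1\<close> at
  \<open>3 x = y\<close> because \<open>s < x\<close> and \<open>x > 1\<close>.
\<close>

lemma right_invariant:
  assumes f: "flow_on {y1..b} x s" and start: "s y1 < 1" "1 < x y1 * s y1" "x y1 < y1" "y1 < 3 * x y1" and y0: "y0 \<in> {y1..b}"
  shows "s y0 < 1 \<and> 1 < x y0 * s y0 \<and> x y0 < y0 \<and> y0 < 3 * x y0"
proof (rule ccontr)
  assume bad: "\<not> ?thesis"
  define \<phi> where "\<phi> y = min (min (1 - s y) (x y * s y - 1)) (min (y - x y) (3 * x y - y))" for y
  have \<phi>_pos: "\<phi> y > 0 \<longleftrightarrow> s y < 1 \<and> 1 < x y * s y \<and> x y < y \<and> y < 3 * x y" for y by (auto simp: \<phi>_def)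
  have "continuous_on {y1..b} \<phi>" unfolding \<phi>_def by (intro continuous_intros flow_on_continuous[OF f])
  from first_zero_after[OF this _ y0] \<phi>_pos[of y1] \<phi>_pos[of y0] start bad
  obtain w where w: "w \<in> {y1<..b}" "\<phi> w = 0" "\<And>y. y \<in> {y1..<w} \<Longrightarrow> \<phi> y > 0" by auto
  have before: "s y < 1 \<and> 1 < x y * s y \<and> x y < y \<and> y < 3 * x y" if "y1 \<le> y" "y < w" for y
    using w(3)[of y] \<phi>_pos[of y] that by auto
  have wI: "w \<in> {y1..b}" using w by auto
  note D = flow_onD[OF f wI]
  have ge0: "s w \<le> 1" "1 \<le> x w * s w" "x w \<le> w" "w \<le> 3 * x w" using w(2) by (auto simp: \<phi>_def min_def split: if_splits)
  have x0: "0 < x w" using ge0 D(1) by linarith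
  have s0: "0 < s w" using ge0(2) x0 by (metis less_le_trans zero_less_mult_pos zero_less_one)
  have spos: "0 < s y" if "y1 \<le> y" "y \<le> w" for y
  proof (cases "y = w")
    case False
    then have "1 < x y * s y" "0 < x y" using before[of y] that flow_onD(1)[OF f, of y] w by auto
    then show ?thesis by (metis less_trans zero_less_mult_pos zero_less_one)
  qed (use s0 in simp)
  have q: "1 < x w * s w"
  proof -
    have "x y1 * s y1 \<le> x w * s w"
    proof (rule DERIV_nonneg_imp_nondecreasing[of y1 w])
      fix y assume y: "y1 \<le> y" "y \<le> w"
      note Dy = flow_onD[OF f, of y]
      have yI: "y \<in> {y1..b}" using y w by auto
      have "((\<lambda>y. x y * s y) has_real_derivative s y * (1 - x y / y)) (at y)"
        using DERIV_mult[OF Dy(3)[OF yI] Dy(4)[OF yI]] product_identity[of y "x y" "s y"] Dy(1,2)[OF yI] by simp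
      moreover have "x y \<le> y" using before[of y] y ge0 by (cases "y = w") auto
      then have "0 \<le> s y * (1 - x y / y)" using spos[OF y] Dy(1)[OF yI] by simp
      ultimately show "\<exists>D. ((\<lambda>y. x y * s y) has_real_derivative D) (at y) \<and> 0 \<le> D" by blast
    qed (use w in auto)
    then show ?thesis using start by linarith
  qed
  have x1: "1 < x w"
  proof -
    have "x w * s w \<le> x w * 1" using x0 ge0 by (intro mult_left_mono) auto
    then show ?thesis using q by linarith
  qed
  have D0: "1 - (x w)\<^sup>2 < 0" using x1 by (simp add: power2_eq_square less_1_mult)
  have no: False if dd: "(\<psi> has_real_derivative l) (at w)" "l > 0" "\<psi> w = 0" and pos: "\<And>y. y1 \<le> y \<Longrightarrow> y < w \<Longrightarrow> \<psi> y > 0"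
    for \<psi> :: "real \<Rightarrow> real" and l
  proof -
    obtain e where e: "e > 0" "\<And>h. 0 < h \<Longrightarrow> h < e \<Longrightarrow> \<psi> (w - h) < \<psi> w" using DERIV_pos_inc_left[OF dd(1,2)] by blast
    define h where "h = min (e / 2) (w - y1)"
    have h: "0 < h" "h < e" "h \<le> w - y1" using e w by (auto simp: h_def)
    show False using e(2)[OF h(1,2)] pos[of "w - h"] h dd(3) by auto
  qed
  consider "s w = 1" | "x w = w" | "3 * x w = w"
    using w(2) ge0 q by (auto simp: \<phi>_def min_def split: if_splits)
  then show False
  proof cases
    case 1
    have "((\<lambda>y. 1 - s y) has_real_derivative - sdot w (x w) (s w)) (at w)" by (auto intro!: derivative_eq_intros D)
    moreover have "- sdot w (x w) (s w) > 0" unfolding 1 using sdot_neg_at_1[OF D(1) x1] by simp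
    ultimately show False by (rule no) (use 1 before in auto)
  next
    case 2
    have "((\<lambda>y. y - x y) has_real_derivative 1 - xdot w (x w) (s w)) (at w)" by (auto intro!: derivative_eq_intros D)
    moreover have "1 - xdot w (x w) (s w) > 0"
    proof -
      have "2 * x w * (1 - x w * s w) < 0" using x0 q by (simp add: mult_pos_neg)
      moreover have "w * (1 - (x w)\<^sup>2) < 0" using D(1) D0 by (simp add: mult_pos_neg)
      ultimately show ?thesis by (simp add: xdot_def divide_neg_neg)
    qed
    ultimately show False by (rule no) (use 2 before in auto)
  next
    case 3
    have "((\<lambda>y. 3 * x y - y) has_real_derivative 3 * xdot w (x w) (s w) - 1) (at w)" by (auto intro!: derivative_eq_intros D)
    moreover have "3 * xdot w (x w) (s w) - 1 > 0"
    proof -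
      have "3 * xdot w (x w) (s w) - 1 = (6 * (x w)\<^sup>2 * (s w - x w) / (1 - (x w)\<^sup>2)) / w"
        using slope_identity[of w "x w" "s w"] D 3 by simp
      also have "\<dots> > 0" using x0 x1 ge0 D0 D(1) by (intro divide_pos_pos divide_neg_neg mult_pos_neg) auto
      finally show ?thesis .
    qed
    ultimately show False by (rule no) (use 3 before in auto)
  qed
qed

lemma outside_bounds:
  assumes "s < 1" "1 < x * s" "y < 3 * x" "(0::real) < y" shows "1 < x" "0 < s"
proof -
  have x: "0 < x" using assms by linarith
  show "0 < s" using assms x by (metis less_trans zero_less_mult_pos zero_less_one)
  have "x * s \<le> x * 1" using assms x by (intro mult_left_mono) auto
  then show "1 < x" using assms by linarith
qed

text \<open>
  The region on the right is entered by the germ for every \<open>z\<close> in \<open>[2,3]\<close>, so no shooting is needed here. In it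
  \<open>x\<close> increases, so it stays above \<open>x(y\<^sub>1) > 1\<close>, and \<open>x < y\<close> bounds it on compact intervals.
\<close>

theorem right_solution:
  assumes z: "z \<in> {2..3}"
  shows "\<exists>x s. flow_on {z<..} x s \<and> (\<forall>y\<in>{z<..<z + d}. x y = X z y \<and> s y = S z y) \<and>
    (\<forall>y>z. 1 < x y \<and> 0 < s y \<and> s y < 1 \<and> 1 < x y * s y \<and> x y < y \<and> y < 3 * x y)"
proof -
  define y1 where "y1 = z + d / 2"
  have y1: "z < y1" "y1 < z + d" "0 < y1" "y1 < z + \<delta>" using d \<delta> z by (auto simp: y1_def)
  have gflow: "flow_on {z<..<z + \<delta>} (X z) (S z)" by (rule flow_on_subset[OF germ_flow[OF z]]) (use \<delta> in auto)
  note st = near_sonic_right[OF z y1(1,2)]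
  have region: "s y < 1 \<and> 1 < x y * s y \<and> x y < y \<and> y < 3 * x y \<and> 1 < x y \<and> 0 < s y"
    if f: "flow_on {y1..b} x s" "x y1 = X z y1" "s y1 = S z y1" and y: "y \<in> {y1..b}" for x s b y
  proof -
    have r: "s y < 1 \<and> 1 < x y * s y \<and> x y < y \<and> y < 3 * x y"
      by (rule right_invariant[OF f(1)]) (use st f y in auto)
    have "0 < y" using y y1 by auto
    then show ?thesis using r outside_bounds[of "s y" "x y" y] by auto
  qed
  have ex: "\<exists>lo hi x s. flow_on {lo<..<hi} x s \<and> closed_segment y1 a \<subseteq> {lo<..<hi} \<and> x y1 = X z y1 \<and> s y1 = S z y1"
    if a: "a \<in> {z<..}" for a
  proof (cases "a \<le> y1")
    case True
    then have "closed_segment y1 a \<subseteq> {z<..<z + \<delta>}" using a y1 by (auto simp: closed_segment_eq_real_ivl)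
    then show ?thesis using gflow by blast
  next
    case False
    define m where "m = min y1 ((X z y1)\<^sup>2 - 1)"
    define R where "R = max 3 a"
    have m: "m > 0" using y1 st by (simp add: m_def power2_eq_square less_1_mult)
    show ?thesis
    proof (rule flow_continuation[OF m, of R])
      fix lo hi x s b
      assume f: "flow_on {lo<..<hi} x s" "x y1 = X z y1" "s y1 = S z y1" and b: "b \<in> closed_segment y1 a"
        and sub: "closed_segment y1 b \<subseteq> {lo<..<hi}"
      have b': "y1 \<le> b" "b \<le> a" using b False by (auto simp: closed_segment_eq_real_ivl)
      have sub': "{y1..b} \<subseteq> {lo<..<hi}" using sub b' by (auto simp: closed_segment_eq_real_ivl)
      have f': "flow_on {y1..b} x s" by (rule flow_on_subset[OF f(1) sub'])
      note R = region[OF f' f(2,3)]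
      have "x y1 \<le> x b"
      proof (rule DERIV_nonneg_imp_nondecreasing[OF b'(1)])
        fix y assume y: "y1 \<le> y" "y \<le> b"
        then have "(x has_real_derivative xdot y (x y) (s y)) (at y)" using flow_onD(3)[OF f'] by auto
        moreover have "xdot y (x y) (s y) > 0" using R[of y] y by (intro xdot_pos_outside) auto
        ultimately show "\<exists>D. (x has_real_derivative D) (at y) \<and> 0 \<le> D" using less_imp_le by blast
      qed
      then have "(X z y1)\<^sup>2 \<le> (x b)\<^sup>2" using st f(2) by (intro power_mono) auto
      then have "m \<le> norm (1 - (x b)\<^sup>2)" by (auto simp: m_def min_le_iff_disj)
      moreover have "m \<le> norm b" using b' y1 by (simp add: m_def)
      ultimately show "(b, x b, s b) \<in> regular_box m R"
        using R[of b] b' y1 by (auto simp: regular_box_def R_def)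
    next
      have "m \<le> norm (1 - (X z y1)\<^sup>2)" by (auto simp: m_def min_le_iff_disj)
      moreover have "m \<le> norm y1" using y1 by (simp add: m_def)
      moreover have "0 < S z y1" using outside_bounds[OF st(2,3,5) y1(3)] by simp
      ultimately show "(y1, X z y1, S z y1) \<in> regular_box m R"
        using st y1 False by (auto simp: regular_box_def R_def)
    qed (use a y1 z in \<open>auto simp: R_def\<close>)
  qed
  obtain x s where f: "flow_on {z<..} x s" "x y1 = X z y1" "s y1 = S z y1"
  proof -
    have "y1 \<in> {z<..}" using y1 by simp
    from flow_exhaust[OF ex open_greaterThan this] that show ?thesis by blast
  qed
  have eq: "x y = X z y \<and> s y = S z y" if y: "y \<in> {z<..<z + d}" for y
  proof (rule flow_unique[of "{z<..<z + d}" x s "X z" "S z" y1])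
    show "flow_on {z<..<z + d} x s" by (rule flow_on_subset[OF f(1)]) auto
    show "flow_on {z<..<z + d} (X z) (S z)" by (rule flow_on_subset[OF gflow]) (use d in auto)
  qed (use y y1 f in \<open>auto simp: is_interval_1\<close>)
  have "1 < x y \<and> 0 < s y \<and> s y < 1 \<and> 1 < x y * s y \<and> x y < y \<and> y < 3 * x y" if y: "y > z" for y
  proof (cases "y1 \<le> y")
    case True
    have "flow_on {y1..y} x s" by (rule flow_on_subset[OF f(1)]) (use y1 in auto)
    then show ?thesis using region[of y x s y] True f by auto
  next
    case False
    then have "y < z + d" using y1 by simp
    then show ?thesis using near_sonic_right[OF z y] eq[of y] y z outside_bounds[of "S z y" "X z y" y] by auto
  qed
  with f(1) eq show ?thesis by blast
qed

end

section \<open>Holomorphic extensions and real-analyticity on the half-line\<close>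

text \<open>
  Only the values on \<open>v \<ge> 0\<close> are prescribed, as in \<open>real_analytic_half_line\<close>: at \<open>x = 0\<close> the disc extends
  \<open>f\<close> from the right half of its real diameter.
\<close>

definition holomorphic_extension_at :: "(real \<Rightarrow> real) \<Rightarrow> real \<Rightarrow> bool" where
  "holomorphic_extension_at f x \<longleftrightarrow> (\<exists>r>0. \<exists>F. F holomorphic_on ball (of_real x) r \<and>
     (\<forall>v\<ge>0. \<bar>v - x\<bar> < r \<longrightarrow> F (of_real v) = of_real (f v)))"

lemma real_analytic_half_lineI:
  assumes "\<And>x. x \<ge> 0 \<Longrightarrow> holomorphic_extension_at f x"
  shows "real_analytic_half_line f"
  unfolding real_analytic_half_line_def
proof (intro allI impI)
  fix x :: real assume "x \<ge> 0"
  then obtain r F where r: "r > 0" and F: "F holomorphic_on ball (complex_of_real x) r"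
    and eq: "\<And>v. v \<ge> 0 \<Longrightarrow> \<bar>v - x\<bar> < r \<Longrightarrow> F (of_real v) = of_real (f v)"
    using assms unfolding holomorphic_extension_at_def by metis
  define a where "a n = Re ((deriv ^^ n) F (of_real x) / fact n)" for n
  have "(\<lambda>n. a n * (v - x) ^ n) sums f v" if v: "v \<ge> 0" "\<bar>v - x\<bar> < r" for v
  proof -
    have "(\<lambda>n. (deriv ^^ n) F (of_real x) / fact n * (of_real v - of_real x) ^ n) sums of_real (f v)"
      using holomorphic_power_series[OF F of_real_in_ball[OF v(2)]] eq[OF v] by simp
    from sums_Re[OF this]
    have "(\<lambda>n. Re ((deriv ^^ n) F (of_real x) / fact n * of_real ((v - x) ^ n))) sums f v" by simp
    moreover have "Re (c * of_real b) = Re c * b" for c and b :: real by simp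
    ultimately show ?thesis unfolding a_def by (simp only:)
  qed
  with r show "\<exists>r>0. \<exists>a. \<forall>v\<ge>0. \<bar>v - x\<bar> < r \<longrightarrow> (\<lambda>n. a n * (v - x) ^ n) sums f v" by blast
qed

lemma at_within_half_line_nontrivial: "v \<ge> (0::real) \<Longrightarrow> at v within {0..} \<noteq> bot"
proof (cases "v = 0")
  case True
  then show ?thesis using at_within_Ici_at_right[of v] trivial_limit_at_right_real[of v] by simp
next
  case False
  assume "v \<ge> 0"
  have "at v within {0..} = at v"
    by (rule at_within_open_subset[of v "{0<..}"]) (use False \<open>v \<ge> 0\<close> in auto)
  then show ?thesis using trivial_limit_at[of v] by simp
qed

text \<open>
  The derivatives of local extensions fit together because each of them is the derivative of \<open>f\<close> within the
  half-line. Applied to \<open>\<rho>\<close> and \<open>\<omega>\<close>, whose derivatives are the right-hand sides of the system, this removes the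
  singularities at \<open>0\<close> and at the sonic point.
\<close>

lemma holomorphic_extension_deriv:
  assumes f: "\<And>x. x \<ge> 0 \<Longrightarrow> holomorphic_extension_at f x"
  shows "\<exists>h. (\<forall>x\<ge>0. holomorphic_extension_at h x) \<and> (\<forall>y>0. (f has_real_derivative h y) (at y))"
proof -
  let ?g = "\<lambda>v. complex_of_real (f v)"
  define D where "D v = vector_derivative ?g (at v within {0..})" for v
  have key: "deriv F (of_real v) = of_real (Re (D v))"
    if F: "F holomorphic_on ball (complex_of_real x) r" and eq: "\<And>v. v \<ge> 0 \<Longrightarrow> \<bar>v - x\<bar> < r \<Longrightarrow> F (of_real v) = of_real (f v)"
      and v: "v \<ge> 0" "\<bar>v - x\<bar> < r" for F x r v
  proof -
    have "(F has_field_derivative deriv F (of_real v)) (at (of_real v))"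
      by (rule holomorphic_derivI[OF F open_ball of_real_in_ball[OF v(2)]])
    from has_vector_derivative_real_field[OF this]
    have 1: "((\<lambda>v. F (of_real v)) has_vector_derivative deriv F (of_real v)) (at v within {0..})" .
    have 2: "(?g has_vector_derivative deriv F (of_real v)) (at v within {0..})"
    proof (rule has_vector_derivative_transform_within[OF 1])
      show "0 < r - \<bar>v - x\<bar>" using v by simp
      show "v \<in> {0..}" using v by simp
      fix u assume "u \<in> {0..}" "dist u v < r - \<bar>v - x\<bar>"
      then show "F (of_real u) = of_real (f u)" by (intro eq) (auto simp: dist_real_def)
    qed
    have nb: "at v within {0..} \<noteq> bot" by (rule at_within_half_line_nontrivial[OF v(1)])
    have Dv: "D v = deriv F (of_real v)" unfolding D_def by (rule vector_derivative_within[OF nb 2])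
    have "((\<lambda>v. Im (?g v)) has_vector_derivative Im (deriv F (of_real v))) (at v within {0..})"
      by (rule bounded_linear.has_vector_derivative[OF bounded_linear_Im 2])
    then have "((\<lambda>v. 0::real) has_vector_derivative Im (deriv F (of_real v))) (at v within {0..})" by simp
    from vector_derivative_within[OF nb this] vector_derivative_within[OF nb has_vector_derivative_const[of "0::real"]]
    have "Im (deriv F (of_real v)) = 0" by simp
    then show ?thesis by (simp add: Dv complex_eq_iff)
  qed
  have "holomorphic_extension_at (\<lambda>v. Re (D v)) x" if x: "x \<ge> 0" for x
  proof -
    obtain r F where r: "r > 0" "F holomorphic_on ball (complex_of_real x) r"
      and eq: "\<And>v. v \<ge> 0 \<Longrightarrow> \<bar>v - x\<bar> < r \<Longrightarrow> F (of_real v) = of_real (f v)"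
      using f[OF x] unfolding holomorphic_extension_at_def by metis
    have "deriv F holomorphic_on ball (of_real x) r" by (rule holomorphic_deriv[OF r(2) open_ball])
    then show ?thesis unfolding holomorphic_extension_at_def using r(1) key[OF r(2) eq] by blast
  qed
  moreover have "(f has_real_derivative Re (D y)) (at y)" if y: "y > 0" for y
  proof -
    obtain r F where r: "r > 0" "F holomorphic_on ball (complex_of_real y) r"
      and eq: "\<And>v. v \<ge> 0 \<Longrightarrow> \<bar>v - y\<bar> < r \<Longrightarrow> F (of_real v) = of_real (f v)"
      using f[OF less_imp_le[OF y]] unfolding holomorphic_extension_at_def by metis
    have "(F has_field_derivative deriv F (of_real y)) (at (of_real y))"
      by (rule holomorphic_derivI[OF r(2) open_ball]) (use r in simp)
    from real_part_has_derivative[OF this]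
    have 1: "((\<lambda>v. Re (F (of_real v))) has_real_derivative Re (D y)) (at y)"
      using key[OF r(2) eq, of y] y r by simp
    show ?thesis
    proof (rule has_field_derivative_transform_within_open[OF 1])
      show "open {max 0 (y - r)<..<y + r}" "y \<in> {max 0 (y - r)<..<y + r}" using y r by auto
      fix v assume "v \<in> {max 0 (y - r)<..<y + r}"
      then show "Re (F (of_real v)) = f v" using eq[of v] by (auto simp: abs_less_iff)
    qed
  qed
  ultimately show ?thesis by blast
qed

lemma holomorphic_extension_quotient:
  assumes y: "y > 0" and r: "r > 0" and F: "F holomorphic_on ball (complex_of_real y) r"
    and eq: "\<And>v. \<bar>v - y\<bar> < r \<Longrightarrow> F (of_real v) = of_real (g v)"
    and f: "\<And>v. v > 0 \<Longrightarrow> \<bar>v - y\<bar> < r \<Longrightarrow> f v = g v / v"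
  shows "holomorphic_extension_at f y"
  unfolding holomorphic_extension_at_def
proof (intro exI[of _ "min r y"] exI[of _ "\<lambda>w. F w / w"] conjI allI impI)
  show "(\<lambda>w. F w / w) holomorphic_on ball (of_real y) (min r y)"
  proof (intro holomorphic_intros holomorphic_on_subset[OF F])
    fix w assume "w \<in> ball (complex_of_real y) (min r y)"
    then show "w \<noteq> 0" using y by (auto simp: dist_norm)
  qed auto
  fix v :: real assume "v \<ge> 0" "\<bar>v - y\<bar> < min r y"
  then show "F (of_real v) / of_real v = of_real (f v)" using eq[of v] f[of v] by auto
qed (use y r in auto)

lemma flow_rho_omega:
  assumes f: "flow_on I x s" and y: "y \<in> I"
  shows "((\<lambda>y. s y / y) has_real_derivative rho_rhs (\<lambda>y. s y / y) (\<lambda>y. x y / y) y) (at y)"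
    and "((\<lambda>y. x y / y) has_real_derivative omega_rhs (\<lambda>y. s y / y) (\<lambda>y. x y / y) y) (at y)"
proof -
  note D = flow_onD[OF f y]
  have y0: "y \<noteq> 0" and xn: "1 - (x y)\<^sup>2 \<noteq> 0" using D(1,2) by auto
  have sq: "y\<^sup>2 * (x y / y)\<^sup>2 = (x y)\<^sup>2" using y0 by (simp add: power_divide)
  have "((\<lambda>y. s y / y) has_real_derivative (sdot y (x y) (s y) * y - s y) / (y * y)) (at y)"
    using DERIV_divide[OF D(4) DERIV_ident y0] by simp
  moreover have "(sdot y (x y) (s y) * y - s y) / (y * y) = rho_rhs (\<lambda>y. s y / y) (\<lambda>y. x y / y) y"
    unfolding sdot_def rho_rhs_def sq using y0 xn
    by (simp add: divide_simps) (simp add: power2_eq_square algebra_simps)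
  ultimately show "((\<lambda>y. s y / y) has_real_derivative rho_rhs (\<lambda>y. s y / y) (\<lambda>y. x y / y) y) (at y)" by simp
  have "((\<lambda>y. x y / y) has_real_derivative (xdot y (x y) (s y) * y - x y) / (y * y)) (at y)"
    using DERIV_divide[OF D(3) DERIV_ident y0] by simp
  moreover have "(xdot y (x y) (s y) * y - x y) / (y * y) = omega_rhs (\<lambda>y. s y / y) (\<lambda>y. x y / y) y"
    unfolding xdot_def omega_rhs_def sq using y0 xn
    by (simp add: divide_simps) (simp add: power2_eq_square algebra_simps)
  ultimately show "((\<lambda>y. x y / y) has_real_derivative omega_rhs (\<lambda>y. s y / y) (\<lambda>y. x y / y) y) (at y)" by simp
qed

section \<open>The centre\<close>

definition centre_dom :: "real \<Rightarrow> (complex \<times> complex \<times> complex) set" where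
  "centre_dom V = {(t, u, v). norm t \<le> 1 / 4 \<and> norm u \<le> 2 \<and> norm v \<le> V}"

lemma centre_dom_denominator:
  assumes "(t, u, v) \<in> centre_dom V" shows "norm (1 - t\<^sup>2 * u\<^sup>2) \<ge> 1 / 2"
proof -
  have "norm t * norm u \<le> 1 / 4 * 2" using assms by (intro mult_mono) (auto simp: centre_dom_def)
  then have "(norm (t * u))\<^sup>2 \<le> (1 / 2)\<^sup>2" unfolding norm_mult by (intro power_mono) auto
  moreover have "t\<^sup>2 * u\<^sup>2 = (t * u)\<^sup>2" by (simp add: power_mult_distrib)
  ultimately have "norm (t\<^sup>2 * u\<^sup>2) \<le> (1 / 2)\<^sup>2" by (simp only: norm_power)
  then have "norm (t\<^sup>2 * u\<^sup>2) \<le> 1 / 2" by (simp add: power2_eq_square)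
  then show ?thesis using norm_triangle_ineq2[of 1 "t\<^sup>2 * u\<^sup>2"] by simp
qed

text \<open>
  Near \<open>y = 0\<close>, with \<open>\<rho> = c + t v\<close> and \<open>\<omega> = u\<close>, the system reads \<open>t u' + 3 u = 1 + t centre_omega\<close> and
  \<open>t v' + v = t centre_rho\<close>, again of Briot-Bouquet type.
\<close>

definition centre_omega :: "complex \<Rightarrow> complex \<Rightarrow> complex \<Rightarrow> complex \<Rightarrow> complex" where
  "centre_omega c t u v = 2 * t * u\<^sup>2 * (c + t * v - u) / (1 - t\<^sup>2 * u\<^sup>2)"

definition centre_rho :: "complex \<Rightarrow> complex \<Rightarrow> complex \<Rightarrow> complex \<Rightarrow> complex" where
  "centre_rho c t u v = - 2 * u * (c + t * v) * (c + t * v - u) / (1 - t\<^sup>2 * u\<^sup>2)"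

lemma centre_lipschitz:
  obtains K where "K \<ge> 1"
    "\<And>t u v. (t, u, v) \<in> centre_dom V \<Longrightarrow> norm (centre_omega c t u v) \<le> K \<and> norm (centre_rho c t u v) \<le> K"
    "\<And>t u v t' u' v'. (t, u, v) \<in> centre_dom V \<Longrightarrow> (t', u', v') \<in> centre_dom V \<Longrightarrow>
      norm (centre_omega c t u v - centre_omega c t' u' v') \<le> K * (dist t t' + (dist u u' + dist v v')) \<and>
      norm (centre_rho c t u v - centre_rho c t' u' v') \<le> K * (dist t t' + (dist u u' + dist v v'))"
proof -
  let ?S = "centre_dom V"
  have "bounded ?S" by (rule bounded_tripleI[of _ "2 + \<bar>V\<bar>"]) (auto simp: centre_dom_def)
  then have id: "bounded_lipschitz ?S (\<lambda>p. p)" by (rule bounded_lipschitz_id)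
  have i: "bounded_lipschitz ?S (\<lambda>p. fst p)" "bounded_lipschitz ?S (\<lambda>p. fst (snd p))"
    "bounded_lipschitz ?S (\<lambda>p. snd (snd p))"
    by (intro bounded_lipschitz_fst_snd id)+
  have low: "\<exists>m>0. \<forall>p\<in>?S. m \<le> norm (1 - (fst p)\<^sup>2 * (fst (snd p))\<^sup>2)"
    by (rule exI[of _ "1 / 2"]) (auto dest: centre_dom_denominator)
  have "bounded_lipschitz ?S (\<lambda>p. centre_omega c (fst p) (fst (snd p)) (snd (snd p)))"
    "bounded_lipschitz ?S (\<lambda>p. centre_rho c (fst p) (fst (snd p)) (snd (snd p)))"
    unfolding centre_omega_def centre_rho_def by (intro bl_intros i low)+
  then show thesis by (rule bounded_lipschitz_tripleD) (rule that; blast)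
qed

text \<open>
  The Briot-Bouquet system at the centre has a holomorphic solution with \<open>\<rho>(0) = c\<close>. The given solution, in the
  variables \<open>\<omega>\<close> and \<open>(\<rho> - c)/y\<close>, is a second bounded solution, so \<open>euler_system_stability\<close> with \<open>E = 0\<close>
  makes the two equal. Boundedness alone thus yields \<open>\<omega> = 1/3\<close> at the centre.
\<close>

lemma centre_extension:
  fixes \<rho> \<omega> :: "real \<Rightarrow> real"
  assumes b: "b > 0"
    and ode: "\<And>y. 0 < y \<Longrightarrow> y \<le> b \<Longrightarrow> (\<rho> has_real_derivative rho_rhs \<rho> \<omega> y) (at y)"
      "\<And>y. 0 < y \<Longrightarrow> y \<le> b \<Longrightarrow> (\<omega> has_real_derivative omega_rhs \<rho> \<omega> y) (at y)"
    and \<omega>: "\<And>y. 0 < y \<Longrightarrow> y \<le> b \<Longrightarrow> \<bar>\<omega> y\<bar> \<le> 2"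
    and \<rho>: "\<And>y. 0 < y \<Longrightarrow> y \<le> b \<Longrightarrow> \<bar>\<rho> y - c\<bar> \<le> V * y"
  shows "\<exists>r>0. \<exists>P W. P holomorphic_on ball 0 r \<and> W holomorphic_on ball 0 r \<and> P 0 = of_real c \<and> W 0 = 1 / 3 \<and>
    (\<forall>y. 0 < y \<and> y < r \<longrightarrow> P (of_real y) = of_real (\<rho> y) \<and> W (of_real y) = of_real (\<omega> y))"
proof -
  let ?S = "centre_dom (\<bar>V\<bar> + 1)" and ?c = "complex_of_real c"
  obtain C where C: "C \<ge> 1"
    and Cb: "\<And>t u v. (t, u, v) \<in> ?S \<Longrightarrow> norm (centre_omega ?c t u v) \<le> C \<and> norm (centre_rho ?c t u v) \<le> C"
    and Cl: "\<And>t u v t' u' v'. (t, u, v) \<in> ?S \<Longrightarrow> (t', u', v') \<in> ?S \<Longrightarrow>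
      norm (centre_omega ?c t u v - centre_omega ?c t' u' v') \<le> C * (dist t t' + (dist u u' + dist v v')) \<and>
      norm (centre_rho ?c t u v - centre_rho ?c t' u' v') \<le> C * (dist t t' + (dist u u' + dist v v'))"
    by (rule centre_lipschitz[where V = "\<bar>V\<bar> + 1" and c = ?c]) blast
  define r where "r = min b (min (1 / (16 * C\<^sup>2)) (1 / 4))"
  have r: "r > 0" "16 * C\<^sup>2 * r \<le> 1" "r \<le> 1 / 4" "r \<le> b"
  proof -
    show "r > 0" using C b by (simp add: r_def)
    have "16 * C\<^sup>2 * r \<le> 16 * C\<^sup>2 * (1 / (16 * C\<^sup>2))" unfolding r_def by (intro mult_left_mono) auto
    then show "16 * C\<^sup>2 * r \<le> 1" using C by simp
  qed (auto simp: r_def)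
  have rC: "r * C \<le> 1"
  proof -
    have "C * r \<le> (16 * C\<^sup>2) * r"
      using C r mult_left_mono[of 1 C C] by (intro mult_right_mono) (auto simp: power2_eq_square)
    from order_trans[OF this r(2)] show ?thesis by (simp add: mult.commute)
  qed
  let ?B = "ball (0::complex) r"
  define G1 G2 where "G1 t u v = 1 + t * centre_omega ?c t u v" and "G2 t u v = t * centre_rho ?c t u v" for t u v
  have dom: "(t, u, v) \<in> ?S" if "t \<in> ?B" "norm u \<le> 2" "norm v \<le> \<bar>V\<bar> + 1" for t u v
    using that r by (auto simp: centre_dom_def)
  have lip: "norm (G1 t u v - G1 t u' v') \<le> C * (norm t * norm (u - u') + norm (v - v'))"
    "norm (G2 t u v - G2 t u' v') \<le> C * norm t * (norm (u - u') + norm (v - v'))"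
    if t: "t \<in> ?B" and d: "norm u \<le> 2" "norm v \<le> \<bar>V\<bar> + 1" "norm u' \<le> 2" "norm v' \<le> \<bar>V\<bar> + 1" for t u v u' v'
  proof -
    note m = dom[OF t d(1,2)] dom[OF t d(3,4)]
    have l: "norm (centre_omega ?c t u v - centre_omega ?c t u' v') \<le> C * (norm (u - u') + norm (v - v'))"
      "norm (centre_rho ?c t u v - centre_rho ?c t u' v') \<le> C * (norm (u - u') + norm (v - v'))"
      using Cl[OF m] by (simp_all add: dist_norm)
    have "norm (G1 t u v - G1 t u' v') = norm t * norm (centre_omega ?c t u v - centre_omega ?c t u' v')"
      unfolding G1_def norm_mult[symmetric] by (simp add: right_diff_distrib)
    also have "\<dots> \<le> norm t * (C * (norm (u - u') + norm (v - v')))"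
      by (intro mult_left_mono l) auto
    also have "\<dots> = C * (norm t * norm (u - u') + norm t * norm (v - v'))" by (simp add: algebra_simps)
    also have "\<dots> \<le> C * (norm t * norm (u - u') + 1 * norm (v - v'))"
      using t r C by (intro mult_left_mono add_left_mono mult_right_mono) auto
    finally show "norm (G1 t u v - G1 t u' v') \<le> C * (norm t * norm (u - u') + norm (v - v'))" by simp
    have "norm (G2 t u v - G2 t u' v') = norm t * norm (centre_rho ?c t u v - centre_rho ?c t u' v')"
      unfolding G2_def norm_mult[symmetric] by (simp add: right_diff_distrib)
    also have "\<dots> \<le> norm t * (C * (norm (u - u') + norm (v - v')))"
      by (intro mult_left_mono l) auto
    finally show "norm (G2 t u v - G2 t u' v') \<le> C * norm t * (norm (u - u') + norm (v - v'))"
      by (simp add: mult_ac)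
  qed
  obtain U W where UW: "U holomorphic_on ?B" "W holomorphic_on ?B"
    "\<And>t. t \<in> ?B \<Longrightarrow> norm (U t) \<le> 2" "\<And>t. t \<in> ?B \<Longrightarrow> norm (W t - of_real (0 / 1)) \<le> 1"
    "\<And>t. t \<in> ?B \<Longrightarrow> t * deriv U t + of_real 3 * U t = G1 t (U t) (W t)"
    "\<And>t. t \<in> ?B \<Longrightarrow> t * deriv W t + of_real 1 * W t = G2 t (U t) (W t)"
  proof (rule triangular_briot_bouquet[of C 2 r 3 1 0 G1 G2, OF C _ r(1,2)])
    fix u v assume hol: "u holomorphic_on ?B" "v holomorphic_on ?B"
      and bd: "\<And>t. t \<in> ?B \<Longrightarrow> norm (u t) \<le> 2 \<and> norm (v t - of_real (0 / 1)) \<le> 1"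
    have nz: "1 - t\<^sup>2 * (u t)\<^sup>2 \<noteq> 0" if t: "t \<in> ?B" for t
    proof -
      have "(t, u t, v t) \<in> ?S" using dom[OF t] bd[OF t] by auto
      then show ?thesis using centre_dom_denominator by fastforce
    qed
    show "(\<lambda>t. G1 t (u t) (v t)) holomorphic_on ?B \<and> (\<lambda>t. G2 t (u t) (v t)) holomorphic_on ?B"
      unfolding G1_def G2_def centre_omega_def centre_rho_def
      by (intro conjI holomorphic_intros hol nz)
  next
    fix t u v :: complex assume t: "t \<in> ?B" and u: "norm u \<le> 2" and v: "norm (v - of_real (0 / 1)) \<le> (1::real)"
    have m: "(t, u, v) \<in> ?S" using dom[OF t u] v by auto
    have "norm (t * centre_omega ?c t u v) \<le> r * C"
      unfolding norm_mult using Cb[OF m] t C r by (intro mult_mono) auto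
    then show "norm (G1 t u v) \<le> 2" using rC norm_triangle_ineq[of 1 "t * centre_omega ?c t u v"] by (simp add: G1_def)
    have "norm t * norm (centre_rho ?c t u v) \<le> norm t * C"
      using Cb[OF m] by (intro mult_left_mono) auto
    then show "norm (G2 t u v - of_real 0) \<le> C * norm t" by (simp add: G2_def norm_mult mult.commute)
  next
    fix t u v :: complex assume "t \<in> \<real>" "u \<in> \<real>" "v \<in> \<real>"
    then show "G1 t u v \<in> \<real> \<and> G2 t u v \<in> \<real>" unfolding G1_def G2_def centre_omega_def centre_rho_def by auto
  qed (use lip in auto)
  define v where "v y = (\<rho> y - c) / y" for y
  have vb: "\<bar>v y\<bar> \<le> \<bar>V\<bar>" if "0 < y" "y \<le> b" for y
  proof -
    have "V * y \<le> \<bar>V\<bar> * y" using that by (intro mult_right_mono) auto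
    then have "\<bar>\<rho> y - c\<bar> \<le> \<bar>V\<bar> * y" using \<rho>[OF that] by linarith
    then show ?thesis using that by (simp add: v_def abs_divide pos_divide_le_eq)
  qed
  have same: "complex_of_real (\<omega> T) = U (of_real T) \<and> complex_of_real (v T) = W (of_real T)" if T: "0 < T" "T < r" for T
  proof -
    let ?p = "\<lambda>\<theta>. complex_of_real (\<omega> \<theta>) - U (of_real \<theta>)" and ?q = "\<lambda>\<theta>. complex_of_real (v \<theta>) - W (of_real \<theta>)"
    have "norm (?p T) + 4 * C * norm (?q T) \<le> 2 * (1 + 4 * C) * 0"
    proof (rule euler_system_stability[where p = ?p and q = ?q and T = T and r = r and ?k1.0 = 3 and ?k2.0 = 1 and B = "4 + \<bar>V\<bar>"
          and p' = "\<lambda>\<theta>. complex_of_real (omega_rhs \<rho> \<omega> \<theta>) - deriv U (of_real \<theta>)"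
          and q' = "\<lambda>\<theta>. complex_of_real ((rho_rhs \<rho> \<omega> \<theta> - v \<theta>) / \<theta>) - deriv W (of_real \<theta>)", OF C _ r(2) _ _ T(1)])
      fix \<theta> assume "\<theta> \<in> {0<..T}"
      then have \<theta>: "0 < \<theta>" "\<theta> \<le> b" "\<theta> < r" using T r by auto
      have t: "complex_of_real \<theta> \<in> ?B" using \<theta> by simp
      have dU: "((\<lambda>\<theta>. U (of_real \<theta>)) has_vector_derivative deriv U (of_real \<theta>)) (at \<theta>)"
        by (rule has_vector_derivative_real_field[OF holomorphic_derivI[OF UW(1) open_ball t]])
      have dW: "((\<lambda>\<theta>. W (of_real \<theta>)) has_vector_derivative deriv W (of_real \<theta>)) (at \<theta>)"
        by (rule has_vector_derivative_real_field[OF holomorphic_derivI[OF UW(2) open_ball t]])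
      have dv: "(v has_real_derivative (rho_rhs \<rho> \<omega> \<theta> - v \<theta>) / \<theta>) (at \<theta>)"
      proof -
        have "(v has_real_derivative (rho_rhs \<rho> \<omega> \<theta> * \<theta> - (\<rho> \<theta> - c) * 1) / (\<theta> * \<theta>)) (at \<theta>)"
          unfolding v_def using ode(1)[OF \<theta>(1,2)] \<theta> by (intro DERIV_divide) (auto intro!: derivative_eq_intros)
        then show ?thesis using \<theta> by (simp add: v_def divide_simps)
      qed
      have of_real_vd: "((\<lambda>y. complex_of_real (f y)) has_vector_derivative of_real D) (at \<theta>)"
        if "(f has_real_derivative D) (at \<theta>)" for f D
        using bounded_linear.has_vector_derivative[OF bounded_linear_of_real that[unfolded has_real_derivative_iff_has_vector_derivative]] .
      show "(?p has_vector_derivative complex_of_real (omega_rhs \<rho> \<omega> \<theta>) - deriv U (of_real \<theta>)) (at \<theta>)"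
        by (intro has_vector_derivative_diff dU of_real_vd ode \<theta>)
      show "(?q has_vector_derivative complex_of_real ((rho_rhs \<rho> \<omega> \<theta> - v \<theta>) / \<theta>) - deriv W (of_real \<theta>)) (at \<theta>)"
        by (intro has_vector_derivative_diff dW of_real_vd dv)
      have rv: "\<rho> \<theta> = c + \<theta> * v \<theta>" using \<theta> by (simp add: v_def)
      have g1: "complex_of_real (\<theta> * omega_rhs \<rho> \<omega> \<theta> + 3 * \<omega> \<theta>) = G1 (of_real \<theta>) (of_real (\<omega> \<theta>)) (of_real (v \<theta>))"
      proof -
        have "\<theta> * omega_rhs \<rho> \<omega> \<theta> + 3 * \<omega> \<theta> = 1 + \<theta> * (2 * \<theta> * (\<omega> \<theta>)\<^sup>2 * (c + \<theta> * v \<theta> - \<omega> \<theta>) / (1 - \<theta>\<^sup>2 * (\<omega> \<theta>)\<^sup>2))"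
          unfolding omega_rhs_def rv using \<theta> by (simp add: field_simps)
        then show ?thesis by (simp add: G1_def centre_omega_def)
      qed
      have g2: "complex_of_real (rho_rhs \<rho> \<omega> \<theta>) = G2 (of_real \<theta>) (of_real (\<omega> \<theta>)) (of_real (v \<theta>))"
        unfolding G2_def centre_rho_def rho_rhs_def rv by simp
      have db: "norm (complex_of_real (\<omega> \<theta>)) \<le> 2" "norm (complex_of_real (v \<theta>)) \<le> \<bar>V\<bar> + 1" "norm (U (of_real \<theta>)) \<le> 2"
        "norm (W (of_real \<theta>)) \<le> \<bar>V\<bar> + 1"
        using \<omega>[OF \<theta>(1,2)] vb[OF \<theta>(1,2)] UW(3)[OF t] UW(4)[OF t] by auto
      have nt: "norm (complex_of_real \<theta>) \<le> r" using \<theta> by simp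
      have "\<theta> *\<^sub>R (complex_of_real (omega_rhs \<rho> \<omega> \<theta>) - deriv U (of_real \<theta>)) + 3 *\<^sub>R ?p \<theta>
          = complex_of_real (\<theta> * omega_rhs \<rho> \<omega> \<theta> + 3 * \<omega> \<theta>) - (of_real \<theta> * deriv U (of_real \<theta>) + of_real 3 * U (of_real \<theta>))"
        by (simp add: scaleR_conv_of_real algebra_simps)
      then have "norm (\<theta> *\<^sub>R (complex_of_real (omega_rhs \<rho> \<omega> \<theta>) - deriv U (of_real \<theta>)) + 3 *\<^sub>R ?p \<theta>)
          \<le> C * (norm (complex_of_real \<theta>) * norm (?p \<theta>) + norm (?q \<theta>))"
        using lip(1)[OF t db] unfolding UW(5)[OF t] g1 by simp
      also have "\<dots> \<le> C * (r * norm (?p \<theta>) + norm (?q \<theta>))"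
        using nt C by (intro mult_left_mono add_right_mono mult_right_mono) auto
      finally show "norm (\<theta> *\<^sub>R (complex_of_real (omega_rhs \<rho> \<omega> \<theta>) - deriv U (of_real \<theta>)) + 3 *\<^sub>R ?p \<theta>)
          \<le> C * (r * norm (?p \<theta>) + norm (?q \<theta>)) + 0" by simp
      have "\<theta> * ((rho_rhs \<rho> \<omega> \<theta> - v \<theta>) / \<theta>) = rho_rhs \<rho> \<omega> \<theta> - v \<theta>" using \<theta> by simp
      then have qv: "complex_of_real \<theta> * complex_of_real ((rho_rhs \<rho> \<omega> \<theta> - v \<theta>) / \<theta>)
          = of_real (rho_rhs \<rho> \<omega> \<theta>) - of_real (v \<theta>)" by (metis of_real_mult of_real_diff)
      have "\<theta> *\<^sub>R (complex_of_real ((rho_rhs \<rho> \<omega> \<theta> - v \<theta>) / \<theta>) - deriv W (of_real \<theta>)) + 1 *\<^sub>R ?q \<theta>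
          = complex_of_real (rho_rhs \<rho> \<omega> \<theta>) - (of_real \<theta> * deriv W (of_real \<theta>) + of_real 1 * W (of_real \<theta>))"
        unfolding scaleR_conv_of_real right_diff_distrib qv by simp
      then have "norm (\<theta> *\<^sub>R (complex_of_real ((rho_rhs \<rho> \<omega> \<theta> - v \<theta>) / \<theta>) - deriv W (of_real \<theta>)) + 1 *\<^sub>R ?q \<theta>)
          \<le> C * norm (complex_of_real \<theta>) * (norm (?p \<theta>) + norm (?q \<theta>))"
        using lip(2)[OF t db] unfolding UW(6)[OF t] g2 by simp
      also have "\<dots> \<le> C * r * (norm (?p \<theta>) + norm (?q \<theta>))"
        using nt C by (intro mult_right_mono mult_left_mono) auto
      finally show "norm (\<theta> *\<^sub>R (complex_of_real ((rho_rhs \<rho> \<omega> \<theta> - v \<theta>) / \<theta>) - deriv W (of_real \<theta>)) + 1 *\<^sub>R ?q \<theta>)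
          \<le> C * r * (norm (?p \<theta>) + norm (?q \<theta>)) + 0" by simp
      show "norm (?p \<theta>) \<le> 4 + \<bar>V\<bar>" using db norm_triangle_ineq4[of "complex_of_real (\<omega> \<theta>)" "U (of_real \<theta>)"] by linarith
      have "norm (W (of_real \<theta>)) \<le> 1" using UW(4)[OF t] by simp
      then show "norm (?q \<theta>) \<le> 4 + \<bar>V\<bar>" using db(2) norm_triangle_ineq4[of "complex_of_real (v \<theta>)" "W (of_real \<theta>)"] by linarith
    qed (use r T in auto)
    moreover have "0 \<le> 4 * C * norm (?q T)" "0 \<le> norm (?p T)" using C by auto
    ultimately have "norm (?p T) = 0" "4 * C * norm (?q T) = 0" by linarith+
    then show ?thesis using C by auto
  qed
  have "(0::complex) \<in> ?B" using r by simp
  from UW(5)[OF this] have U0: "U 0 = 1 / 3" by (simp add: G1_def eq_divide_eq mult.commute)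
  show ?thesis
  proof (rule exI[of _ r], intro conjI, rule r(1), rule exI[of _ "\<lambda>t. ?c + t * W t"], rule exI[of _ U], intro conjI allI impI)
    show "(\<lambda>t. ?c + t * W t) holomorphic_on ?B" by (intro holomorphic_intros UW)
    fix y assume y: "0 < y \<and> y < r"
    show "?c + of_real y * W (of_real y) = of_real (\<rho> y)"
    proof -
      have "of_real y * W (of_real y) = complex_of_real (y * v y)" using same[of y] y by simp
      then show ?thesis using y by (simp add: v_def flip: of_real_add)
    qed
    show "U (of_real y) = of_real (\<omega> y)" using same[of y] y by simp
  qed (use UW r U0 in auto)
qed

text \<open>
  In the region on the left \<open>\<rho>' = - \<kappa> \<rho>\<close> with \<open>0 \<le> \<kappa> \<le> 2\<close>. So \<open>\<rho>\<close> is decreasing in \<open>y\<close>, bounded by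
  \<open>\<rho>(1) e\<^sup>2\<close>, hence Lipschitz, and its supremum is the limit at \<open>0\<close>.
\<close>

lemma centre_limit:
  assumes f: "flow_on {0<..1} x s"
    and reg: "\<And>y. 0 < y \<Longrightarrow> y \<le> 1 \<Longrightarrow> y < 3 * x y \<and> 2 * x y < y \<and> x y < s y \<and> s y < 1"
  shows "\<exists>c>0. \<exists>V. \<forall>y. 0 < y \<and> y \<le> 1 \<longrightarrow> \<bar>s y / y - c\<bar> \<le> V * y"
proof -
  define \<rho> where "\<rho> y = s y / y" for y
  define \<kappa> where "\<kappa> y = 2 * (x y / y) * (s y - x y) / (1 - (x y)\<^sup>2)" for y
  have d\<rho>: "(\<rho> has_real_derivative - \<kappa> y * \<rho> y) (at y)" and \<kappa>: "0 \<le> \<kappa> y" "\<kappa> y \<le> 2" and \<rho>0: "\<rho> y > 0" if y: "0 < y" "y \<le> 1" for y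
  proof -
    note D = flow_onD[OF f, of y]
    have yI: "y \<in> {0<..1}" using y by simp
    note r = reg[OF y]
    have x: "0 < x y" "x y < 1 / 2" using r y by auto
    have "(x y)\<^sup>2 \<le> (1 / 2)\<^sup>2" using x by (intro power_mono) auto
    then have D0: "1 - (x y)\<^sup>2 \<ge> 3 / 4" by (simp add: power2_eq_square)
    have q: "0 \<le> x y / y" "x y / y \<le> 1 / 2" using x r y by (auto simp: field_simps)
    have "2 * (x y / y) * (s y - x y) \<le> 2 * (1 / 2) * 1" using q r x by (intro mult_mono) auto
    then have "\<kappa> y \<le> 1 / (3 / 4)" unfolding \<kappa>_def using D0 by (intro frac_le) auto
    then show "\<kappa> y \<le> 2" by simp
    show "0 \<le> \<kappa> y" unfolding \<kappa>_def using q r D0 by (intro divide_nonneg_nonneg mult_nonneg_nonneg) auto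
    show "\<rho> y > 0" using r x y by (simp add: \<rho>_def)
    have "(\<rho> has_real_derivative rho_rhs (\<lambda>y. s y / y) (\<lambda>y. x y / y) y) (at y)"
      unfolding \<rho>_def by (rule flow_rho_omega(1)[OF f yI])
    moreover have "rho_rhs (\<lambda>y. s y / y) (\<lambda>y. x y / y) y = - \<kappa> y * \<rho> y"
    proof -
      have "y\<^sup>2 * (x y / y)\<^sup>2 = (x y)\<^sup>2" using y by (simp add: power_divide)
      then show ?thesis unfolding rho_rhs_def \<kappa>_def \<rho>_def using y D0 by (simp add: divide_simps)
    qed
    ultimately show "(\<rho> has_real_derivative - \<kappa> y * \<rho> y) (at y)" by simp
  qed
  have anti: "\<rho> v \<le> \<rho> u" if "0 < u" "u \<le> v" "v \<le> 1" for u v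
  proof (rule DERIV_nonpos_imp_nonincreasing[OF that(2)])
    fix y assume y: "u \<le> y" "y \<le> v"
    have "- \<kappa> y * \<rho> y \<le> 0" using \<kappa>[of y] \<rho>0[of y] y that by (auto intro!: mult_nonneg_nonneg)
    then show "\<exists>l. (\<rho> has_real_derivative l) (at y) \<and> l \<le> 0" using d\<rho>[of y] y that by auto
  qed
  define R where "R = \<rho> 1 * exp 2"
  have upper: "\<rho> u \<le> R" if u: "0 < u" "u \<le> 1" for u
  proof -
    have "\<rho> u * exp (2 * u) \<le> \<rho> 1 * exp (2 * 1)"
    proof (rule DERIV_nonneg_imp_nondecreasing[OF u(2), where f = "\<lambda>y. \<rho> y * exp (2 * y)"])
      fix y assume y: "u \<le> y" "y \<le> 1"
      have "((\<lambda>y. \<rho> y * exp (2 * y)) has_real_derivative (2 - \<kappa> y) * \<rho> y * exp (2 * y)) (at y)"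
        using y u by (auto intro!: derivative_eq_intros d\<rho> simp: algebra_simps)
      moreover have "0 \<le> (2 - \<kappa> y) * \<rho> y * exp (2 * y)"
        using \<kappa>[of y] \<rho>0[of y] y u by (intro mult_nonneg_nonneg) auto
      ultimately show "\<exists>l. ((\<lambda>y. \<rho> y * exp (2 * y)) has_real_derivative l) (at y) \<and> 0 \<le> l" by blast
    qed
    moreover have "\<rho> u * 1 \<le> \<rho> u * exp (2 * u)" using \<rho>0[OF u] u by (intro mult_left_mono) auto
    ultimately show ?thesis by (simp add: R_def)
  qed
  have lip: "\<rho> u \<le> \<rho> v + 2 * R * v" if "0 < u" "u \<le> v" "v \<le> 1" for u v
  proof -
    have "\<rho> u + 2 * R * u \<le> \<rho> v + 2 * R * v"
    proof (rule DERIV_nonneg_imp_nondecreasing[OF that(2), where f = "\<lambda>y. \<rho> y + 2 * R * y"])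
      fix y assume y: "u \<le> y" "y \<le> v"
      have y01: "0 < y" "y \<le> 1" using y that by auto
      have "((\<lambda>y. \<rho> y + 2 * R * y) has_real_derivative - \<kappa> y * \<rho> y + 2 * R) (at y)"
        by (auto intro!: derivative_eq_intros d\<rho> y01)
      moreover have "\<kappa> y * \<rho> y \<le> 2 * R" using \<kappa>[OF y01] \<rho>0[OF y01] upper[OF y01] by (intro mult_mono) auto
      ultimately show "\<exists>l. ((\<lambda>y. \<rho> y + 2 * R * y) has_real_derivative l) (at y) \<and> 0 \<le> l" by (intro exI conjI) auto
    qed
    moreover have "0 \<le> 2 * R * u" using upper[of 1] \<rho>0[of 1] that by auto
    ultimately show ?thesis by linarith
  qed
  define c where "c = Sup (\<rho> ` {0<..1})"
  have bdd: "bdd_above (\<rho> ` {0<..1})" using upper by (intro bdd_aboveI2[of _ _ R]) auto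
  have le: "\<rho> y \<le> c" if "0 < y" "y \<le> 1" for y unfolding c_def using that bdd by (intro cSup_upper) auto
  have ge: "c \<le> \<rho> y + 2 * R * y" if y: "0 < y" "y \<le> 1" for y
    unfolding c_def
  proof (rule cSup_least)
    fix l assume "l \<in> \<rho> ` {0<..1}"
    then obtain u where u: "0 < u" "u \<le> 1" "l = \<rho> u" by auto
    have R0: "0 \<le> 2 * R * y" using upper[of 1] \<rho>0[of 1] y by auto
    show "l \<le> \<rho> y + 2 * R * y"
    proof (cases "u \<le> y")
      case True
      then show ?thesis using lip[OF u(1) True y(2)] u by simp
    next
      case False
      then show ?thesis using anti[of y u] u y R0 by simp
    qed
  qed auto
  have "c > 0" using le[of 1] \<rho>0[of 1] by simp
  moreover have "\<bar>\<rho> y - c\<bar> \<le> 2 * R * y" if "0 < y \<and> y \<le> 1" for y using le[of y] ge[of y] that by auto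
  ultimately show ?thesis unfolding \<rho>_def by blast
qed

section \<open>Behaviour at infinity\<close>

text \<open>
  Since \<open>s < 1\<close>, \<open>1 - x' = 2 x (x s - 1) / (y (x\<^sup>2 - 1)) \<le> 2 / y\<close>, so \<open>y - x\<close> grows at most logarithmically and
  \<open>x/y\<close> tends to \<open>1\<close>. The logarithm of \<open>x s\<close> has the derivative \<open>(y - x) / (x y)\<close>, which is integrable by the same
  bound together with \<open>x > y/3\<close>; so the increasing function \<open>x s\<close> has a finite limit.
\<close>

lemma far_field:
  assumes f: "flow_on {z<..} x s" and z: "z \<ge> 1"
    and reg: "\<And>y. y > z \<Longrightarrow> 1 < x y \<and> 0 < s y \<and> s y < 1 \<and> 1 < x y * s y \<and> x y < y \<and> y < 3 * x y"
  shows "((\<lambda>y. x y / y) \<longlongrightarrow> 1) at_top" and "\<exists>c>0. ((\<lambda>y. y * s y) \<longlongrightarrow> c) at_top"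
proof -
  define a where "a = z + 1"
  have a: "a > z" "a > 1" using z by (auto simp: a_def)
  define K where "K = a - x a"
  have K: "0 < K" using reg[OF a(1)] by (simp add: K_def)
  have D: "(x has_real_derivative xdot y (x y) (s y)) (at y)" "(s has_real_derivative sdot y (x y) (s y)) (at y)"
    "(x y)\<^sup>2 \<noteq> 1" if "y \<ge> a" for y using flow_onD[OF f, of y] that a by auto
  have gap: "y - x y \<le> K + 2 * ln y" if y: "y \<ge> a" for y
  proof -
    have "(y - x y) - 2 * ln y \<le> (a - x a) - 2 * ln a"
    proof (rule DERIV_nonpos_imp_nonincreasing[OF y, where f = "\<lambda>y. (y - x y) - 2 * ln y"])
      fix w assume w: "a \<le> w" "w \<le> y"
      have r: "1 < x w" "0 < s w" "s w < 1" "1 < x w * s w" "x w < w" using reg[of w] w a by auto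
      have w0: "w > 0" using w a by simp
      have dd: "((\<lambda>y. (y - x y) - 2 * ln y) has_real_derivative (1 - xdot w (x w) (s w)) - 2 / w) (at w)"
        using w0 by (auto intro!: derivative_eq_intros D(1)[OF w(1)])
      have D0: "(x w)\<^sup>2 - 1 > 0" using r by (simp add: power2_eq_square less_1_mult)
      have xd: "1 - xdot w (x w) (s w) = 2 * (x w * (x w * s w - 1) / ((x w)\<^sup>2 - 1)) / w"
      proof -
        have "2 * x w * (1 - x w * s w) = - (2 * x w * (x w * s w - 1))" "w * (1 - (x w)\<^sup>2) = - (w * ((x w)\<^sup>2 - 1))"
          by (simp_all add: algebra_simps)
        then show ?thesis unfolding xdot_def by (simp only: minus_divide_divide) (simp add: mult_ac)
      qed
      have le1: "x w * (x w * s w - 1) / ((x w)\<^sup>2 - 1) \<le> 1"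
      proof -
        have "x w * s w \<le> x w * 1" using r by (intro mult_left_mono) auto
        then have "x w * (x w * s w - 1) \<le> x w * (x w - 1)" using r by (intro mult_left_mono) auto
        also have "\<dots> \<le> (x w)\<^sup>2 - 1" using r by (simp add: power2_eq_square algebra_simps)
        finally show ?thesis using D0 by simp
      qed
      have "1 - xdot w (x w) (s w) \<le> 2 * 1 / w"
        unfolding xd using le1 w0 by (intro divide_right_mono mult_left_mono) auto
      then show "\<exists>l. ((\<lambda>y. (y - x y) - 2 * ln y) has_real_derivative l) (at w) \<and> l \<le> 0"
        using dd by (intro exI conjI) auto
    qed
    moreover have "ln a \<ge> 0" using a by simp
    ultimately show ?thesis by (simp add: K_def)
  qed
  have lim0: "((\<lambda>y. (K + 2 * ln y) / y) \<longlongrightarrow> 0) at_top"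
  proof -
    have "((\<lambda>y. K * (1 / y) + 2 * (ln y / y)) \<longlongrightarrow> K * 0 + 2 * 0) at_top"
      by (intro tendsto_intros ln_x_over_x_tendsto_0 tendsto_divide_0[OF tendsto_const] filterlim_at_top_imp_at_infinity filterlim_ident)
    then show ?thesis by (simp add: add_divide_distrib)
  qed
  have "((\<lambda>y. 1 - x y / y) \<longlongrightarrow> 0) at_top"
  proof (rule tendsto_sandwich[OF _ _ tendsto_const lim0])
    show "\<forall>\<^sub>F y in at_top. 0 \<le> 1 - x y / y"
      using eventually_ge_at_top[of a]
    proof eventually_elim
      case (elim y)
      then show ?case using reg[of y] a by simp
    qed
    show "\<forall>\<^sub>F y in at_top. 1 - x y / y \<le> (K + 2 * ln y) / y"
      using eventually_ge_at_top[of a]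
    proof eventually_elim
      case (elim y)
      then have "(y - x y) / y \<le> (K + 2 * ln y) / y" using gap a by (intro divide_right_mono) auto
      then show ?case using elim a by (simp add: diff_divide_distrib)
    qed
  qed
  from tendsto_diff[OF tendsto_const[of 1] this] show lim1: "((\<lambda>y. x y / y) \<longlongrightarrow> 1) at_top" by simp
  define q where "q y = x y * s y" for y
  have dq: "(q has_real_derivative s y * (1 - x y / y)) (at y)" if y: "y \<ge> a" for y
  proof -
    have "(q has_real_derivative xdot y (x y) (s y) * s y + sdot y (x y) (s y) * x y) (at y)"
      unfolding q_def using DERIV_mult[OF D(1)[OF y] D(2)[OF y]] by simp
    then show ?thesis using product_identity[of y "x y" "s y"] D(3)[OF y] y a by simp
  qed
  have mono: "q u \<le> q v" if "a \<le> u" "u \<le> v" for u v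
  proof (rule DERIV_nonneg_imp_nondecreasing[OF that(2)])
    fix y assume y: "u \<le> y" "y \<le> v"
    have "0 \<le> s y * (1 - x y / y)" using reg[of y] y that a by (intro mult_nonneg_nonneg) auto
    then show "\<exists>l. (q has_real_derivative l) (at y) \<and> 0 \<le> l" using dq[of y] y that by auto
  qed
  have q1: "1 < q y" if "y \<ge> a" for y using reg[of y] that a by (auto simp: q_def)
  \<comment> \<open>\<open>- E'\<close> is the majorant \<open>3 (K + 2 ln y) / y\<^sup>2\<close> of the derivative of \<open>ln (x s)\<close>.\<close>
  define E where "E y = 3 * (K + 2 + 2 * ln y) / y" for y
  have E0: "0 \<le> E y" if "y \<ge> a" for y using that a K by (auto simp: E_def)
  have bound: "q y \<le> exp (ln (q a) + E a)" if y: "y \<ge> a" for y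
  proof -
    have "ln (q y) + E y \<le> ln (q a) + E a"
    proof (rule DERIV_nonpos_imp_nonincreasing[OF y, where f = "\<lambda>y. ln (q y) + E y"])
      fix w assume w: "a \<le> w" "w \<le> y"
      have w0: "w > 0" using w a by simp
      have r: "1 < x w" "0 < s w" "x w < w" "w < 3 * x w" using reg[of w] w a by auto
      have dE: "(E has_real_derivative - (3 * (K + 2 * ln w) / w\<^sup>2)) (at w)"
        unfolding E_def using w0 by (auto intro!: derivative_eq_intros simp: power2_eq_square field_simps)
      have dl: "((\<lambda>y. ln (q y)) has_real_derivative s w * (1 - x w / w) / q w) (at w)"
        using q1[OF w(1)] by (auto intro!: derivative_eq_intros dq w)
      have "s w * (1 - x w / w) / q w = (w - x w) / (x w * w)" using r w0 by (simp add: q_def divide_simps)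
      also have "\<dots> \<le> (K + 2 * ln w) / (w / 3 * w)"
        using r w0 gap[OF w(1)] by (intro frac_le mult_right_mono) auto
      also have "\<dots> = 3 * (K + 2 * ln w) / w\<^sup>2" using w0 by (simp add: power2_eq_square field_simps)
      finally have "s w * (1 - x w / w) / q w + - (3 * (K + 2 * ln w) / w\<^sup>2) \<le> 0" by linarith
      with DERIV_add[OF dl dE]
      show "\<exists>l. ((\<lambda>y. ln (q y) + E y) has_real_derivative l) (at w) \<and> l \<le> 0" by blast
    qed
    then have "ln (q y) \<le> ln (q a) + E a" using E0[OF y] by simp
    then show ?thesis using q1[OF y] by (metis exp_le_cancel_iff exp_ln less_trans zero_less_one)
  qed
  define c where "c = Sup (q ` {a..})"
  have bdd: "bdd_above (q ` {a..})" using bound by (auto intro!: bdd_aboveI2)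
  have qc: "q y \<le> c" if "y \<ge> a" for y unfolding c_def using that bdd by (intro cSup_upper) auto
  have "(q \<longlongrightarrow> c) at_top"
  proof (rule order_tendstoI)
    fix l assume "l < c"
    then obtain u where u: "u \<ge> a" "l < q u" unfolding c_def using less_cSup_iff[OF _ bdd] by auto
    show "\<forall>\<^sub>F y in at_top. l < q y"
      using eventually_ge_at_top[of u] by eventually_elim (use mono u in \<open>force intro: less_le_trans\<close>)
  next
    fix l assume "c < l"
    show "\<forall>\<^sub>F y in at_top. q y < l"
      using eventually_ge_at_top[of a] by eventually_elim (use qc \<open>c < l\<close> in \<open>force intro: le_less_trans\<close>)
  qed
  from tendsto_divide[OF this lim1] have "((\<lambda>y. q y / (x y / y)) \<longlongrightarrow> c) at_top" by simp
  moreover have "\<forall>\<^sub>F y in at_top. q y / (x y / y) = y * s y"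
    using eventually_ge_at_top[of a]
  proof eventually_elim
    case (elim y)
    then have "x y > 0" "y > 0" using reg[of y] a by auto
    then show ?case by (simp add: q_def)
  qed
  ultimately have "((\<lambda>y. y * s y) \<longlongrightarrow> c) at_top" by (rule Lim_transform_eventually)
  moreover have "c > 0" using qc[of a] q1[of a] by simp
  ultimately show "\<exists>c>0. ((\<lambda>y. y * s y) \<longlongrightarrow> c) at_top" by blast
qed

section \<open>Assembling the profile\<close>

text \<open>
  Multiplication by \<open>y = z + t\<close> turns the required expansions of \<open>\<rho>\<close> and \<open>\<omega>\<close> into those of \<open>s\<close> and \<open>x\<close>, up to an
  exact cubic term.
\<close>

lemma rho_expansion:
  fixes z t :: real
  assumes z: "2 \<le> z"
  shows "(z + t) * (1 / z - 1 / z\<^sup>2 * t + (- z\<^sup>2 + 6 * z - 7) / (2 * z ^ 3 * (2 * z - 3)) * t\<^sup>2)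
    = 1 + curv0 z * t\<^sup>2 + (- z\<^sup>2 + 6 * z - 7) / (2 * z ^ 3 * (2 * z - 3)) * t ^ 3"
proof -
  have nz: "z \<noteq> 0" "2 * z - 3 \<noteq> 0" using z by auto
  have A: "(- z\<^sup>2 + 6 * z - 7) / (2 * z ^ 3 * (2 * z - 3)) * z - 1 / z\<^sup>2 = curv0 z"
    unfolding curv0_def using nz
    by (simp add: divide_simps) (simp add: power2_eq_square power3_eq_cube algebra_simps)
  have B: "(z + t) * (1 / z - 1 / z\<^sup>2 * t + e * t\<^sup>2) = 1 + (e * z - 1 / z\<^sup>2) * t\<^sup>2 + e * t ^ 3" for e
    using nz by (simp add: divide_simps) (simp add: power2_eq_square power3_eq_cube algebra_simps)
  show ?thesis by (simp only: A B)
qed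

lemma omega_expansion:
  fixes z t :: real
  assumes z: "2 \<le> z"
  shows "(z + t) * (1 / z + 1 / z * (1 - 2 / z) * t + (- 5 * z\<^sup>2 + 19 * z - 17) / (2 * z ^ 3 * (2 * z - 3)) * t\<^sup>2)
    = 1 + (1 - 1 / z) * t + bend0 z * t\<^sup>2 + (- 5 * z\<^sup>2 + 19 * z - 17) / (2 * z ^ 3 * (2 * z - 3)) * t ^ 3"
proof -
  have nz: "z \<noteq> 0" "2 * z - 3 \<noteq> 0" using z by auto
  have A: "(- 5 * z\<^sup>2 + 19 * z - 17) / (2 * z ^ 3 * (2 * z - 3)) * z + 1 / z * (1 - 2 / z) = bend0 z"
    unfolding bend0_def using nz
    by (simp add: divide_simps) (simp add: power2_eq_square power3_eq_cube algebra_simps)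
  have B: "(z + t) * (1 / z + 1 / z * (1 - 2 / z) * t + e * t\<^sup>2)
      = 1 + (1 - 1 / z) * t + (e * z + 1 / z * (1 - 2 / z)) * t\<^sup>2 + e * t ^ 3" for e
    using nz by (simp add: divide_simps) (simp add: power2_eq_square power3_eq_cube algebra_simps)
  show ?thesis by (simp only: A B)
qed

lemma cubic_remainder_bigo:
  fixes f p g :: "real \<Rightarrow> real"
  assumes d: "d > 0"
    and f: "\<And>y. y \<noteq> z \<Longrightarrow> \<bar>y - z\<bar> < d \<Longrightarrow> y > 1 \<and> y * f y = g y"
    and g: "\<And>y. y \<noteq> z \<Longrightarrow> \<bar>y - z\<bar> < d \<Longrightarrow> \<bar>g y - q y\<bar> \<le> M * \<bar>y - z\<bar> ^ 3"
    and p: "\<And>y. y \<noteq> z \<Longrightarrow> \<bar>y - z\<bar> < d \<Longrightarrow> y * p y = q y + e * (y - z) ^ 3"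
  shows "(\<lambda>y. f y - p y) \<in> O[at z](\<lambda>y. \<bar>y - z\<bar> ^ 3)"
proof (rule bigoI[of _ "M + \<bar>e\<bar>"])
  have "\<forall>\<^sub>F y in at z. y \<noteq> z \<and> \<bar>y - z\<bar> < d"
    using d unfolding eventually_at by (auto simp: dist_real_def intro!: exI[of _ d])
  then show "\<forall>\<^sub>F y in at z. norm (f y - p y) \<le> (M + \<bar>e\<bar>) * norm (\<bar>y - z\<bar> ^ 3)"
  proof eventually_elim
    case (elim y)
    then have y: "y > 1" "y * f y = g y" using f by auto
    have e3: "\<bar>e * (y - z) ^ 3\<bar> = \<bar>e\<bar> * \<bar>y - z\<bar> ^ 3" by (simp add: abs_mult power_abs)
    have "y * (f y - p y) = (g y - q y) - e * (y - z) ^ 3" using y(2) p[of y] elim by (simp add: right_diff_distrib)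
    then have "\<bar>y * (f y - p y)\<bar> \<le> \<bar>g y - q y\<bar> + \<bar>e * (y - z) ^ 3\<bar>" by (simp add: abs_triangle_ineq4)
    also have "\<dots> \<le> (M + \<bar>e\<bar>) * \<bar>y - z\<bar> ^ 3" unfolding e3 using g[of y] elim by (simp add: algebra_simps)
    finally have "\<bar>y\<bar> * \<bar>f y - p y\<bar> \<le> (M + \<bar>e\<bar>) * \<bar>y - z\<bar> ^ 3" by (simp only: abs_mult)
    moreover have "1 * \<bar>f y - p y\<bar> \<le> \<bar>y\<bar> * \<bar>f y - p y\<bar>" using y by (intro mult_right_mono) auto
    ultimately show ?case by simp
  qed
qed

text \<open>
  The solutions on the two sides of the critical \<open>z\<close> are joined through the germ, which is analytic across \<open>z\<close>, and
  then translated back by \<open>\<rho> = s/y\<close>, \<open>\<omega> = x/y\<close>. The values at \<open>0\<close> are the limits \<open>c\<close> and \<open>1/3\<close>.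
\<close>

theorem theorem1p2:
  shows "\<exists>z::real. 2 < z \<and> z < 3 \<and> (\<exists>\<rho> \<omega> :: real \<Rightarrow> real.
    real_analytic_half_line \<rho> \<and> real_analytic_half_line \<omega> \<and>
    (\<forall>y\<in>{0<..} - {z}.
       (\<rho> has_real_derivative rho_rhs \<rho> \<omega> y) (at y) \<and>
       (\<omega> has_real_derivative omega_rhs \<rho> \<omega> y) (at y)) \<and>
    removable_at_0_and z (rho_rhs \<rho> \<omega>) \<and> removable_at_0_and z (omega_rhs \<rho> \<omega>) \<and>
    \<omega> 0 = 1 / 3 \<and> \<rho> 0 > 0 \<and>
    (\<exists>c>0. ((\<lambda>y. y\<^sup>2 * \<rho> y) \<longlongrightarrow> c) at_top) \<and>
    (\<omega> \<longlongrightarrow> 1) at_top \<and>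
    (\<forall>y. sonic_point \<omega> y \<longleftrightarrow> y = z) \<and>
    (\<lambda>y. \<rho> y - (1 / z - 1 / z\<^sup>2 * (y - z)
            + (- z\<^sup>2 + 6 * z - 7) / (2 * z ^ 3 * (2 * z - 3)) * (y - z)\<^sup>2))
       \<in> O[at z](\<lambda>y. \<bar>y - z\<bar> ^ 3) \<and>
    (\<lambda>y. \<omega> y - (1 / z + 1 / z * (1 - 2 / z) * (y - z)
            + (- 5 * z\<^sup>2 + 19 * z - 17) / (2 * z ^ 3 * (2 * z - 3)) * (y - z)\<^sup>2))
       \<in> O[at z](\<lambda>y. \<bar>y - z\<bar> ^ 3) \<and>
    (\<forall>y\<ge>0. \<rho> y > 0) \<and>
    (\<forall>y>0. - (2 / 3) * y \<le> velocity \<omega> y \<and> velocity \<omega> y < 0))"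
proof -
  obtain \<delta> M X S where g: "0 < \<delta>" "\<delta> \<le> 1 / 8" "M \<ge> 1"
    "\<And>z. z \<in> {2..3} \<Longrightarrow> flow_on ({z - \<delta><..<z + \<delta>} - {z}) (X z) (S z)"
    and ghol: "\<And>z. z \<in> {2..3} \<Longrightarrow> \<exists>F G. F holomorphic_on ball (of_real z) \<delta> \<and> G holomorphic_on ball (of_real z) \<delta> \<and>
        (\<forall>y. \<bar>y - z\<bar> < \<delta> \<longrightarrow> F (of_real y) = of_real (X z y) \<and> G (of_real y) = of_real (S z y))"
    and gX: "\<And>z y. z \<in> {2..3} \<Longrightarrow> \<bar>y - z\<bar> < \<delta> \<Longrightarrow>
        \<bar>X z y - (1 + (1 - 1 / z) * (y - z) + bend0 z * (y - z)\<^sup>2)\<bar> \<le> M * \<bar>y - z\<bar> ^ 3"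
    and gS: "\<And>z y. z \<in> {2..3} \<Longrightarrow> \<bar>y - z\<bar> < \<delta> \<Longrightarrow> \<bar>S z y - (1 + curv0 z * (y - z)\<^sup>2)\<bar> \<le> M * \<bar>y - z\<bar> ^ 3"
    and gL: "\<And>z z' y. z \<in> {2..3} \<Longrightarrow> z' \<in> {2..3} \<Longrightarrow> \<bar>y - z\<bar> < \<delta> \<Longrightarrow> \<bar>y - z'\<bar> < \<delta> \<Longrightarrow>
        \<bar>X z y - X z' y\<bar> \<le> M * \<bar>z - z'\<bar> \<and> \<bar>S z y - S z' y\<bar> \<le> M * \<bar>z - z'\<bar>"
    by (rule sonic_germ_exists) blast
  interpret sonic_germ \<delta> M X S
    by unfold_locales (fact g gX gS gL)+
  obtain z where z: "z \<in> {2<..<3}" and no: "\<not> falls_below z" "\<not> rises_above z" using critical_parameter by blast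
  have z23: "z \<in> {2..3}" and z2: "2 < z" "z < 3" using z by auto
  obtain xl sl where L: "flow_on {0<..<z} xl sl" "\<And>y. y \<in> {z - d<..<z} \<Longrightarrow> xl y = X z y \<and> sl y = S z y"
    "\<And>y. y \<in> {0<..<z} \<Longrightarrow> y < 3 * xl y \<and> 2 * xl y < y \<and> xl y < sl y \<and> sl y < 1"
    using left_solution[OF z no] by blast
  obtain xr sr where R: "flow_on {z<..} xr sr" "\<And>y. y \<in> {z<..<z + d} \<Longrightarrow> xr y = X z y \<and> sr y = S z y"
    "\<And>y. y > z \<Longrightarrow> 1 < xr y \<and> 0 < sr y \<and> sr y < 1 \<and> 1 < xr y * sr y \<and> xr y < y \<and> y < 3 * xr y"
    using right_solution[OF z23] by blast
  have Xz: "X z z = 1" "S z z = 1" using gX[OF z23, of z] gS[OF z23, of z] \<delta> by auto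
  define x s where "x y = (if y < z then xl y else if y = z then 1 else xr y)"
    and "s y = (if y < z then sl y else if y = z then 1 else sr y)" for y
  have germ: "x y = X z y \<and> s y = S z y" if "\<bar>y - z\<bar> < d" for y
    using L(2)[of y] R(2)[of y] Xz that by (auto simp: x_def s_def abs_less_iff)
  have fL: "flow_on {0<..<z} x s" by (rule flow_on_cong_open[OF L(1)]) (auto simp: x_def s_def)
  have fR: "flow_on {z<..} x s" by (rule flow_on_cong_open[OF R(1)]) (auto simp: x_def s_def)
  have regL: "y < 3 * x y \<and> 2 * x y < y \<and> x y < s y \<and> s y < 1" if "0 < y" "y < z" for y
    using L(3)[of y] that by (simp add: x_def s_def)
  have regR: "1 < x y \<and> 0 < s y \<and> s y < 1 \<and> 1 < x y * s y \<and> x y < y \<and> y < 3 * x y" if "y > z" for y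
    using R(3)[of y] that by (simp add: x_def s_def)
  have xz: "x z = 1" "s z = 1" by (simp_all add: x_def s_def)
  have fl: "flow_on ({0<..} - {z}) x s" using fL fR unfolding flow_on_def by force
  have f1: "flow_on {0<..1} x s" by (rule flow_on_subset[OF fL]) (use z2 in auto)
  obtain c V where c: "c > 0" "\<And>y. 0 < y \<Longrightarrow> y \<le> 1 \<Longrightarrow> \<bar>s y / y - c\<bar> \<le> V * y"
  proof -
    have "\<And>y. 0 < y \<Longrightarrow> y \<le> 1 \<Longrightarrow> y < 3 * x y \<and> 2 * x y < y \<and> x y < s y \<and> s y < 1" using regL z2 by auto
    from centre_limit[OF f1 this] that show ?thesis by blast
  qed
  define \<rho> \<omega> where "\<rho> y = (if y \<le> 0 then c else s y / y)" and "\<omega> y = (if y \<le> 0 then 1 / 3 else x y / y)" for y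
  have \<rho>p: "\<rho> y = s y / y" and \<omega>p: "\<omega> y = x y / y" if "y > 0" for y using that by (simp_all add: \<rho>_def \<omega>_def)
  have rhs: "rho_rhs \<rho> \<omega> y = rho_rhs (\<lambda>y. s y / y) (\<lambda>y. x y / y) y"
    "omega_rhs \<rho> \<omega> y = omega_rhs (\<lambda>y. s y / y) (\<lambda>y. x y / y) y" if "y > 0" for y
    using that by (simp_all add: rho_rhs_def omega_rhs_def \<rho>p \<omega>p)
  have ode: "(\<rho> has_real_derivative rho_rhs \<rho> \<omega> y) (at y)" "(\<omega> has_real_derivative omega_rhs \<rho> \<omega> y) (at y)"
    if y: "y \<in> {0<..} - {z}" for y
  proof -
    have y0: "y > 0" "y \<in> {0<..}" using y by auto
    show "(\<rho> has_real_derivative rho_rhs \<rho> \<omega> y) (at y)"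
      unfolding rhs[OF y0(1)]
      by (rule has_field_derivative_transform_within_open[OF flow_rho_omega(1)[OF fl y] open_greaterThan y0(2)]) (simp add: \<rho>p)
    show "(\<omega> has_real_derivative omega_rhs \<rho> \<omega> y) (at y)"
      unfolding rhs[OF y0(1)]
      by (rule has_field_derivative_transform_within_open[OF flow_rho_omega(2)[OF fl y] open_greaterThan y0(2)]) (simp add: \<omega>p)
  qed
  have centre: "holomorphic_extension_at \<rho> 0 \<and> holomorphic_extension_at \<omega> 0"
  proof -
    have "\<exists>r>0. \<exists>P W. P holomorphic_on ball 0 r \<and> W holomorphic_on ball 0 r \<and> P 0 = of_real c \<and> W 0 = 1 / 3 \<and>
      (\<forall>y. 0 < y \<and> y < r \<longrightarrow> P (of_real y) = of_real (\<rho> y) \<and> W (of_real y) = of_real (\<omega> y))"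
    proof (rule centre_extension[OF zero_less_one])
      fix y :: real assume y: "0 < y" "y \<le> 1"
      then have yz: "y \<in> {0<..} - {z}" "y < z" using z2 by auto
      show "(\<rho> has_real_derivative rho_rhs \<rho> \<omega> y) (at y)" "(\<omega> has_real_derivative omega_rhs \<rho> \<omega> y) (at y)"
        using ode[OF yz(1)] by auto
      have "x y / y \<le> 1 / 2" "0 \<le> x y / y" using regL[OF y(1) yz(2)] y by (auto simp: field_simps)
      then show "\<bar>\<omega> y\<bar> \<le> 2" unfolding \<omega>p[OF y(1)] by linarith
      show "\<bar>\<rho> y - c\<bar> \<le> V * y" using c(2)[OF y] \<rho>p[OF y(1)] by simp
    qed
    then obtain r P W where r: "r > 0" "P holomorphic_on ball 0 r" "W holomorphic_on ball 0 r" "P 0 = of_real c" "W 0 = 1 / 3"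
      "\<And>y. 0 < y \<Longrightarrow> y < r \<Longrightarrow> P (of_real y) = of_real (\<rho> y) \<and> W (of_real y) = of_real (\<omega> y)" by blast
    have "P (of_real v) = of_real (\<rho> v) \<and> W (of_real v) = of_real (\<omega> v)" if "v \<ge> 0" "\<bar>v - 0\<bar> < r" for v
      using r(4-6) that by (cases "v = 0") (auto simp: \<rho>_def \<omega>_def)
    then show ?thesis unfolding holomorphic_extension_at_def using r(1-3) by (metis of_real_0)
  qed
  have ext: "holomorphic_extension_at \<rho> y \<and> holomorphic_extension_at \<omega> y" if y: "y \<ge> 0" for y
  proof -
    have pos: ?thesis if F: "r > 0" "F holomorphic_on ball (complex_of_real y) r" "G holomorphic_on ball (complex_of_real y) r"
      "\<And>v. \<bar>v - y\<bar> < r \<Longrightarrow> F (of_real v) = of_real (x v) \<and> G (of_real v) = of_real (s v)" and y0: "y > 0" for r F G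
      using holomorphic_extension_quotient[OF y0 F(1,3), of s \<rho>] holomorphic_extension_quotient[OF y0 F(1,2), of x \<omega>] F(4) \<rho>p \<omega>p by auto
    consider "y = 0" | "0 < y" "y < z" | "y = z" | "y > z" using y by linarith
    then show ?thesis
    proof cases
      case 1
      then show ?thesis using centre by simp
    next
      case 2
      then obtain r F G where "r > 0" "F holomorphic_on ball (of_real y) r" "G holomorphic_on ball (of_real y) r"
        "\<forall>v. \<bar>v - y\<bar> < r \<longrightarrow> F (of_real v) = of_real (x v) \<and> G (of_real v) = of_real (s v)"
        using flow_holomorphic_extension[OF fL, of y] by auto
      then show ?thesis using 2 by (intro pos[of r F G]) auto
    next
      case 3
      obtain F G where F: "F holomorphic_on ball (of_real z) \<delta>" "G holomorphic_on ball (of_real z) \<delta>"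
        "\<forall>y. \<bar>y - z\<bar> < \<delta> \<longrightarrow> F (of_real y) = of_real (X z y) \<and> G (of_real y) = of_real (S z y)"
        using ghol[OF z23] by blast
      have "ball (complex_of_real z) d \<subseteq> ball (of_real z) \<delta>" using d by auto
      then show ?thesis using F d germ z2 unfolding 3
        by (intro pos[of d F G, unfolded 3]) (auto intro: holomorphic_on_subset)
    next
      case 4
      have "flow_on {z<..<y + 1} x s" by (rule flow_on_subset[OF fR]) auto
      then obtain r F G where "r > 0" "F holomorphic_on ball (of_real y) r" "G holomorphic_on ball (of_real y) r"
        "\<forall>v. \<bar>v - y\<bar> < r \<longrightarrow> F (of_real v) = of_real (x v) \<and> G (of_real v) = of_real (s v)"
        using flow_holomorphic_extension[of z "y + 1" x s y] 4 by auto
      then show ?thesis using 4 z2 by (intro pos[of r F G]) auto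
    qed
  qed
  have removable: "removable_at_0_and z h" if f: "\<And>y. y \<ge> 0 \<Longrightarrow> holomorphic_extension_at f y"
    and df: "\<And>y. y \<in> {0<..} - {z} \<Longrightarrow> (f has_real_derivative h y) (at y)" for f h
  proof -
    obtain k where k: "\<forall>x\<ge>0. holomorphic_extension_at k x" "\<forall>y>0. (f has_real_derivative k y) (at y)"
      using holomorphic_extension_deriv[OF f] by blast
    have "h y = k y" if "y \<in> {0<..} - {z}" for y using DERIV_unique[OF df[OF that]] k(2) that by auto
    then show ?thesis unfolding removable_at_0_and_def using real_analytic_half_lineI[of k] k(1) by blast
  qed
  have xsq: "(x y)\<^sup>2 \<noteq> 1" if "y > 0" "y \<noteq> z" for y using flow_onD(2)[OF fl, of y] that by auto
  have sonic: "sonic_point \<omega> y \<longleftrightarrow> y = z" for y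
  proof (cases "y > 0")
    case True
    have "y\<^sup>2 * (\<omega> y)\<^sup>2 = (x y)\<^sup>2" using True by (simp add: \<omega>p power_divide)
    then show ?thesis unfolding sonic_point_def using True xsq[of y] xz by auto
  next
    case False
    then show ?thesis unfolding sonic_point_def using z2 by auto
  qed
  have far: "((\<lambda>y. x y / y) \<longlongrightarrow> 1) at_top" "\<exists>c>0. ((\<lambda>y. y * s y) \<longlongrightarrow> c) at_top"
    using far_field[OF fR _ regR] z2 by auto
  have lim1: "(\<omega> \<longlongrightarrow> 1) at_top"
    using far(1) by (rule Lim_transform_eventually) (use eventually_gt_at_top[of 0] in \<open>eventually_elim, simp add: \<omega>p\<close>)
  obtain c' where c': "c' > 0" "((\<lambda>y. y * s y) \<longlongrightarrow> c') at_top" using far(2) by blast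
  have lim2: "((\<lambda>y. y\<^sup>2 * \<rho> y) \<longlongrightarrow> c') at_top"
    using c'(2) by (rule Lim_transform_eventually)
      (use eventually_gt_at_top[of 0] in \<open>eventually_elim, simp add: \<rho>p power2_eq_square\<close>)
  have s0: "s y > 0" if "y > 0" for y
    using regL[of y] regR[of y] xz that by (cases y z rule: linorder_cases) auto
  have \<rho>pos: "\<rho> y > 0" for y using s0[of y] c(1) by (auto simp: \<rho>_def)
  have vel: "- (2 / 3) * y \<le> velocity \<omega> y \<and> velocity \<omega> y < 0" if y: "y > 0" for y
  proof -
    have "y \<le> 3 * x y \<and> x y < y"
      using regL[of y] regR[of y] xz z2 y by (cases y z rule: linorder_cases) auto
    moreover have "velocity \<omega> y = x y - y" using y by (simp add: velocity_def \<omega>p right_diff_distrib)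
    ultimately show ?thesis by auto
  qed
  have y1: "y > 1" if "\<bar>y - z\<bar> < d" for y using that d \<delta> z2 by auto
  have exp\<rho>: "(\<lambda>y. \<rho> y - (1 / z - 1 / z\<^sup>2 * (y - z) + (- z\<^sup>2 + 6 * z - 7) / (2 * z ^ 3 * (2 * z - 3)) * (y - z)\<^sup>2))
       \<in> O[at z](\<lambda>y. \<bar>y - z\<bar> ^ 3)"
  proof (rule cubic_remainder_bigo[where d = d and g = s and M = M and q = "\<lambda>y. 1 + curv0 z * (y - z)\<^sup>2"])
    fix y assume y: "y \<noteq> z" "\<bar>y - z\<bar> < d"
    show "1 < y \<and> y * \<rho> y = s y" using y1[OF y(2)] \<rho>p[of y] by auto
    show "\<bar>s y - (1 + curv0 z * (y - z)\<^sup>2)\<bar> \<le> M * \<bar>y - z\<bar> ^ 3" using gS[OF z23, of y] germ[OF y(2)] y d by auto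
    show "y * (1 / z - 1 / z\<^sup>2 * (y - z) + (- z\<^sup>2 + 6 * z - 7) / (2 * z ^ 3 * (2 * z - 3)) * (y - z)\<^sup>2)
        = 1 + curv0 z * (y - z)\<^sup>2 + (- z\<^sup>2 + 6 * z - 7) / (2 * z ^ 3 * (2 * z - 3)) * (y - z) ^ 3"
      using rho_expansion[of z "y - z"] y1[OF y(2)] z2 by simp
  qed (use d z2 in auto)
  have exp\<omega>: "(\<lambda>y. \<omega> y - (1 / z + 1 / z * (1 - 2 / z) * (y - z) + (- 5 * z\<^sup>2 + 19 * z - 17) / (2 * z ^ 3 * (2 * z - 3)) * (y - z)\<^sup>2))
       \<in> O[at z](\<lambda>y. \<bar>y - z\<bar> ^ 3)"
  proof (rule cubic_remainder_bigo[where d = d and g = x and M = M and q = "\<lambda>y. 1 + (1 - 1 / z) * (y - z) + bend0 z * (y - z)\<^sup>2"])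
    fix y assume y: "y \<noteq> z" "\<bar>y - z\<bar> < d"
    show "1 < y \<and> y * \<omega> y = x y" using y1[OF y(2)] \<omega>p[of y] by auto
    show "\<bar>x y - (1 + (1 - 1 / z) * (y - z) + bend0 z * (y - z)\<^sup>2)\<bar> \<le> M * \<bar>y - z\<bar> ^ 3"
      using gX[OF z23, of y] germ[OF y(2)] y d by auto
    show "y * (1 / z + 1 / z * (1 - 2 / z) * (y - z) + (- 5 * z\<^sup>2 + 19 * z - 17) / (2 * z ^ 3 * (2 * z - 3)) * (y - z)\<^sup>2)
        = 1 + (1 - 1 / z) * (y - z) + bend0 z * (y - z)\<^sup>2 + (- 5 * z\<^sup>2 + 19 * z - 17) / (2 * z ^ 3 * (2 * z - 3)) * (y - z) ^ 3"
      using omega_expansion[of z "y - z"] y1[OF y(2)] z2 by simp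
  qed (use d z2 in auto)
  have analytic: "real_analytic_half_line \<rho>" "real_analytic_half_line \<omega>"
    using ext by (auto intro: real_analytic_half_lineI)
  have rem: "removable_at_0_and z (rho_rhs \<rho> \<omega>)" "removable_at_0_and z (omega_rhs \<rho> \<omega>)"
    using removable[of \<rho> "rho_rhs \<rho> \<omega>"] removable[of \<omega> "omega_rhs \<rho> \<omega>"] ext ode by auto
  have \<omega>0: "\<omega> 0 = 1 / 3" by (simp add: \<omega>_def)
  have decay: "\<exists>c>0. ((\<lambda>y. y\<^sup>2 * \<rho> y) \<longlongrightarrow> c) at_top" using c'(1) lim2 by blast
  show ?thesis
    by (rule exI[of _ z], intro conjI, rule z2, rule z2, rule exI[of _ \<rho>], rule exI[of _ \<omega>], intro conjI ballI allI impI)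
      (rule analytic rem \<omega>0 lim1 decay sonic exp\<rho> exp\<omega> \<rho>pos | erule ode vel[THEN conjunct1] vel[THEN conjunct2])+
qed

end
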